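(* Let $1<p<\infty$, $p'=p/(p-1)$, $0<\alpha<n$, $w(x)=|x|^\theta$ on $\mathbb{R}^n$ with $0\le\theta<(n-1)(p-1)$, and $V(x)=|x|^a$ with $a>-\frac{n}{p}+\frac{(p'-1)\theta}{p}$. Then the following property holds if and only if $-\alpha<a\le0$: for any $\epsilon>0$ there exists $C(\epsilon)>0$ such that for any $\phi\in C_c^\infty(\mathbb{R}^n)$, $$\|V\phi\|_{L^p(w)}^p\le\epsilon\,\|(-\Delta)^{\frac{\alpha}{2}}\phi\|_{L^p(w)}^p+C(\epsilon)\|\phi\|_{L^p(w)}^p.$$
   Context: $\|f\|_{L^p(w)}^p=\int_{\mathbb{R}^n}|f|^pw\,dx$. $(-\Delta)^{\alpha/2}$ is the Fourier multiplier operator with symbol $|\xi|^\alpha$. *)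

theory Defs
  imports "HOL-Analysis.Analysis"
begin

(* Continuous partial derivatives up to order k on the whole space: the directional derivatives
   in all directions v are required to be of class C^(k-1). *)
primrec C_class :: "nat \<Rightarrow> ('a::euclidean_space \<Rightarrow> 'b::real_normed_vector) \<Rightarrow> bool" where
  "C_class 0 f \<longleftrightarrow> continuous_on UNIV f"
| "C_class (Suc k) f \<longleftrightarrow>
     f differentiable_on UNIV \<and> (\<forall>v. C_class k (\<lambda>x. frechet_derivative f (at x) v))"

definition test_functions :: "('a::euclidean_space \<Rightarrow> complex) set" where
  "test_functions = {\<phi>. (\<forall>k. C_class k \<phi>) \<and> compact (closure (support_on UNIV \<phi>))}"

definition fourier :: "('a::euclidean_space \<Rightarrow> complex) \<Rightarrow> 'a \<Rightarrow> complex" where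
  "fourier f \<xi> = (LINT x|lborel. cis (- (x \<bullet> \<xi>)) * f x)"

definition inverse_fourier :: "('a::euclidean_space \<Rightarrow> complex) \<Rightarrow> 'a \<Rightarrow> complex" where
  "inverse_fourier g x =
     of_real (1 / (2 * pi) ^ DIM('a)) * (LINT \<xi>|lborel. cis (x \<bullet> \<xi>) * g \<xi>)"

(* Meant for f whose transform, multiplied by m, is integrable; this is the case for test
   functions and measurable symbols m of polynomial growth. *)
definition fourier_multiplier ::
  "('a::euclidean_space \<Rightarrow> complex) \<Rightarrow> ('a \<Rightarrow> complex) \<Rightarrow> 'a \<Rightarrow> complex" where
  "fourier_multiplier m f = inverse_fourier (\<lambda>\<xi>. m \<xi> * fourier f \<xi>)"

(* (-Delta)^s *)
definition frac_laplacian :: "real \<Rightarrow> ('a::euclidean_space \<Rightarrow> complex) \<Rightarrow> 'a \<Rightarrow> complex" where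
  "frac_laplacian s = fourier_multiplier (\<lambda>\<xi>. of_real (norm \<xi> powr (2 * s)))"

(* The p-th power of the norm of L^p(w); the value is infinite if f is not in L^p(w). *)
definition Lp_norm_power ::
  "real \<Rightarrow> ('a::euclidean_space \<Rightarrow> real) \<Rightarrow> ('a \<Rightarrow> complex) \<Rightarrow> ennreal" where
  "Lp_norm_power p w f = (\<integral>\<^sup>+ x. ennreal (norm (f x) powr p * w x) \<partial>lborel)"

end

theory Submission
  imports Defs "HOL-Probability.Probability"
begin

text \<open>
  Write \<open>\<alpha> = 2 * s\<close>, \<open>b = - a\<close>, \<open>n\<close> for the dimension, \<open>u = |\<xi>|\<^sup>2\<close> for the symbol of the
  negative Laplacian, and \<open>G\<^sub>t\<close> for the heat kernel, which acts as the multiplier \<open>exp (- t u)\<close>.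
  Every operator that has to be bounded is written as a superposition of the heat operators \<open>G\<^sub>t\<close>, so that
  positive Gaussian kernels are the only kernels to be estimated.

  \<^bold>\<open>Sufficiency.\<close> For \<open>0 \<le> b < 2 * s\<close> the heart of the matter is the inequality \<open>weighted_hardy\<close>,
  which bounds \<open>|x| powr (- b) * f\<close> by \<open>f\<close> and \<open>(-\<Delta>)^s f\<close> in \<open>L^p\<close> with weight \<open>|x| powr \<theta>\<close>.
  It rests on the identity \<open>u powr s * u powr (- s) * (1 - exp (- u)) ^ N = (1 - exp (- u)) ^ N\<close>.
  On the left, \<open>u powr (- s) * (1 - exp (- u)) ^ N\<close> is up to a constant the Laplace transform of
  the \<open>N\<close>-th backward difference \<open>m\<close> of \<open>t powr (s - 1)\<close>; on the right, the binomial theorem produces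
  the identity plus heat operators at the times \<open>1, ..., N\<close>. Hence (\<open>heat_resolution\<close>) \<open>f\<close> is
  a constant multiple of \<open>\<integral> m(t) G\<^sub>t (-\<Delta>)^s f dt\<close> plus finitely many terms \<open>G\<^sub>k f\<close>. The operator
  \<open>|x| powr (- b) G\<^sub>t\<close> has norm of the order of \<open>t powr (- b / 2)\<close> on the weighted space, and
  \<open>|m(t)| * t powr (- b / 2)\<close> is integrable: near 0 because \<open>b < 2 * s\<close>, near infinity because
  taking \<open>N > s\<close> differences has improved the decay. This superposition is estimated in one go
  by a weighted Hoelder inequality (\<open>weighted_heat_superposition\<close>), which needs just two facts on Gaussian
  averages: they map \<open>|y| powr (- \<sigma>)\<close> to at most a multiple of itself for \<open>0 \<le> \<sigma> < n\<close>, used with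
  \<open>\<sigma> = \<theta> / (p - 1)\<close>, and they are at most \<open>t powr (- \<beta> / 2)\<close> up to a constant on
  \<open>|x| powr (- \<beta>)\<close>, used with \<open>\<beta> = b p\<close>. Applied to the dilates of \<open>f\<close>, the inequality
  then acquires the arbitrarily small constant in front of \<open>(-\<Delta>)^s f\<close>, since \<open>b < 2 * s\<close>.

  \<^bold>\<open>Necessity.\<close> Translating a fixed test function by a vector of length \<open>\<rho>\<close> multiplies the left hand side
  by about \<open>\<rho> powr (\<theta> + a p)\<close> and the right hand side by at most a multiple of \<open>\<rho> powr \<theta>\<close>, so \<open>a \<le> 0\<close>.
  Concentrating it at the origin shows that for \<open>a \<le> - \<alpha>\<close> the left hand side would be bounded by an
  arbitrarily small multiple of a constant. Both arguments need that \<open>(-\<Delta>)^s f\<close> lies in the weighted space, which is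
  \<open>weighted_power_frac_laplacian_finite\<close>; it follows from another superposition of heat operators,
  applied this time to \<open>f\<close> and its iterated Laplacians.
\<close>

section \<open>Gaussians and the heat kernel\<close>

lemma measurable_cis [measurable]: "cis \<in> borel_measurable borel"
  by (intro borel_measurable_continuous_onI continuous_intros)

lemma nn_integral_lborel_affine:
  fixes f :: "'a::euclidean_space \<Rightarrow> ennreal"
  assumes "c \<noteq> 0" and [measurable]: "f \<in> borel_measurable borel"
  shows "(\<integral>\<^sup>+x. f x \<partial>lborel) = ennreal (\<bar>c\<bar> ^ DIM('a)) * (\<integral>\<^sup>+x. f (t + c *\<^sub>R x) \<partial>lborel)"
  by (subst lborel_affine[OF assms(1), of t])
     (simp add: nn_integral_density nn_integral_distr nn_integral_cmult)

lemma nn_integral_lborel_reflect: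
  fixes f :: "'a::euclidean_space \<Rightarrow> ennreal"
  assumes [measurable]: "f \<in> borel_measurable borel"
  shows "(\<integral>\<^sup>+y. f (x - y) \<partial>lborel) = (\<integral>\<^sup>+y. f y \<partial>lborel)"
  using nn_integral_lborel_affine[of "-1" f x] by simp

lemma integral_lborel_shift:
  fixes f :: "'a::euclidean_space \<Rightarrow> 'b::{banach,second_countable_topology}"
  assumes [measurable]: "f \<in> borel_measurable borel"
  shows "(LINT x|lborel. f (t + x)) = (LINT x|lborel. f x)"
proof -
  have "(LINT x|lborel. f x) = (LINT x|distr lborel borel ((+) t). f x)"
    by (simp add: lborel_distr_plus)
  also have "\<dots> = (LINT x|lborel. f (t + x))"
    by (rule integral_distr) auto
  finally show ?thesis ..
qed

lemma integral_lborel_scale: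
  fixes f :: "'a::euclidean_space \<Rightarrow> 'b::{banach,second_countable_topology}"
  assumes c: "c \<noteq> 0" and [measurable]: "f \<in> borel_measurable borel"
  shows "(LINT x|lborel. f x) = (\<bar>c\<bar> ^ DIM('a)) *\<^sub>R (LINT x|lborel. f (c *\<^sub>R x))"
proof -
  have "(LINT x|lborel. f x) = (LINT x|density (distr lborel borel (\<lambda>x. 0 + c *\<^sub>R x)) (\<lambda>_. \<bar>c\<bar> ^ DIM('a)). f x)"
    using lborel_affine[OF c, of "0::'a"] by simp
  also have "\<dots> = (\<bar>c\<bar> ^ DIM('a)) *\<^sub>R (LINT x|lborel. f (c *\<^sub>R x))"
    by (subst integral_density) (auto simp: integral_distr)
  finally show ?thesis .
qed

text \<open>Up to the rescaling \<open>x \<mapsto> sqrt (2 * t) * x\<close> this is the characteristic function of the standard normal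
distribution.\<close>

lemma gaussian_fourier_1d:
  fixes t z :: real
  assumes t: "t > 0"
  shows "(LINT x|lborel. cis (x * z) * of_real (exp (- t * x\<^sup>2))) = of_real (sqrt (pi / t) * exp (- z\<^sup>2 / (4 * t)))"
proof -
  define c where "c = sqrt (2 * t)"
  have c: "c > 0" "c\<^sup>2 = 2 * t" using t by (auto simp: c_def)
  let ?h = "\<lambda>x::real. of_real (std_normal_density x) * cis (z / c * x)"
  have "complex_of_real (exp (- (z / c)\<^sup>2 / 2)) = char std_normal_distribution (z / c)"
    by (simp add: char_std_normal_distribution)
  also have "\<dots> = (LINT x|lborel. ?h x)"
    unfolding char_def by (subst integral_density) (auto simp: cis_conv_exp mult_ac scaleR_conv_of_real)
  also have "\<dots> = c *\<^sub>R (LINT x|lborel. ?h (c *\<^sub>R x))"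
    using c by (subst integral_lborel_scale[of c]) simp_all
  also have "(\<lambda>x. ?h (c *\<^sub>R x)) = (\<lambda>x. of_real (1 / sqrt (2 * pi)) * (cis (x * z) * of_real (exp (- t * x\<^sup>2))))"
    using c by (intro ext) (simp add: std_normal_density_def power_mult_distrib mult_ac)
  also have "(LINT x|lborel. \<dots> x) = of_real (1 / sqrt (2 * pi)) * (LINT x|lborel. cis (x * z) * of_real (exp (- t * x\<^sup>2)))"
    by (rule integral_mult_right_zero)
  finally have "complex_of_real (exp (- (z / c)\<^sup>2 / 2)) = of_real (c / sqrt (2 * pi)) * (LINT x|lborel. cis (x * z) * of_real (exp (- t * x\<^sup>2)))"
    by (simp add: scaleR_conv_of_real)
  moreover have "(z / c)\<^sup>2 / 2 = z\<^sup>2 / (4 * t)"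
    by (simp add: power_divide c)
  moreover have "sqrt (pi / t) * (c / sqrt (2 * pi)) = 1"
    using t by (simp add: c_def real_sqrt_mult real_sqrt_divide field_simps)
  ultimately show ?thesis
    by (metis (no_types, lifting) minus_divide_left mult.assoc mult.commute mult_1 of_real_1 of_real_mult)
qed

lemma integrable_gaussian_1d:
  fixes t :: real
  assumes t: "t > 0"
  shows "integrable lborel (\<lambda>x. exp (- t * x\<^sup>2))"
proof (rule ccontr)
  assume "\<not> ?thesis"
  hence "\<not> integrable lborel (\<lambda>x. complex_of_real (exp (- t * x\<^sup>2)))"
    by (simp only: complex_of_real_integrable_eq) simp
  hence "(LINT x|lborel. complex_of_real (exp (- t * x\<^sup>2))) = 0"
    by (rule not_integrable_integral_eq)
  hence "(LINT x|lborel. cis (x * 0) * of_real (exp (- t * x\<^sup>2))) = 0"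
    by simp
  thus False using gaussian_fourier_1d[OF t, of 0] t by simp
qed

lemma integral_lborel_prod:
  fixes f :: "'a::euclidean_space \<Rightarrow> real \<Rightarrow> 'b::{real_normed_field,banach,second_countable_topology}"
  assumes "\<And>b. b \<in> Basis \<Longrightarrow> integrable lborel (f b)"
  shows "(LINT x|lborel. (\<Prod>b\<in>Basis. f b (x \<bullet> b))) = (\<Prod>b\<in>Basis. (LINT x|lborel. f b x))"
    and "integrable lborel (\<lambda>x. \<Prod>b\<in>Basis. f b (x \<bullet> b))"
proof -
  interpret product_sigma_finite "\<lambda>_::'a. lborel::real measure" ..
  have [measurable]: "f b \<in> borel_measurable borel" if "b \<in> Basis" for b
    using assms[OF that] by simp
  have m: "(\<lambda>x. \<Prod>b\<in>Basis. f b (x \<bullet> b)) \<in> borel_measurable borel"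
    by measurable
  have T: "(\<lambda>g. \<Sum>b\<in>Basis. g b *\<^sub>R b) \<in> (\<Pi>\<^sub>M b\<in>(Basis::'a set). lborel) \<rightarrow>\<^sub>M (borel :: 'a measure)"
    by measurable
  have e: "(\<Sum>b\<in>Basis. g b *\<^sub>R b) \<bullet> (b::'a) = g b" if "b \<in> Basis" for g b
    using that by simp
  have "(LINT x|lborel. (\<Prod>b\<in>Basis. f b (x \<bullet> b))) = (LINT g|(\<Pi>\<^sub>M b\<in>(Basis::'a set). lborel). (\<Prod>b\<in>Basis. f b (g b)))"
    by (subst lborel_eq, subst integral_distr[OF T m]) (simp add: e)
  thus "(LINT x|lborel. (\<Prod>b\<in>Basis. f b (x \<bullet> b))) = (\<Prod>b\<in>Basis. (LINT x|lborel. f b x))"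
    using assms by (simp add: product_integral_prod)
  show "integrable lborel (\<lambda>x. \<Prod>b\<in>Basis. f b (x \<bullet> b))"
    by (subst lborel_eq, subst integrable_distr_eq[OF T m]) (simp add: e product_integrable_prod assms)
qed

lemma cis_sum: "finite A \<Longrightarrow> cis (sum f A) = (\<Prod>a\<in>A. cis (f a))"
  by (induction A rule: finite_induct) (auto simp: cis_mult[symmetric])

lemma norm_sq_eq_sum: "(norm (x::'a::euclidean_space))\<^sup>2 = (\<Sum>b\<in>Basis. (x \<bullet> b)\<^sup>2)"
  by (metis (no_types, lifting) euclidean_inner power2_eq_square power2_norm_eq_inner sum.cong)

lemma gaussian_fourier:
  fixes z :: "'a::euclidean_space"
  assumes t: "t > 0"
  shows "(LINT x|lborel. cis (x \<bullet> z) * of_real (exp (- t * (norm x)\<^sup>2))) =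
    of_real (sqrt (pi / t) ^ DIM('a) * exp (- (norm z)\<^sup>2 / (4 * t)))"
    and "integrable lborel (\<lambda>x::'a. exp (- t * (norm x)\<^sup>2))"
proof -
  have eq: "cis (x \<bullet> z) * of_real (exp (- t * (norm x)\<^sup>2)) =
     (\<Prod>b\<in>Basis. cis ((x \<bullet> b) * (z \<bullet> b)) * of_real (exp (- t * (x \<bullet> b)\<^sup>2)))" for x :: 'a
    by (simp add: prod.distrib euclidean_inner[of x z] cis_sum norm_sq_eq_sum sum_distrib_left
        exp_sum flip: of_real_prod sum_negf)
  have i: "integrable lborel (\<lambda>y::real. cis (y * (z \<bullet> b)) * of_real (exp (- t * y\<^sup>2)))" for b
  proof (rule Bochner_Integration.integrable_bound[OF integrable_gaussian_1d[OF t]])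
    show "(\<lambda>y::real. cis (y * (z \<bullet> b)) * of_real (exp (- t * y\<^sup>2))) \<in> borel_measurable lborel"
      by (simp add: cis_conv_exp)
  qed (simp add: norm_mult)
  have "(LINT x|lborel. cis (x \<bullet> z) * of_real (exp (- t * (norm x)\<^sup>2))) =
     (\<Prod>b\<in>Basis. (LINT y|lborel. cis (y * (z \<bullet> b)) * of_real (exp (- t * y\<^sup>2))))"
    unfolding eq by (rule integral_lborel_prod) (rule i)
  also have "\<dots> = (\<Prod>b\<in>(Basis::'a set). of_real (sqrt (pi / t) * exp (- (z \<bullet> b)\<^sup>2 / (4 * t))))"
    by (intro prod.cong refl gaussian_fourier_1d t)
  also have "\<dots> = of_real (sqrt (pi / t) ^ DIM('a) * exp (- (norm z)\<^sup>2 / (4 * t)))"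
    by (simp add: prod.distrib norm_sq_eq_sum exp_sum sum_divide_distrib flip: of_real_prod sum_negf)
  finally show "(LINT x|lborel. cis (x \<bullet> z) * of_real (exp (- t * (norm x)\<^sup>2))) =
    of_real (sqrt (pi / t) ^ DIM('a) * exp (- (norm z)\<^sup>2 / (4 * t)))" .
  have "integrable lborel (\<lambda>x::'a. \<Prod>b\<in>Basis. exp (- t * (x \<bullet> b)\<^sup>2))"
    by (rule integral_lborel_prod(2)) (rule integrable_gaussian_1d[OF t])
  thus "integrable lborel (\<lambda>x::'a. exp (- t * (norm x)\<^sup>2))"
    by (simp add: norm_sq_eq_sum sum_distrib_left exp_sum flip: sum_negf)
qed

definition heat_kernel :: "real \<Rightarrow> 'a::euclidean_space \<Rightarrow> real" where
  "heat_kernel t x = exp (- (norm x)\<^sup>2 / (4 * t)) / sqrt (4 * pi * t) ^ DIM('a)"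

lemma heat_kernel_nonneg [simp]: "t > 0 \<Longrightarrow> heat_kernel t x \<ge> 0"
  by (simp add: heat_kernel_def)

lemma heat_kernel_minus [simp]: "heat_kernel t (- x) = heat_kernel t x"
  by (simp add: heat_kernel_def)

lemma heat_kernel_swap: "heat_kernel t (x - y) = heat_kernel t (y - x)"
  by (simp add: heat_kernel_def norm_minus_commute)

lemma measurable_heat_kernel [measurable (raw)]:
  assumes [measurable]: "f \<in> borel_measurable M" "g \<in> borel_measurable M"
  shows "(\<lambda>x. heat_kernel (f x) (g x)) \<in> borel_measurable M"
  unfolding heat_kernel_def by measurable

lemma heat_kernel_fourier:
  fixes z :: "'a::euclidean_space"
  assumes t: "t > 0"
  shows "(LINT x|lborel. cis (x \<bullet> z) * of_real (heat_kernel t x)) = of_real (exp (- t * (norm z)\<^sup>2))"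
    and "integrable lborel (heat_kernel t :: 'a \<Rightarrow> real)"
proof -
  have eq: "heat_kernel t = (\<lambda>x::'a. exp (- (1/(4*t)) * (norm x)\<^sup>2) / sqrt (4 * pi * t) ^ DIM('a))"
    by (simp add: fun_eq_iff heat_kernel_def)
  have "(LINT x|lborel. cis (x \<bullet> z) * of_real (heat_kernel t x)) =
     (LINT x|lborel. cis (x \<bullet> z) * of_real (exp (- (1/(4*t)) * (norm x)\<^sup>2)) / of_real (sqrt (4 * pi * t) ^ DIM('a)))"
    by (simp add: eq)
  also have "\<dots> = (LINT x|lborel. cis (x \<bullet> z) * of_real (exp (- (1/(4*t)) * (norm x)\<^sup>2))) / of_real (sqrt (4 * pi * t) ^ DIM('a))"
    by (rule integral_divide_zero)
  also have "\<dots> = of_real (exp (- t * (norm z)\<^sup>2))"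
    using t by (subst gaussian_fourier) (simp_all add: mult_ac)
  finally show "(LINT x|lborel. cis (x \<bullet> z) * of_real (heat_kernel t x)) = of_real (exp (- t * (norm z)\<^sup>2))" .
  show "integrable lborel (heat_kernel t :: 'a \<Rightarrow> real)"
    unfolding eq by (intro integrable_divide_zero impI gaussian_fourier(2)) (use t in simp)
qed

lemma nn_integral_heat_kernel:
  assumes t: "t > 0"
  shows "(\<integral>\<^sup>+x. heat_kernel t (x::'a::euclidean_space) \<partial>lborel) = 1"
proof -
  have "complex_of_real (LINT x|lborel. heat_kernel t (x::'a)) = 1"
    using heat_kernel_fourier(1)[OF t, of "0::'a"] by simp
  hence "(LINT x|lborel. heat_kernel t (x::'a)) = 1" by (simp only: of_real_eq_1_iff)
  thus ?thesis
    using heat_kernel_fourier(2)[OF t, where 'a='a] t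
    by (subst nn_integral_eq_integral) auto
qed

text \<open>The converse direction to \<open>heat_kernel_fourier\<close>. For Gaussians both directions are explicit, and knowing
them before any inversion theorem is what makes inversion provable by heat regularization.\<close>

lemma heat_kernel_eq_integral:
  fixes z :: "'a::euclidean_space"
  assumes t: "t > 0"
  shows "of_real (1 / (2 * pi) ^ DIM('a)) * (LINT \<xi>|lborel. cis (\<xi> \<bullet> z) * of_real (exp (- t * (norm \<xi>)\<^sup>2)))
     = of_real (heat_kernel t z)"
proof -
  have "sqrt (pi / t) / (2 * pi) = 1 / sqrt (4 * pi * t)"
    using t by (simp add: real_sqrt_mult real_sqrt_divide field_simps)
  hence "1 / (2 * pi) ^ DIM('a) * sqrt (pi / t) ^ DIM('a) = 1 / sqrt (4 * pi * t) ^ DIM('a)"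
    by (metis (no_types, lifting) mult.commute mult_1 power_divide power_one times_divide_eq_left)
  thus ?thesis
    unfolding gaussian_fourier[OF t] of_real_mult [symmetric] heat_kernel_def
    by (metis (no_types, lifting) mult.assoc mult_1 times_divide_eq_left)
qed

section \<open>Smooth functions of compact support\<close>

lemma C_class_imp_continuous: "C_class k f \<Longrightarrow> continuous_on UNIV f"
  by (cases k) (auto intro: differentiable_imp_continuous_on)

lemma C_class_zero_fun: "C_class k (\<lambda>x. 0)"
  by (induction k) auto

lemma C_class_add: "C_class k f \<Longrightarrow> C_class k g \<Longrightarrow> C_class k (\<lambda>x. f x + g x)"
proof (induction k arbitrary: f g)
  case (Suc k)
  have d: "f differentiable at x" "g differentiable at x" for x
    using Suc.prems by (auto simp: differentiable_on_def)
  have "frechet_derivative (\<lambda>x. f x + g x) (at x) v =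
      frechet_derivative f (at x) v + frechet_derivative g (at x) v" for x v
    by (subst frechet_derivative_at[OF has_derivative_add, symmetric])
       (use d in \<open>auto simp: frechet_derivative_works[symmetric]\<close>)
  with Suc d show ?case by (auto simp: differentiable_on_def)
qed (auto intro: continuous_intros)

lemma C_class_sum: "finite A \<Longrightarrow> (\<And>a. a \<in> A \<Longrightarrow> C_class k (f a)) \<Longrightarrow> C_class k (\<lambda>x. \<Sum>a\<in>A. f a x)"
  by (induction A rule: finite_induct) (auto intro: C_class_add simp: C_class_zero_fun)

lemma C_class_bounded_linear:
  assumes L: "bounded_linear L"
  shows "C_class k f \<Longrightarrow> C_class k (\<lambda>x. L (f x))"
proof (induction k arbitrary: f)
  case 0
  thus ?case using bounded_linear.continuous_on[OF L] by simp
next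
  case (Suc k)
  have der: "((\<lambda>x. L (f x)) has_derivative (\<lambda>v. L (frechet_derivative f (at x) v))) (at x)" for x
    using Suc.prems
    by (intro bounded_linear.has_derivative[OF L]) (auto simp: differentiable_on_def frechet_derivative_works)
  hence "(\<lambda>x. L (f x)) differentiable at x"
        "frechet_derivative (\<lambda>x. L (f x)) (at x) v = L (frechet_derivative f (at x) v)" for x v
    by (auto simp: differentiable_def frechet_derivative_at[OF der, symmetric])
  with Suc show ?case by (auto simp: differentiable_on_def)
qed

lemma C_class_affine: "C_class k f \<Longrightarrow> C_class k (\<lambda>x. f (d + c *\<^sub>R x))"
proof (induction k arbitrary: f)
  case 0
  thus ?case by (auto intro!: continuous_intros continuous_on_compose2[of UNIV f])
next
  case (Suc k)
  have der: "((\<lambda>x. f (d + c *\<^sub>R x)) has_derivative (\<lambda>v. frechet_derivative f (at (d + c *\<^sub>R x)) (c *\<^sub>R v))) (at x)" for x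
    using Suc.prems
    by (intro has_derivative_compose[where f="\<lambda>x. d + c *\<^sub>R x" and g=f])
       (auto simp: differentiable_on_def frechet_derivative_works[symmetric] intro!: derivative_eq_intros)
  hence "(\<lambda>x. f (d + c *\<^sub>R x)) differentiable at x"
        "frechet_derivative (\<lambda>x. f (d + c *\<^sub>R x)) (at x) v = frechet_derivative f (at (d + c *\<^sub>R x)) (c *\<^sub>R v)" for x v
    by (auto simp: differentiable_def frechet_derivative_at[OF der, symmetric])
  moreover have "C_class k (\<lambda>x. frechet_derivative f (at (d + c *\<^sub>R x)) (c *\<^sub>R v))" for v
    using Suc by auto
  ultimately show ?case by (auto simp: differentiable_on_def)
qed

lemma test_functions_iff:
  "\<phi> \<in> test_functions \<longleftrightarrow> (\<forall>k. C_class k \<phi>) \<and> (\<exists>R. \<forall>x. norm x > R \<longrightarrow> \<phi> x = 0)"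
proof -
  have "compact (closure (support_on UNIV \<phi>)) \<longleftrightarrow> bounded (support_on UNIV \<phi>)"
    by (simp add: compact_closure)
  also have "\<dots> \<longleftrightarrow> (\<exists>R. \<forall>x. norm x > R \<longrightarrow> \<phi> x = 0)"
    unfolding bounded_iff support_on_def by (auto simp: not_less) (meson not_le)+
  finally show ?thesis by (simp add: test_functions_def)
qed

lemma test_functions_sum:
  fixes f :: "'i \<Rightarrow> 'a::euclidean_space \<Rightarrow> complex"
  assumes "finite A" "\<And>a. a \<in> A \<Longrightarrow> f a \<in> test_functions"
  shows "(\<lambda>x. \<Sum>a\<in>A. f a x) \<in> test_functions"
proof -
  have "\<exists>R. \<forall>x::'a. norm x > R \<longrightarrow> (\<Sum>a\<in>A. f a x) = 0"
  proof -
    have "\<forall>a\<in>A. \<exists>R. \<forall>x::'a. norm x > R \<longrightarrow> f a x = 0"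
      using assms(2) by (auto simp: test_functions_iff)
    then obtain R where R: "\<And>a (x::'a). a \<in> A \<Longrightarrow> norm x > R a \<Longrightarrow> f a x = 0" by metis
    show ?thesis
    proof (intro exI[of _ "Max (insert 0 (R ` A))"] allI impI sum.neutral ballI)
      fix x :: 'a and a assume "norm x > Max (insert 0 (R ` A))" "a \<in> A"
      thus "f a x = 0" using assms(1) by (intro R) auto
    qed
  qed
  with assms show ?thesis by (auto simp: test_functions_iff intro!: C_class_sum)
qed

lemma test_functions_add:
  assumes "f \<in> test_functions" "g \<in> test_functions"
  shows "(\<lambda>x. f x + g x) \<in> test_functions"
  using test_functions_sum[of "UNIV :: bool set" "\<lambda>b. if b then f else g"] assms
  by (simp add: UNIV_bool add.commute)

lemma test_functions_uminus: "f \<in> test_functions \<Longrightarrow> (\<lambda>x. - f x) \<in> test_functions"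
  by (auto simp: test_functions_iff intro!: C_class_bounded_linear[of uminus] bounded_linear_minus bounded_linear_ident)

lemma test_functions_affine:
  assumes "f \<in> test_functions" and c: "c \<noteq> 0"
  shows "(\<lambda>x. f (d + c *\<^sub>R x)) \<in> test_functions"
proof -
  obtain R where R: "\<And>x. norm x > R \<Longrightarrow> f x = 0" using assms by (auto simp: test_functions_iff)
  have "f (d + c *\<^sub>R x) = 0" if "norm x > (R + norm d) / \<bar>c\<bar>" for x
  proof (rule R)
    have "R + norm d < norm (c *\<^sub>R x)" using that c by (simp add: field_simps)
    also have "\<dots> \<le> norm (d + c *\<^sub>R x) + norm d"
      by (metis add.commute add_diff_cancel_left' norm_triangle_ineq4)
    finally show "R < norm (d + c *\<^sub>R x)" by simp
  qed
  thus ?thesis using assms by (auto simp: test_functions_iff intro!: C_class_affine)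
qed

lemma test_functions_continuous: "f \<in> test_functions \<Longrightarrow> continuous_on UNIV f"
  using C_class_imp_continuous[of 0 f] by (auto simp: test_functions_iff)

lemma test_functions_measurable: "f \<in> test_functions \<Longrightarrow> f \<in> borel_measurable borel"
  by (intro borel_measurable_continuous_onI test_functions_continuous)

lemma test_functions_bounded_support:
  assumes "f \<in> test_functions"
  obtains B R where "B \<ge> 0" "R > 0" "\<And>x. norm (f x) \<le> B" "\<And>x. norm x > R \<Longrightarrow> f x = 0"
proof -
  obtain R where R: "\<And>x. norm x > R \<Longrightarrow> f x = 0" using assms by (auto simp: test_functions_iff)
  define R' where "R' = max R 1"
  have "compact (f ` cball 0 R')"
    using assms by (intro compact_continuous_image continuous_on_subset[OF test_functions_continuous]) auto
  hence "bounded (f ` cball 0 R')" by (rule compact_imp_bounded)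
  then obtain B where B: "\<And>x. norm x \<le> R' \<Longrightarrow> norm (f x) \<le> B" unfolding bounded_iff by fastforce
  have "norm (f x) \<le> max B 0" for x
    by (cases "norm x \<le> R'") (use B R in \<open>auto simp: R'_def le_max_iff_disj\<close>)
  thus ?thesis using R by (intro that[of "max B 0" R']) (auto simp: R'_def)
qed

lemma integrable_bounded_support:
  fixes f :: "'a::euclidean_space \<Rightarrow> 'b::{banach,second_countable_topology}"
  assumes "f \<in> borel_measurable borel" "\<And>x. norm (f x) \<le> B" "\<And>x. norm x > R \<Longrightarrow> f x = 0"
  shows "integrable lborel f"
proof (rule Bochner_Integration.integrable_bound)
  show "integrable lborel (\<lambda>x::'a. B * indicator (cball 0 R) x)"
    using emeasure_lborel_cball_finite[of "0::'a" R] by (auto simp: integrable_real_indicator)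
  have "0 \<le> B" using norm_ge_zero assms(2) order_trans by blast
  thus "AE x in lborel. norm (f x) \<le> norm (B * indicator (cball 0 R) x)"
    using assms by (intro AE_I2) (auto simp: indicator_def not_le)
qed (use assms in simp)

lemma test_functions_integrable: "f \<in> test_functions \<Longrightarrow> integrable lborel f"
  by (metis integrable_bounded_support test_functions_bounded_support test_functions_measurable)

definition dderiv :: "'a::euclidean_space \<Rightarrow> ('a \<Rightarrow> 'b::real_normed_vector) \<Rightarrow> 'a \<Rightarrow> 'b" where
  "dderiv v f = (\<lambda>x. frechet_derivative f (at x) v)"

lemma test_functions_has_derivative:
  assumes "f \<in> test_functions"
  shows "(f has_derivative (\<lambda>v. dderiv v f x)) (at x)"
proof -
  have "C_class (Suc 0) f" using assms unfolding test_functions_iff by blast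
  hence "f differentiable at x" by (auto simp: differentiable_on_def)
  thus ?thesis by (simp add: dderiv_def frechet_derivative_works[symmetric])
qed

lemma test_functions_dderiv:
  assumes "f \<in> test_functions"
  shows "dderiv v f \<in> test_functions"
proof -
  obtain R where R: "\<And>x. norm x > R \<Longrightarrow> f x = 0" using assms by (auto simp: test_functions_iff)
  have "dderiv v f x = 0" if x: "norm x > R" for x
  proof -
    have "((\<lambda>x. 0) has_derivative (\<lambda>v. dderiv v f x)) (at x)"
    proof (rule has_derivative_transform_within_open[OF test_functions_has_derivative[OF assms]])
      show "open {x::'a. norm x > R}" by (intro open_Collect_less continuous_intros)
    qed (use R x in auto)
    from has_derivative_unique[OF this has_derivative_const] show ?thesis by (auto simp: fun_eq_iff)
  qed
  moreover have "C_class k (dderiv v f)" for k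
  proof -
    have "C_class (Suc k) f" using assms unfolding test_functions_iff by blast
    thus ?thesis by (simp add: dderiv_def)
  qed
  ultimately show ?thesis by (auto simp: test_functions_iff)
qed

definition neg_laplacian :: "('a::euclidean_space \<Rightarrow> complex) \<Rightarrow> 'a \<Rightarrow> complex" where
  "neg_laplacian f = (\<lambda>x. - (\<Sum>b\<in>Basis. dderiv b (dderiv b f) x))"

lemma test_functions_neg_laplacian: "f \<in> test_functions \<Longrightarrow> neg_laplacian f \<in> test_functions"
  unfolding neg_laplacian_def
  by (intro test_functions_uminus test_functions_sum test_functions_dderiv) auto

text \<open>The derivatives of \<open>exp (- 1 / t)\<close> are polynomials in \<open>1 / t\<close> times \<open>exp (- 1 / t)\<close>; the index
\<open>j\<close> makes the family of their monomials closed under differentiation.\<close>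

definition flat_exp :: "nat \<Rightarrow> real \<Rightarrow> real" where
  "flat_exp j t = (if t > 0 then (1 / t) ^ j * exp (- (1 / t)) else 0)"

lemma flat_exp_tendsto_0: "(flat_exp j \<longlongrightarrow> 0) (at 0)"
proof -
  have "((\<lambda>y::real. y ^ j / exp y) \<longlongrightarrow> 0) at_top" by (rule tendsto_power_div_exp_0)
  hence "((\<lambda>t::real. inverse t ^ j / exp (inverse t)) \<longlongrightarrow> 0) (at_right 0)"
    by (rule filterlim_compose[OF _ filterlim_inverse_at_top_right])
  hence "(flat_exp j \<longlongrightarrow> 0) (at_right 0)"
    by (rule Lim_transform_eventually)
       (auto simp: eventually_at_filter flat_exp_def exp_minus divide_inverse)
  moreover have "(flat_exp j \<longlongrightarrow> 0) (at_left 0)"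
    by (rule Lim_transform_eventually[OF tendsto_const])
       (auto simp: eventually_at_filter flat_exp_def)
  ultimately show ?thesis by (simp add: filterlim_split_at)
qed

lemma DERIV_flat_exp:
  "(flat_exp j has_real_derivative (flat_exp (j + 2) t - of_nat j * flat_exp (j + 1) t)) (at t)"
proof -
  consider "t > 0" | "t < 0" | "t = 0" by linarith
  thus ?thesis
  proof cases
    case 1
    define y where "y = 1 / t"
    have d: "((\<lambda>t. 1 / t) has_real_derivative - (y ^ 2)) (at t)"
      using 1 by (auto intro!: derivative_eq_intros simp: y_def power2_eq_square)
    have "((\<lambda>t. (1 / t) ^ j * exp (- (1 / t))) has_real_derivative
       (of_nat j * (- (y ^ 2) * y ^ (j - 1))) * exp (- y) + (exp (- y) * (y ^ 2)) * y ^ j) (at t)"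
      by (rule DERIV_cong, (rule DERIV_mult DERIV_power DERIV_fun_exp DERIV_minus d)+) (simp add: y_def)
    also have "(of_nat j * (- (y ^ 2) * y ^ (j - 1))) * exp (- y) + (exp (- y) * (y ^ 2)) * y ^ j =
       flat_exp (j + 2) t - of_nat j * flat_exp (j + 1) t"
      using 1 by (cases j) (simp_all add: flat_exp_def y_def[symmetric] power2_eq_square algebra_simps)
    finally have "((\<lambda>t. (1 / t) ^ j * exp (- (1 / t))) has_real_derivative
       (flat_exp (j + 2) t - of_nat j * flat_exp (j + 1) t)) (at t)" .
    thus ?thesis
      by (rule has_field_derivative_transform_within_open[where S="{0<..}"]) (use 1 in \<open>auto simp: flat_exp_def\<close>)
  next
    case 2
    have "((\<lambda>t. 0) has_real_derivative 0) (at t)" by simp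
    hence "(flat_exp j has_real_derivative 0) (at t)"
      by (rule has_field_derivative_transform_within_open[where S="{..<0}"]) (use 2 in \<open>auto simp: flat_exp_def\<close>)
    thus ?thesis using 2 by (simp add: flat_exp_def)
  next
    case 3
    have "((\<lambda>h. (flat_exp j (0 + h) - flat_exp j 0) / h) \<longlongrightarrow> 0) (at 0)"
      by (rule Lim_transform_eventually[OF flat_exp_tendsto_0[of "Suc j"]])
         (auto simp: eventually_at_filter flat_exp_def)
    thus ?thesis using 3 by (simp add: DERIV_def flat_exp_def)
  qed
qed

text \<open>All derivatives of the bump function \<open>exp (- 1 / (1 - |x|\<^sup>2))\<close> lie in this algebra. Since the algebra is mapped
into itself by directional derivatives, smoothness of every order follows by a single induction, without
any formula for the higher derivatives.\<close>

inductive_set bump_algebra :: "('a::euclidean_space \<Rightarrow> real) set" where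
  const: "(\<lambda>_. c) \<in> bump_algebra"
| inner: "(\<lambda>x. x \<bullet> v) \<in> bump_algebra"
| flat: "(\<lambda>x. flat_exp j (1 - x \<bullet> x)) \<in> bump_algebra"
| add: "f \<in> bump_algebra \<Longrightarrow> g \<in> bump_algebra \<Longrightarrow> (\<lambda>x. f x + g x) \<in> bump_algebra"
| mult: "f \<in> bump_algebra \<Longrightarrow> g \<in> bump_algebra \<Longrightarrow> (\<lambda>x. f x * g x) \<in> bump_algebra"

lemma bump_algebra_derivative:
  "f \<in> bump_algebra \<Longrightarrow> \<exists>D. (\<forall>v. D v \<in> bump_algebra) \<and> (\<forall>x. (f has_derivative (\<lambda>v. D v x)) (at x))"
proof (induction rule: bump_algebra.induct)
  case (const c)
  show ?case by (rule exI[of _ "\<lambda>_ _. 0"]) (auto intro: bump_algebra.const)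
next
  case (inner w)
  show ?case
    by (rule exI[of _ "\<lambda>v _. v \<bullet> w"]) (auto intro: bump_algebra.const intro!: derivative_eq_intros)
next
  case (flat j)
  define D where "D = (\<lambda>v x::'a. (-2) * (x \<bullet> v) * (flat_exp (j + 2) (1 - x \<bullet> x) + (- of_nat j) * flat_exp (j + 1) (1 - x \<bullet> x)))"
  have "D v \<in> bump_algebra" for v
    unfolding D_def by (intro bump_algebra.intros)
  moreover have "((\<lambda>x. flat_exp j (1 - x \<bullet> x)) has_derivative (\<lambda>v. D v x)) (at x)" for x
  proof -
    have "((\<lambda>x. flat_exp j (1 - x \<bullet> x)) has_derivative
      (\<lambda>v. (flat_exp (j + 2) (1 - x \<bullet> x) - of_nat j * flat_exp (j + 1) (1 - x \<bullet> x)) * (- (x \<bullet> v + v \<bullet> x)))) (at x)"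
      by (rule has_derivative_compose[where g="flat_exp j", OF _ DERIV_flat_exp[unfolded has_field_derivative_def]])
         (auto intro!: derivative_eq_intros)
    thus ?thesis by (simp add: D_def inner_commute algebra_simps)
  qed
  ultimately show ?case by blast
next
  case (add f g)
  then obtain D E where "\<forall>v. D v \<in> bump_algebra" "\<forall>x. (f has_derivative (\<lambda>v. D v x)) (at x)"
    "\<forall>v. E v \<in> bump_algebra" "\<forall>x. (g has_derivative (\<lambda>v. E v x)) (at x)" by blast
  thus ?case
    by (intro exI[of _ "\<lambda>v x. D v x + E v x"]) (auto intro: bump_algebra.intros derivative_intros)
next
  case (mult f g)
  then obtain D E where "\<forall>v. D v \<in> bump_algebra" "\<forall>x. (f has_derivative (\<lambda>v. D v x)) (at x)"
    "\<forall>v. E v \<in> bump_algebra" "\<forall>x. (g has_derivative (\<lambda>v. E v x)) (at x)" by blast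
  thus ?case using mult
    by (intro exI[of _ "\<lambda>v x. f x * E v x + D v x * g x"]) (auto intro!: bump_algebra.intros derivative_intros)
qed

lemma bump_algebra_C_class: "f \<in> bump_algebra \<Longrightarrow> C_class k f"
proof (induction k arbitrary: f)
  case 0
  then obtain D where "\<forall>x. (f has_derivative (\<lambda>v. D v x)) (at x)"
    using bump_algebra_derivative by blast
  thus ?case by (auto simp: continuous_on_eq_continuous_at intro: has_derivative_continuous)
next
  case (Suc k)
  obtain D where D: "\<forall>v. D v \<in> bump_algebra" "\<forall>x. (f has_derivative (\<lambda>v. D v x)) (at x)"
    using bump_algebra_derivative[OF Suc.prems] by blast
  hence "frechet_derivative f (at x) = (\<lambda>v. D v x)" "f differentiable at x" for x
    by (auto dest: frechet_derivative_at[symmetric] simp: differentiable_def)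
  thus ?case using D Suc.IH by (auto simp: differentiable_on_def)
qed

lemma bump_test_function:
  obtains \<phi> :: "'a::euclidean_space \<Rightarrow> complex" where "\<phi> \<in> test_functions" "\<phi> 0 \<noteq> 0"
proof
  let ?\<phi> = "\<lambda>x::'a. complex_of_real (flat_exp 0 (1 - x \<bullet> x))"
  have "?\<phi> x = 0" if "norm x > 1" for x
  proof -
    have "1 < (norm x)\<^sup>2" using that by (rule one_less_power) simp
    thus ?thesis by (simp add: flat_exp_def flip: power2_norm_eq_inner)
  qed
  thus "?\<phi> \<in> test_functions"
    unfolding test_functions_iff
    by (intro conjI allI exI[of _ 1] impI C_class_bounded_linear[OF bounded_linear_of_real]
        bump_algebra_C_class bump_algebra.flat) auto
  show "?\<phi> 0 \<noteq> 0" by (simp add: flat_exp_def)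
qed

section \<open>The Fourier transform of test functions\<close>

text \<open>Oscillating factors such as \<open>cis (x \<bullet> \<xi>)\<close> have modulus at most 1, so a product of two integrable
functions of separate variables dominates every double integral to which Fubini's theorem is applied below.\<close>

lemma integrable_prod_lborel:
  fixes f :: "'a::euclidean_space \<Rightarrow> complex" and g :: "'b::euclidean_space \<Rightarrow> complex"
    and k :: "'a \<Rightarrow> 'b \<Rightarrow> complex"
  assumes f: "integrable lborel f" and g: "integrable lborel g"
    and k[measurable]: "(\<lambda>(x, y). k x y) \<in> borel_measurable (borel \<Otimes>\<^sub>M borel)"
    and k1: "\<And>x y. norm (k x y) \<le> 1"
  shows "integrable (lborel \<Otimes>\<^sub>M lborel) (\<lambda>(x, y). f x * g y * k x y)"
proof -
  note [measurable] = borel_measurable_integrable[OF f] borel_measurable_integrable[OF g]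
  have fg: "integrable (lborel \<Otimes>\<^sub>M lborel) (\<lambda>(x, y). f x * g y)"
  proof (rule lborel_pair.Fubini_integrable)
    have "(\<lambda>x. LINT y|lborel. norm (f x * g y)) = (\<lambda>x. norm (f x) * (LINT y|lborel. norm (g y)))"
      by (simp add: norm_mult)
    thus "integrable lborel (\<lambda>x. LINT y|lborel. norm (case (x, y) of (x, y) \<Rightarrow> f x * g y))"
      using f by simp
  qed (use g in auto)
  show ?thesis
  proof (rule Bochner_Integration.integrable_bound[OF fg])
    show "AE z in lborel \<Otimes>\<^sub>M lborel. norm (case z of (x, y) \<Rightarrow> f x * g y * k x y) \<le> norm (case z of (x, y) \<Rightarrow> f x * g y)"
      using k1 by (intro AE_I2) (auto simp: norm_mult mult_left_le)
  qed measurable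
qed

lemma integral_swap_lborel:
  fixes f :: "'a::euclidean_space \<Rightarrow> complex" and g :: "'b::euclidean_space \<Rightarrow> complex"
    and k :: "'a \<Rightarrow> 'b \<Rightarrow> complex"
  assumes f: "integrable lborel f" and g: "integrable lborel g"
    and k: "(\<lambda>(x, y). k x y) \<in> borel_measurable (borel \<Otimes>\<^sub>M borel)"
    and k1: "\<And>x y. norm (k x y) \<le> 1"
  shows "(LINT x|lborel. LINT y|lborel. f x * g y * k x y) = (LINT y|lborel. LINT x|lborel. f x * g y * k x y)"
proof -
  show ?thesis using lborel_pair.Fubini_integral[OF integrable_prod_lborel[OF assms]] by simp
qed

lemma integrable_mult_cis:
  assumes "integrable lborel f" and [measurable]: "k \<in> borel_measurable borel"
  shows "integrable lborel (\<lambda>x. cis (k x) * f x)"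
  by (rule Bochner_Integration.integrable_bound[OF assms(1)])
     (use borel_measurable_integrable[OF assms(1)] in \<open>auto simp: norm_mult\<close>)

lemma measurable_fourier [measurable (raw)]:
  assumes [measurable]: "f \<in> borel_measurable borel"
  shows "fourier f \<in> borel_measurable borel"
  unfolding fourier_def by measurable

lemma measurable_inverse_fourier [measurable (raw)]:
  assumes [measurable]: "f \<in> borel_measurable borel"
  shows "inverse_fourier f \<in> borel_measurable borel"
  unfolding inverse_fourier_def by measurable

lemma norm_fourier_le: "norm (fourier f \<xi>) \<le> (LINT x|lborel. norm (f x))"
proof -
  have "norm (fourier f \<xi>) \<le> (LINT x|lborel. norm (cis (- (x \<bullet> \<xi>)) * f x))"
    unfolding fourier_def by (rule integral_norm_bound)
  thus ?thesis by (simp add: norm_mult)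
qed

lemma fourier_shift:
  fixes f :: "'a::euclidean_space \<Rightarrow> complex"
  assumes [measurable]: "f \<in> borel_measurable borel"
  shows "fourier (\<lambda>x. f (h + x)) \<xi> = cis (h \<bullet> \<xi>) * fourier f \<xi>"
proof -
  have "fourier f \<xi> = (LINT x|lborel. cis (- ((h + x) \<bullet> \<xi>)) * f (h + x))"
    unfolding fourier_def by (rule integral_lborel_shift[symmetric]) measurable
  also have "\<dots> = (LINT x|lborel. cis (- (h \<bullet> \<xi>)) * (cis (- (x \<bullet> \<xi>)) * f (h + x)))"
    by (simp add: inner_add_left mult.assoc[symmetric] cis_mult)
  also have "\<dots> = cis (- (h \<bullet> \<xi>)) * fourier (\<lambda>x. f (h + x)) \<xi>"
    unfolding fourier_def by (rule integral_mult_right_zero)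
  finally show ?thesis by (simp add: mult.assoc[symmetric] cis_mult)
qed

lemma fourier_add:
  assumes "integrable lborel f" "integrable lborel g"
  shows "fourier (\<lambda>x. f x + g x) \<xi> = fourier f \<xi> + fourier g \<xi>"
  unfolding fourier_def distrib_left
  by (intro Bochner_Integration.integral_add integrable_mult_cis assms) measurable

lemma fourier_sum:
  assumes "\<And>a. a \<in> A \<Longrightarrow> integrable lborel (f a)"
  shows "fourier (\<lambda>x. \<Sum>a\<in>A. f a x) \<xi> = (\<Sum>a\<in>A. fourier (f a) \<xi>)"
  unfolding fourier_def sum_distrib_left
  by (intro Bochner_Integration.integral_sum integrable_mult_cis assms) measurable

lemma fourier_cmult: "fourier (\<lambda>x. c * f x) \<xi> = c * fourier f \<xi>"
  unfolding fourier_def by (simp add: mult.left_commute)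

lemma inverse_fourier_sum:
  assumes "\<And>a. a \<in> A \<Longrightarrow> integrable lborel (f a)"
  shows "inverse_fourier (\<lambda>\<xi>. \<Sum>a\<in>A. f a \<xi>) x = (\<Sum>a\<in>A. inverse_fourier (f a) x)"
proof -
  have "(LINT \<xi>|lborel. (\<Sum>a\<in>A. cis (x \<bullet> \<xi>) * f a \<xi>)) = (\<Sum>a\<in>A. (LINT \<xi>|lborel. cis (x \<bullet> \<xi>) * f a \<xi>))"
    by (intro Bochner_Integration.integral_sum integrable_mult_cis assms) measurable
  thus ?thesis unfolding inverse_fourier_def by (simp add: sum_distrib_left)
qed

lemma inverse_fourier_cmult: "inverse_fourier (\<lambda>\<xi>. c * h \<xi>) x = c * inverse_fourier h x"
  unfolding inverse_fourier_def by (simp add: mult.left_commute)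

lemma inverse_fourier_cong_AE:
  assumes "AE \<xi> in lborel. h \<xi> = h' \<xi>" and [measurable]: "h \<in> borel_measurable borel" "h' \<in> borel_measurable borel"
  shows "inverse_fourier h x = inverse_fourier h' x"
  unfolding inverse_fourier_def
  by (intro arg_cong2[where f="(*)"] refl integral_cong_AE) (use assms(1) in auto)

lemma LIMSEQ_one_over_Suc: "(\<lambda>n. 1 / real (Suc n)) \<longlonglongrightarrow> 0"
  using LIMSEQ_inverse_real_of_nat by (simp only: inverse_eq_divide)

lemma tendsto_difference_quotient:
  fixes g :: "real \<Rightarrow> 'b::real_normed_vector"
  assumes "(g has_vector_derivative D) (at 0)"
  shows "(\<lambda>n. real (Suc n) *\<^sub>R (g (1 / real (Suc n)) - g 0)) \<longlonglongrightarrow> D"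
proof -
  let ?d = "\<lambda>n. g (0 + 1 / real (Suc n)) - g 0 - (1 / real (Suc n)) *\<^sub>R D"
  have "((\<lambda>h. norm (g (0 + h) - g 0 - h *\<^sub>R D) / norm h) \<longlongrightarrow> 0) (at 0)"
    using assms unfolding has_vector_derivative_def has_derivative_at by blast
  moreover have "filterlim (\<lambda>n. 1 / real (Suc n)) (at 0) sequentially"
    unfolding filterlim_at by (auto intro!: eventuallyI LIMSEQ_one_over_Suc simp del: of_nat_Suc)
  ultimately have lim: "(\<lambda>n. norm (?d n) / norm (1 / real (Suc n))) \<longlonglongrightarrow> 0"
    by (rule filterlim_compose)
  have eq: "norm (?d n) / norm (1 / real (Suc n))
     = norm (real (Suc n) *\<^sub>R (g (1 / real (Suc n)) - g 0) - D)" for n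
  proof -
    have "real (Suc n) *\<^sub>R (g (1 / real (Suc n)) - g 0) - D = real (Suc n) *\<^sub>R (?d n)"
      by (simp add: scaleR_diff_right del: of_nat_Suc)
    also have "norm \<dots> = real (Suc n) * norm (?d n)"
      by (simp del: of_nat_Suc)
    finally have e: "norm (real (Suc n) *\<^sub>R (g (1 / real (Suc n)) - g 0) - D) =
      real (Suc n) * norm (?d n)" .
    show ?thesis unfolding e by (simp del: of_nat_Suc)
  qed
  have "(\<lambda>n. norm (real (Suc n) *\<^sub>R (g (1 / real (Suc n)) - g 0) - D)) \<longlonglongrightarrow> 0"
    using lim unfolding eq .
  thus ?thesis by (rule LIM_zero_cancel[OF tendsto_norm_zero_cancel])
qed

lemma test_functions_directional:
  assumes "f \<in> test_functions"
  shows "((\<lambda>r. f (x + r *\<^sub>R v)) has_vector_derivative dderiv v f (x + r *\<^sub>R v)) (at r within S)"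
proof -
  have "((\<lambda>r. f (x + r *\<^sub>R v)) has_derivative (\<lambda>s. dderiv (s *\<^sub>R v) f (x + r *\<^sub>R v))) (at r within S)"
    by (rule has_derivative_compose[where g=f, OF _ test_functions_has_derivative[OF assms]])
       (auto intro!: derivative_eq_intros)
  moreover have "dderiv (s *\<^sub>R v) f y = s *\<^sub>R dderiv v f y" for s y
    using test_functions_has_derivative[OF assms, THEN has_derivative_linear, of y]
    by (rule linear_scale)
  ultimately show ?thesis by (simp add: has_vector_derivative_def)
qed

text \<open>The difference quotients of \<open>f\<close> in direction \<open>v\<close> converge boundedly and with a common bounded
support to the derivative, while a translation multiplies the transform by a character. Passing to the limit in
the transforms of the difference quotients takes the place of integration by parts.\<close>

lemma fourier_dderiv:
  fixes f :: "'a::euclidean_space \<Rightarrow> complex"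
  assumes f: "f \<in> test_functions"
  shows "fourier (dderiv v f) \<xi> = \<i> * of_real (v \<bullet> \<xi>) * fourier f \<xi>"
proof -
  have [measurable]: "f \<in> borel_measurable borel" "dderiv v f \<in> borel_measurable borel"
    using f by (auto intro: test_functions_measurable test_functions_dderiv)
  obtain B R where BR: "B \<ge> 0" "\<And>x. norm (dderiv v f x) \<le> B" "\<And>x. norm x > R \<Longrightarrow> dderiv v f x = 0" "R > 0"
    using test_functions_bounded_support[OF test_functions_dderiv[OF f]] by metis
  obtain B' R' where BR': "\<And>x. norm x > R' \<Longrightarrow> f x = 0"
    using test_functions_bounded_support[OF f] by metis
  define q where "q n x = real (Suc n) *\<^sub>R (f (x + (1 / real (Suc n)) *\<^sub>R v) - f x)" for n x
  have [measurable]: "q n \<in> borel_measurable borel" for n unfolding q_def by measurable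
  have bound: "norm (q n x) \<le> B" for n x
  proof -
    have "norm (f (x + (1 / real (Suc n)) *\<^sub>R v) - f (x + 0 *\<^sub>R v)) \<le> B * norm (1 / real (Suc n) - 0)"
    proof (rule differentiable_bound[of UNIV])
      fix r show "((\<lambda>r. f (x + r *\<^sub>R v)) has_derivative (\<lambda>s. s *\<^sub>R dderiv v f (x + r *\<^sub>R v))) (at r within UNIV)"
        using test_functions_directional[OF f] by (auto simp: has_vector_derivative_def)
      show "onorm (\<lambda>s. s *\<^sub>R dderiv v f (x + r *\<^sub>R v)) \<le> B"
        by (rule onorm_le) (metis BR(2) abs_ge_zero mult.commute mult_left_mono norm_scaleR real_norm_def)
    qed auto
    hence "real (Suc n) * norm (f (x + (1 / real (Suc n)) *\<^sub>R v) - f x) \<le> real (Suc n) * (B * (1 / real (Suc n)))"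
      by (intro mult_left_mono) auto
    thus ?thesis by (simp add: q_def del: of_nat_Suc)
  qed
  have supp: "q n x = 0" if "norm x > R' + norm v" for n x
  proof -
    have "norm ((1 / real (Suc n)) *\<^sub>R v) \<le> norm v"
      by (simp add: field_simps mult_left_le)
    hence "norm (x + (1 / real (Suc n)) *\<^sub>R v) > R'" "norm x > R'"
      using that norm_triangle_ineq4[of "x + (1 / real (Suc n)) *\<^sub>R v" "(1 / real (Suc n)) *\<^sub>R v"] norm_ge_zero[of v]
      unfolding add_diff_cancel_right' by linarith+
    thus ?thesis by (simp add: q_def BR')
  qed
  have fint: "integrable lborel f" by (rule test_functions_integrable[OF f])
  have "(\<lambda>n. fourier (q n) \<xi>) \<longlonglongrightarrow> fourier (dderiv v f) \<xi>"
    unfolding fourier_def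
  proof (rule integral_dominated_convergence[where w="\<lambda>x. B * indicator (cball 0 (R' + norm v)) x"])
    show "integrable lborel (\<lambda>x::'a. B * indicator (cball 0 (R' + norm v)) x :: real)"
      using emeasure_lborel_cball_finite[of "0::'a" "R' + norm v"] by (auto simp: integrable_real_indicator)
    have "q n x = 0" if "x \<notin> cball 0 (R' + norm v)" for n x using supp that by auto
    thus "AE x in lborel. norm (cis (- (x \<bullet> \<xi>)) * q n x) \<le> B * indicator (cball 0 (R' + norm v)) x" for n
      using bound by (intro AE_I2) (auto simp: norm_mult indicator_def)
    have "(\<lambda>n. q n x) \<longlonglongrightarrow> dderiv v f x" for x
      using tendsto_difference_quotient[OF test_functions_directional[OF f, of x v 0 UNIV]]
      by (simp add: q_def)
    thus "AE x in lborel. (\<lambda>n. cis (- (x \<bullet> \<xi>)) * q n x) \<longlonglongrightarrow> cis (- (x \<bullet> \<xi>)) * dderiv v f x"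
      by (intro AE_I2 tendsto_intros)
  qed measurable
  moreover have "fourier (q n) \<xi> = (real (Suc n) *\<^sub>R (cis ((1 / real (Suc n)) * (v \<bullet> \<xi>)) - cis (0 * (v \<bullet> \<xi>)))) * fourier f \<xi>" for n
  proof -
    have qeq: "q n = (\<lambda>x. of_real (real (Suc n)) * f ((1 / real (Suc n)) *\<^sub>R v + x) + (- of_real (real (Suc n))) * f x)"
      by (simp add: q_def fun_eq_iff scaleR_conv_of_real algebra_simps)
    have i: "integrable lborel (\<lambda>x. f ((1 / real (Suc n)) *\<^sub>R v + x))"
      using test_functions_integrable[OF test_functions_affine[OF f, of 1]] by simp
    have "fourier (q n) \<xi> = of_real (real (Suc n)) * fourier (\<lambda>x. f ((1 / real (Suc n)) *\<^sub>R v + x)) \<xi> + (- of_real (real (Suc n))) * fourier f \<xi>"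
      unfolding qeq by (subst fourier_add) (auto simp only: fourier_cmult intro!: integrable_mult_right i fint)
    also have "\<dots> = (real (Suc n) *\<^sub>R (cis ((1 / real (Suc n)) * (v \<bullet> \<xi>)) - cis (0 * (v \<bullet> \<xi>)))) * fourier f \<xi>"
      by (subst fourier_shift) (auto simp: scaleR_conv_of_real algebra_simps simp del: of_nat_Suc)
    finally show ?thesis .
  qed
  moreover have "(\<lambda>n. (real (Suc n) *\<^sub>R (cis ((1 / real (Suc n)) * (v \<bullet> \<xi>)) - cis (0 * (v \<bullet> \<xi>)))) * fourier f \<xi>)
     \<longlonglongrightarrow> (\<i> * of_real (v \<bullet> \<xi>)) * fourier f \<xi>"
  proof (rule tendsto_mult[OF tendsto_difference_quotient tendsto_const])
    have "((\<lambda>r. exp (of_real r * (\<i> * of_real (v \<bullet> \<xi>)))) has_vector_derivative (\<i> * of_real (v \<bullet> \<xi>))) (at (0::real))"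
      by (rule has_vector_derivative_real_field) (auto intro!: derivative_eq_intros)
    thus "((\<lambda>r. cis (r * (v \<bullet> \<xi>))) has_vector_derivative (\<i> * of_real (v \<bullet> \<xi>))) (at 0)"
      by (simp add: cis_conv_exp mult_ac)
  qed
  ultimately show ?thesis by (simp add: LIMSEQ_unique)
qed

lemma fourier_neg_laplacian:
  assumes f: "f \<in> test_functions"
  shows "fourier (neg_laplacian f) \<xi> = of_real ((norm \<xi>)\<^sup>2) * fourier f \<xi>"
proof -
  have eq: "neg_laplacian f = (\<lambda>x. (-1) * (\<Sum>b\<in>Basis. dderiv b (dderiv b f) x))"
    by (simp add: neg_laplacian_def)
  have "fourier (neg_laplacian f) \<xi> = - (\<Sum>b\<in>Basis. fourier (dderiv b (dderiv b f)) \<xi>)"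
    unfolding eq fourier_cmult
    by (subst fourier_sum) (auto intro: test_functions_integrable test_functions_dderiv f)
  also have "\<dots> = (\<Sum>b\<in>Basis. of_real ((\<xi> \<bullet> b)\<^sup>2) * fourier f \<xi>)"
    by (simp add: fourier_dderiv test_functions_dderiv f power2_eq_square inner_commute algebra_simps flip: sum_negf)
  finally show ?thesis by (simp add: norm_sq_eq_sum sum_distrib_right)
qed

text \<open>Each factor \<open>1 + (norm \<xi>)\<^sup>2\<close> is absorbed by replacing \<open>f\<close> by \<open>f + neg_laplacian f\<close>, again a test function,
and the transform of any integrable function is bounded.\<close>

lemma fourier_decay:
  fixes f :: "'a::euclidean_space \<Rightarrow> complex"
  assumes "f \<in> test_functions"
  shows "\<exists>C. \<forall>\<xi>. (1 + (norm \<xi>)\<^sup>2) ^ J * norm (fourier f \<xi>) \<le> C"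
  using assms
proof (induction J arbitrary: f)
  case 0
  show ?case using norm_fourier_le[of f] by auto
next
  case (Suc J)
  define g where "g = (\<lambda>x. f x + neg_laplacian f x)"
  have g: "g \<in> test_functions" using Suc.prems
    by (auto simp: g_def intro: test_functions_add test_functions_neg_laplacian)
  have "fourier g \<xi> = (1 + of_real ((norm \<xi>)\<^sup>2)) * fourier f \<xi>" for \<xi>
    unfolding g_def using Suc.prems
    by (subst fourier_add)
       (auto simp: fourier_neg_laplacian algebra_simps intro: test_functions_integrable test_functions_neg_laplacian)
  hence "norm (fourier g \<xi>) = norm (of_real (1 + (norm \<xi>)\<^sup>2) * fourier f \<xi>)" for \<xi> by simp
  hence eq: "norm (fourier g \<xi>) = (1 + (norm \<xi>)\<^sup>2) * norm (fourier f \<xi>)" for \<xi>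
    unfolding norm_mult norm_of_real by simp
  obtain C where "\<And>\<xi>. (1 + (norm \<xi>)\<^sup>2) ^ J * norm (fourier g \<xi>) \<le> C" using Suc.IH[OF g] by blast
  thus ?case by (auto simp: eq mult_ac)
qed

text \<open>The power \<open>DIM('a)\<close> is large enough for a domination by a product of one-dimensional functions
\<open>1 / (1 + x\<^sup>2)\<close>, one for each coordinate.\<close>

lemma integrable_japanese_bracket:
  "integrable lborel (\<lambda>\<xi>::'a::euclidean_space. 1 / (1 + (norm \<xi>)\<^sup>2) ^ DIM('a))"
proof -
  have "integrable lborel (\<lambda>x::real. inverse (1 + x\<^sup>2))"
    using integrable_inverse_1_plus_square by (simp add: set_integrable_def)
  hence "integrable lborel (\<lambda>\<xi>::'a. \<Prod>b\<in>Basis. inverse (1 + (\<xi> \<bullet> b)\<^sup>2))"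
    by (intro integral_lborel_prod(2))
  thus ?thesis
  proof (rule Bochner_Integration.integrable_bound)
    have "1 / (1 + (norm \<xi>)\<^sup>2) ^ DIM('a) \<le> (\<Prod>b\<in>Basis. inverse (1 + (\<xi> \<bullet> b)\<^sup>2))" for \<xi> :: 'a
    proof -
      have "(\<Prod>b\<in>(Basis::'a set). inverse (1 + (norm \<xi>)\<^sup>2)) \<le> (\<Prod>b\<in>Basis. inverse (1 + (\<xi> \<bullet> b)\<^sup>2))"
      proof (intro prod_mono conjI)
        fix b :: 'a assume b: "b \<in> Basis"
        have "(\<xi> \<bullet> b)\<^sup>2 \<le> (norm \<xi>)\<^sup>2" using Basis_le_norm[OF b] by (simp add: abs_le_square_iff[symmetric])
        thus "inverse (1 + (norm \<xi>)\<^sup>2) \<le> inverse (1 + (\<xi> \<bullet> b)\<^sup>2)"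
          by (intro le_imp_inverse_le) (auto intro: add_pos_nonneg)
      qed simp
      thus ?thesis by (simp add: power_one_over divide_inverse power_inverse)
    qed
    thus "AE \<xi> in lborel. norm (1 / (1 + (norm (\<xi>::'a))\<^sup>2) ^ DIM('a)) \<le> norm (\<Prod>b\<in>Basis. inverse (1 + (\<xi> \<bullet> b)\<^sup>2))"
      by (intro AE_I2) (auto simp: abs_prod intro: order.trans)
  qed measurable
qed

lemma integrable_powr_fourier:
  fixes f :: "'a::euclidean_space \<Rightarrow> complex"
  assumes f: "f \<in> test_functions" and \<beta>: "\<beta> \<ge> 0"
  shows "integrable lborel (\<lambda>\<xi>. of_real (norm \<xi> powr \<beta>) * fourier f \<xi>)"
proof -
  have [measurable]: "f \<in> borel_measurable borel" by (rule test_functions_measurable[OF f])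
  define J where "J = nat \<lceil>\<beta>\<rceil>"
  obtain C where C: "\<And>\<xi>. (1 + (norm \<xi>)\<^sup>2) ^ (DIM('a) + J) * norm (fourier f \<xi>) \<le> C"
    using fourier_decay[OF f] by metis
  have "integrable lborel (\<lambda>\<xi>::'a. C * (1 / (1 + (norm \<xi>)\<^sup>2) ^ DIM('a)))"
    by (intro integrable_mult_right integrable_japanese_bracket)
  thus ?thesis
  proof (rule Bochner_Integration.integrable_bound)
    have "norm (of_real (norm \<xi> powr \<beta>) * fourier f \<xi>) \<le> norm (C * (1 / (1 + (norm \<xi>)\<^sup>2) ^ DIM('a)))" for \<xi> :: 'a
    proof -
      let ?w = "1 + (norm \<xi>)\<^sup>2"
      have w: "?w \<ge> 1" by simp
      have "0 \<le> (norm \<xi> - 1)\<^sup>2" by simp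
      hence "2 * norm \<xi> \<le> ?w" unfolding power2_diff by simp
      hence "norm \<xi> \<le> ?w" using norm_ge_zero[of \<xi>] by linarith
      hence "norm \<xi> powr \<beta> \<le> ?w powr \<beta>" using \<beta> by (intro powr_mono2) auto
      also have "\<dots> \<le> ?w powr (real J)" using w by (intro powr_mono) (auto simp: J_def real_nat_ceiling_ge)
      also have "\<dots> = ?w ^ J" using w by (subst powr_realpow) linarith+
      finally have "?w ^ DIM('a) * (norm \<xi> powr \<beta> * norm (fourier f \<xi>)) \<le> ?w ^ DIM('a) * (?w ^ J * norm (fourier f \<xi>))"
        by (intro mult_left_mono mult_right_mono) auto
      also have "\<dots> \<le> C" using C[of \<xi>] by (simp add: power_add mult_ac)
      finally have "norm \<xi> powr \<beta> * norm (fourier f \<xi>) \<le> C / ?w ^ DIM('a)"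
        using w by (subst pos_le_divide_eq) (auto simp: mult_ac intro!: zero_less_power intro: add_pos_nonneg)
      also have "\<dots> \<le> norm (C * (1 / ?w ^ DIM('a)))"
        unfolding times_divide_eq_right mult_1_right real_norm_def by (rule abs_ge_self)
      finally show ?thesis by (simp add: norm_mult)
    qed
    thus "AE \<xi> in lborel. norm (of_real (norm \<xi> powr \<beta>) * fourier f \<xi>) \<le> norm (C * (1 / (1 + (norm (\<xi>::'a))\<^sup>2) ^ DIM('a)))"
      by (intro AE_I2)
  qed measurable
qed

lemma integrable_fourier:
  assumes f: "f \<in> test_functions"
  shows "integrable lborel (fourier f)"
proof -
  have [measurable]: "f \<in> borel_measurable borel" by (rule test_functions_measurable[OF f])
  show ?thesis
  proof (rule integrable_cong_AE_imp[OF integrable_powr_fourier[OF f, of 0]])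
    show "AE \<xi> in lborel. of_real (norm \<xi> powr 0) * fourier f \<xi> = fourier f \<xi>"
      using AE_lborel_singleton[of 0] by eventually_elim simp
  qed auto
qed

section \<open>The heat operators and Fourier inversion\<close>

definition heat :: "real \<Rightarrow> ('a::euclidean_space \<Rightarrow> complex) \<Rightarrow> 'a \<Rightarrow> complex" where
  "heat t f x = (LINT y|lborel. of_real (heat_kernel t (x - y)) * f y)"

text \<open>Here the heat operator meets an inverse transform. This form suits the fractional Laplacian, which is defined
as such an inverse transform, because it asks for integrability on the frequency side only.\<close>

lemma heat_inverse_fourier:
  fixes h :: "'a::euclidean_space \<Rightarrow> complex"
  assumes t: "t > 0" and h: "integrable lborel h"
  shows "heat t (inverse_fourier h) x = inverse_fourier (\<lambda>\<xi>. of_real (exp (- t * (norm \<xi>)\<^sup>2)) * h \<xi>) x"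
proof -
  have [measurable]: "h \<in> borel_measurable borel" using h by auto
  let ?c = "complex_of_real (1 / (2 * pi) ^ DIM('a))"
  have int: "integrable lborel (\<lambda>y. complex_of_real (heat_kernel t (x - y)))"
  proof -
    have "integrable lborel (\<lambda>y. heat_kernel t (x - y))"
      using heat_kernel_fourier(2)[OF t, where 'a='a] t
      by (simp add: integrable_iff_bounded nn_integral_lborel_reflect[of "\<lambda>y. ennreal (heat_kernel t y)" x])
    thus ?thesis by simp
  qed
  have "heat t (inverse_fourier h) x =
     (LINT y|lborel. ?c * (LINT \<xi>|lborel. of_real (heat_kernel t (x - y)) * h \<xi> * cis (y \<bullet> \<xi>)))"
  proof -
    have "of_real (heat_kernel t (x - y)) * inverse_fourier h y =
       ?c * (LINT \<xi>|lborel. of_real (heat_kernel t (x - y)) * h \<xi> * cis (y \<bullet> \<xi>))" for y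
    proof -
      have "of_real (heat_kernel t (x - y)) * inverse_fourier h y =
         ?c * (of_real (heat_kernel t (x - y)) * (LINT \<xi>|lborel. cis (y \<bullet> \<xi>) * h \<xi>))"
        by (simp only: inverse_fourier_def mult_ac)
      also have "of_real (heat_kernel t (x - y)) * (LINT \<xi>|lborel. cis (y \<bullet> \<xi>) * h \<xi>) =
         (LINT \<xi>|lborel. of_real (heat_kernel t (x - y)) * (cis (y \<bullet> \<xi>) * h \<xi>))"
        by (rule integral_mult_right_zero[symmetric])
      finally show ?thesis by (simp only: mult_ac)
    qed
    thus ?thesis unfolding heat_def by simp
  qed
  also have "\<dots> = ?c * (LINT y|lborel. LINT \<xi>|lborel. of_real (heat_kernel t (x - y)) * h \<xi> * cis (y \<bullet> \<xi>))"
    by (rule integral_mult_right_zero)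
  also have "(LINT y|lborel. LINT \<xi>|lborel. of_real (heat_kernel t (x - y)) * h \<xi> * cis (y \<bullet> \<xi>)) =
     (LINT \<xi>|lborel. LINT y|lborel. of_real (heat_kernel t (x - y)) * h \<xi> * cis (y \<bullet> \<xi>))"
    by (rule integral_swap_lborel[OF int h]) auto
  also have "(\<lambda>\<xi>. LINT y|lborel. of_real (heat_kernel t (x - y)) * h \<xi> * cis (y \<bullet> \<xi>)) =
     (\<lambda>\<xi>. cis (x \<bullet> \<xi>) * (of_real (exp (- t * (norm \<xi>)\<^sup>2)) * h \<xi>))"
  proof
    fix \<xi>
    have "(LINT y|lborel. of_real (heat_kernel t (x - y)) * h \<xi> * cis (y \<bullet> \<xi>)) =
       (LINT z|lborel. of_real (heat_kernel t (x - (x + z))) * h \<xi> * cis ((x + z) \<bullet> \<xi>))"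
      by (rule integral_lborel_shift[symmetric]) measurable
    also have "\<dots> = (LINT z|lborel. (h \<xi> * cis (x \<bullet> \<xi>)) * (cis (z \<bullet> \<xi>) * of_real (heat_kernel t z)))"
      by (simp add: inner_add_left cis_mult[symmetric] mult_ac)
    also have "\<dots> = (h \<xi> * cis (x \<bullet> \<xi>)) * of_real (exp (- t * (norm \<xi>)\<^sup>2))"
      by (subst integral_mult_right_zero) (simp only: heat_kernel_fourier[OF t])
    finally show "(LINT y|lborel. of_real (heat_kernel t (x - y)) * h \<xi> * cis (y \<bullet> \<xi>)) =
      cis (x \<bullet> \<xi>) * (of_real (exp (- t * (norm \<xi>)\<^sup>2)) * h \<xi>)" by (simp add: mult_ac)
  qed
  finally show ?thesis unfolding inverse_fourier_def[of _ x] .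
qed

text \<open>The counterpart of \<open>heat_inverse_fourier\<close> with integrability on the space side. It holds without
Fourier inversion and is used to prove it.\<close>

lemma heat_eq_inverse_fourier:
  fixes f :: "'a::euclidean_space \<Rightarrow> complex"
  assumes t: "t > 0" and f: "integrable lborel f"
  shows "heat t f x = inverse_fourier (\<lambda>\<xi>. of_real (exp (- t * (norm \<xi>)\<^sup>2)) * fourier f \<xi>) x"
proof -
  have [measurable]: "f \<in> borel_measurable borel" using f by auto
  let ?c = "complex_of_real (1 / (2 * pi) ^ DIM('a))"
  let ?e = "\<lambda>\<xi>::'a. complex_of_real (exp (- t * (norm \<xi>)\<^sup>2))"
  have int: "integrable lborel (\<lambda>\<xi>::'a. ?e \<xi>)"
    using gaussian_fourier(2)[OF t, where 'a='a] by (simp only: complex_of_real_integrable_eq)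
  have "inverse_fourier (\<lambda>\<xi>. ?e \<xi> * fourier f \<xi>) x =
     ?c * (LINT \<xi>|lborel. LINT y|lborel. ?e \<xi> * f y * cis ((x - y) \<bullet> \<xi>))"
  proof -
    have "(\<lambda>\<xi>. cis (x \<bullet> \<xi>) * (?e \<xi> * fourier f \<xi>)) =
      (\<lambda>\<xi>. LINT y|lborel. ?e \<xi> * f y * cis ((x - y) \<bullet> \<xi>))"
    proof
      fix \<xi>
      have "cis (x \<bullet> \<xi>) * (?e \<xi> * fourier f \<xi>) =
        (cis (x \<bullet> \<xi>) * ?e \<xi>) * (LINT y|lborel. cis (- (y \<bullet> \<xi>)) * f y)"
        by (simp add: fourier_def mult_ac)
      also have "\<dots> = (LINT y|lborel. (cis (x \<bullet> \<xi>) * ?e \<xi>) * (cis (- (y \<bullet> \<xi>)) * f y))"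
        by (rule integral_mult_right_zero[symmetric])
      also have "\<dots> = (LINT y|lborel. ?e \<xi> * f y * (cis (x \<bullet> \<xi>) * cis (- (y \<bullet> \<xi>))))"
        by (simp only: mult_ac)
      finally show "cis (x \<bullet> \<xi>) * (?e \<xi> * fourier f \<xi>) =
        (LINT y|lborel. ?e \<xi> * f y * cis ((x - y) \<bullet> \<xi>))"
        by (simp add: cis_mult inner_diff_left)
    qed
    thus ?thesis by (simp add: inverse_fourier_def)
  qed
  also have "(LINT \<xi>|lborel. LINT y|lborel. ?e \<xi> * f y * cis ((x - y) \<bullet> \<xi>)) =
     (LINT y|lborel. LINT \<xi>|lborel. ?e \<xi> * f y * cis ((x - y) \<bullet> \<xi>))"
    by (rule integral_swap_lborel[OF int f]) auto
  also have "?c * \<dots> = (LINT y|lborel. ?c * (LINT \<xi>|lborel. ?e \<xi> * f y * cis ((x - y) \<bullet> \<xi>)))"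
    by (rule integral_mult_right_zero[symmetric])
  also have "(\<lambda>y. ?c * (LINT \<xi>|lborel. ?e \<xi> * f y * cis ((x - y) \<bullet> \<xi>))) =
     (\<lambda>y. of_real (heat_kernel t (x - y)) * f y)"
  proof
    fix y
    have "(LINT \<xi>|lborel. ?e \<xi> * f y * cis ((x - y) \<bullet> \<xi>)) =
       (LINT \<xi>|lborel. f y * (cis (\<xi> \<bullet> (x - y)) * ?e \<xi>))"
      by (simp only: mult_ac inner_commute[of "x - y"])
    also have "\<dots> = f y * (LINT \<xi>|lborel. cis (\<xi> \<bullet> (x - y)) * ?e \<xi>)"
      by (rule integral_mult_right_zero)
    finally have e: "(LINT \<xi>|lborel. ?e \<xi> * f y * cis ((x - y) \<bullet> \<xi>)) =
       f y * (LINT \<xi>|lborel. cis (\<xi> \<bullet> (x - y)) * ?e \<xi>)" .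
    show "?c * (LINT \<xi>|lborel. ?e \<xi> * f y * cis ((x - y) \<bullet> \<xi>)) =
       of_real (heat_kernel t (x - y)) * f y"
      unfolding e mult.left_commute[of ?c "f y"] heat_kernel_eq_integral[OF t] by (rule mult.commute)
  qed
  finally show ?thesis by (simp add: heat_def)
qed

text \<open>After the substitution \<open>y = x + sqrt t * z\<close> the kernel no longer depends on \<open>t\<close>, and dominated
convergence applies to the bounded continuous function \<open>f\<close>.\<close>

lemma heat_tendsto:
  fixes f :: "'a::euclidean_space \<Rightarrow> complex"
  assumes f: "f \<in> test_functions"
  shows "(\<lambda>n. heat (1 / real (Suc n)) f x) \<longlonglongrightarrow> f x"
proof -
  have [measurable]: "f \<in> borel_measurable borel" by (rule test_functions_measurable[OF f])
  obtain B where B: "\<And>x. norm (f x) \<le> B" using test_functions_bounded_support[OF f] by metis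
  define r where "r n = sqrt (1 / real (Suc n))" for n
  have r: "r n > 0" "(r n)\<^sup>2 = 1 / real (Suc n)" for n by (auto simp: r_def)
  have eq: "heat (1 / real (Suc n)) f x = (LINT z|lborel. of_real (heat_kernel 1 z) * f (x + r n *\<^sub>R z))" for n
  proof -
    have "heat (1 / real (Suc n)) f x = (LINT z|lborel. of_real (heat_kernel ((r n)\<^sup>2) (x - (x + z))) * f (x + z))"
      unfolding heat_def r by (rule integral_lborel_shift[symmetric]) measurable
    also have "\<dots> = (\<bar>r n\<bar> ^ DIM('a)) *\<^sub>R (LINT z|lborel. of_real (heat_kernel ((r n)\<^sup>2) (x - (x + r n *\<^sub>R z))) * f (x + r n *\<^sub>R z))"
      using r(1)[of n] by (intro integral_lborel_scale) auto
    also have "\<dots> = (LINT z|lborel. (\<bar>r n\<bar> ^ DIM('a)) *\<^sub>R (of_real (heat_kernel ((r n)\<^sup>2) (x - (x + r n *\<^sub>R z))) * f (x + r n *\<^sub>R z)))"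
      by (rule integral_scaleR_right[symmetric])
    also have "\<dots> = (LINT z|lborel. of_real (heat_kernel 1 z) * f (x + r n *\<^sub>R z))"
    proof (intro Bochner_Integration.integral_cong refl)
      fix z :: 'a
      have "\<bar>r n\<bar> ^ DIM('a) * heat_kernel ((r n)\<^sup>2) (r n *\<^sub>R z) = heat_kernel 1 z"
        using r(1)[of n] by (simp add: heat_kernel_def real_sqrt_mult power_mult_distrib)
      moreover have "heat_kernel ((r n)\<^sup>2) (x - (x + r n *\<^sub>R z)) = heat_kernel ((r n)\<^sup>2) (r n *\<^sub>R z)"
        by simp
      ultimately show "(\<bar>r n\<bar> ^ DIM('a)) *\<^sub>R (of_real (heat_kernel ((r n)\<^sup>2) (x - (x + r n *\<^sub>R z))) * f (x + r n *\<^sub>R z)) =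
         of_real (heat_kernel 1 z) * f (x + r n *\<^sub>R z)"
        by (metis (no_types, lifting) mult.assoc of_real_mult scaleR_conv_of_real)
    qed
    finally show ?thesis .
  qed
  have "(\<lambda>n. LINT z|lborel. of_real (heat_kernel 1 z) * f (x + r n *\<^sub>R z)) \<longlonglongrightarrow> (LINT z|lborel. of_real (heat_kernel 1 (z::'a)) * f x)"
  proof (rule integral_dominated_convergence[where w="\<lambda>z. B * heat_kernel 1 z"])
    show "integrable lborel (\<lambda>z::'a. B * heat_kernel 1 z)"
      by (intro integrable_mult_right heat_kernel_fourier) simp
    show "AE z in lborel. norm (of_real (heat_kernel 1 z) * f (x + r n *\<^sub>R z)) \<le> B * heat_kernel 1 z" for n
      using B by (intro AE_I2) (auto simp: norm_mult mult.commute[of B] intro!: mult_left_mono)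
    have "r \<longlonglongrightarrow> 0"
      unfolding r_def using tendsto_real_sqrt[OF LIMSEQ_one_over_Suc] by simp
    hence "(\<lambda>n. f (x + r n *\<^sub>R z)) \<longlonglongrightarrow> f (x + 0 *\<^sub>R z)" for z
      by (intro isCont_tendsto_compose[of _ f] tendsto_intros)
         (use test_functions_continuous[OF f] in \<open>auto simp: continuous_on_eq_continuous_at\<close>)
    thus "AE z in lborel. (\<lambda>n. of_real (heat_kernel 1 z) * f (x + r n *\<^sub>R z)) \<longlonglongrightarrow> of_real (heat_kernel 1 z) * f x"
      by (intro AE_I2 tendsto_intros) auto
  qed measurable
  also have "(LINT z|lborel. of_real (heat_kernel 1 (z::'a)) * f x) = f x"
    using heat_kernel_fourier(1)[of 1 "0::'a"] by (subst integral_mult_left_zero) auto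
  finally show ?thesis unfolding eq .
qed

text \<open>Both sides are limits of \<open>heat t f\<close> as \<open>t\<close> tends to 0: the right hand side by \<open>heat_tendsto\<close>,
the left hand side because \<open>exp (- t * (norm \<xi>)\<^sup>2)\<close> tends to 1 under an integrable majorant.\<close>

lemma fourier_inversion:
  fixes f :: "'a::euclidean_space \<Rightarrow> complex"
  assumes f: "f \<in> test_functions"
  shows "inverse_fourier (fourier f) = f"
proof
  fix x
  have [measurable]: "f \<in> borel_measurable borel" by (rule test_functions_measurable[OF f])
  let ?e = "\<lambda>n \<xi>. of_real (exp (- (1 / real (Suc n)) * (norm (\<xi>::'a))\<^sup>2)) :: complex"
  have "(\<lambda>n. inverse_fourier (\<lambda>\<xi>. ?e n \<xi> * fourier f \<xi>) x) \<longlonglongrightarrow> inverse_fourier (fourier f) x"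
    unfolding inverse_fourier_def
  proof (intro tendsto_mult tendsto_const integral_dominated_convergence[where w="\<lambda>\<xi>. norm (fourier f \<xi>)"])
    show "integrable lborel (\<lambda>\<xi>. norm (fourier f \<xi>))" using integrable_fourier[OF f] by simp
    show "AE \<xi> in lborel. norm (cis (x \<bullet> \<xi>) * (?e n \<xi> * fourier f \<xi>)) \<le> norm (fourier f \<xi>)" for n
      by (intro AE_I2) (auto simp: norm_mult intro!: mult_left_le_one_le)
    have "(\<lambda>n. ?e n \<xi>) \<longlonglongrightarrow> of_real (exp (- 0 * (norm \<xi>)\<^sup>2))" for \<xi> :: 'a
      by (intro tendsto_of_real tendsto_exp tendsto_mult tendsto_minus LIMSEQ_one_over_Suc tendsto_const)
    hence "(\<lambda>n. cis (x \<bullet> \<xi>) * (?e n \<xi> * fourier f \<xi>)) \<longlonglongrightarrow> cis (x \<bullet> \<xi>) * (of_real (exp (- 0 * (norm \<xi>)\<^sup>2)) * fourier f \<xi>)" for \<xi>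
      by (intro tendsto_mult tendsto_const)
    thus "AE \<xi> in lborel. (\<lambda>n. cis (x \<bullet> \<xi>) * (?e n \<xi> * fourier f \<xi>)) \<longlonglongrightarrow> cis (x \<bullet> \<xi>) * fourier f \<xi>"
      by (intro AE_I2) simp
  qed measurable
  moreover have "inverse_fourier (\<lambda>\<xi>. ?e n \<xi> * fourier f \<xi>) x = heat (1 / real (Suc n)) f x" for n
    by (rule heat_eq_inverse_fourier[symmetric]) (auto intro: test_functions_integrable f)
  ultimately show "inverse_fourier (fourier f) x = f x"
    using heat_tendsto[OF f, of x] by (simp only: LIMSEQ_unique)
qed

text \<open>A superposition of heat operators with density \<open>m\<close> is the multiplier whose symbol is the Laplace transform
of \<open>m\<close>, evaluated at \<open>(norm \<xi>)\<^sup>2\<close>. Identities between Laplace transforms thereby become identities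
between operators.\<close>

lemma integral_heat_inverse_fourier:
  fixes h :: "'a::euclidean_space \<Rightarrow> complex"
  assumes m: "integrable lborel m" and m0: "\<And>t. t \<le> 0 \<Longrightarrow> m t = 0" and h: "integrable lborel h"
  shows "(LINT t|lborel. of_real (m t) * heat t (inverse_fourier h) x) =
    inverse_fourier (\<lambda>\<xi>. of_real (LINT t|lborel. m t * exp (- t * (norm \<xi>)\<^sup>2)) * h \<xi>) x"
proof -
  have [measurable]: "h \<in> borel_measurable borel" "m \<in> borel_measurable borel" using h m by auto
  let ?c = "complex_of_real (1 / (2 * pi) ^ DIM('a))"
  let ?k = "\<lambda>t \<xi>. cis (x \<bullet> \<xi>) * of_real (if t > 0 then exp (- t * (norm \<xi>)\<^sup>2) else 0)"
  have "of_real (m t) * heat t (inverse_fourier h) x = ?c * (LINT \<xi>|lborel. of_real (m t) * h \<xi> * ?k t \<xi>)" for t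
  proof (cases "t > 0")
    case True
    have "(LINT \<xi>|lborel. of_real (m t) * h \<xi> * ?k t \<xi>) = (LINT \<xi>|lborel. of_real (m t) * (cis (x \<bullet> \<xi>) * (of_real (exp (- t * (norm \<xi>)\<^sup>2)) * h \<xi>)))"
      using True by (simp add: mult_ac)
    also have "\<dots> = of_real (m t) * (LINT \<xi>|lborel. cis (x \<bullet> \<xi>) * (of_real (exp (- t * (norm \<xi>)\<^sup>2)) * h \<xi>))"
      by (rule integral_mult_right_zero)
    finally show ?thesis
      unfolding heat_inverse_fourier[OF True h] by (simp add: inverse_fourier_def mult_ac)
  qed (use m0 in auto)
  hence "(LINT t|lborel. of_real (m t) * heat t (inverse_fourier h) x) = ?c * (LINT t|lborel. LINT \<xi>|lborel. of_real (m t) * h \<xi> * ?k t \<xi>)"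
    by simp
  also have "(LINT t|lborel. LINT \<xi>|lborel. of_real (m t) * h \<xi> * ?k t \<xi>) = (LINT \<xi>|lborel. LINT t|lborel. of_real (m t) * h \<xi> * ?k t \<xi>)"
  proof (rule integral_swap_lborel)
    show "integrable lborel (\<lambda>t. complex_of_real (m t))" using m by simp
    show "norm (?k t \<xi>) \<le> 1" for t \<xi> by (auto simp: norm_mult)
  qed (use h in measurable)
  also have "(\<lambda>\<xi>. LINT t|lborel. of_real (m t) * h \<xi> * ?k t \<xi>) =
     (\<lambda>\<xi>. cis (x \<bullet> \<xi>) * (of_real (LINT t|lborel. m t * exp (- t * (norm \<xi>)\<^sup>2)) * h \<xi>))"
  proof
    fix \<xi>
    have "of_real (m t) * h \<xi> * ?k t \<xi> = (cis (x \<bullet> \<xi>) * h \<xi>) * of_real (m t * exp (- t * (norm \<xi>)\<^sup>2))" for t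
      using m0[of t] by (cases "t > 0") (auto simp: mult_ac)
    hence "(LINT t|lborel. of_real (m t) * h \<xi> * ?k t \<xi>) = (cis (x \<bullet> \<xi>) * h \<xi>) * (LINT t|lborel. of_real (m t * exp (- t * (norm \<xi>)\<^sup>2)))"
      by (simp only: integral_mult_right_zero)
    also have "(LINT t|lborel. complex_of_real (m t * exp (- t * (norm \<xi>)\<^sup>2))) = of_real (LINT t|lborel. m t * exp (- t * (norm \<xi>)\<^sup>2))"
      by (rule integral_complex_of_real)
    finally show "(LINT t|lborel. of_real (m t) * h \<xi> * ?k t \<xi>) = cis (x \<bullet> \<xi>) * (of_real (LINT t|lborel. m t * exp (- t * (norm \<xi>)\<^sup>2)) * h \<xi>)"
      by (simp only: mult_ac)
  qed
  finally show ?thesis unfolding inverse_fourier_def[of _ x] .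
qed

section \<open>Laplace transforms of powers and their differences\<close>

lemma laplace_power:
  fixes s u :: real
  assumes s: "s > 0" and u: "u > 0"
  shows "has_bochner_integral lborel (\<lambda>t. (if t > 0 then t powr (s - 1) else 0) * exp (- t * u)) (Gamma s * u powr (- s))"
proof -
  define F where "F t = (if t > 0 then t powr (s - 1) else 0) * exp (- t)" for t :: real
  have [measurable]: "F \<in> borel_measurable borel" unfolding F_def by measurable
  have Feq: "F t = indicator {0..} t * t powr (s - 1) / exp t" for t
    by (auto simp: F_def exp_minus divide_inverse indicator_def)
  have G: "has_bochner_integral lborel F (Gamma s)"
  proof (rule has_bochner_integral_nn_integral)
    show "(\<integral>\<^sup>+ t. ennreal (F t) \<partial>lborel) = ennreal (Gamma s)"
      unfolding Feq by (rule Gamma_conv_nn_integral_real[OF s, symmetric])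
  qed (use Gamma_real_pos[OF s] in \<open>auto simp: F_def\<close>)
  have "has_bochner_integral lborel (\<lambda>t. F (0 + u * t)) (Gamma s /\<^sub>R \<bar>u\<bar>)"
    using lborel_has_bochner_integral_real_affine_iff[of u F "Gamma s" 0] u G by simp
  hence B: "has_bochner_integral lborel (\<lambda>t. u powr (1 - s) * F (0 + u * t)) (u powr (1 - s) * (Gamma s /\<^sub>R \<bar>u\<bar>))"
    by (rule has_bochner_integral_mult_right)
  have eq1: "u powr (1 - s) * F (0 + u * t) = (if t > 0 then t powr (s - 1) else 0) * exp (- t * u)" for t
  proof (cases "t > 0")
    case True
    have "u powr (1 - s) * u powr (s - 1) = 1"
      using u by (simp flip: powr_add)
    hence "u powr (1 - s) * (u powr (s - 1) * (t powr (s - 1) * exp (- (u * t)))) = t powr (s - 1) * exp (- (u * t))"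
      unfolding mult.assoc[symmetric] by simp
    with True u show ?thesis by (simp add: F_def powr_mult mult_ac)
  qed (use u in \<open>auto simp: F_def zero_less_mult_iff\<close>)
  have eq2: "u powr (1 - s) * (Gamma s /\<^sub>R \<bar>u\<bar>) = Gamma s * u powr (- s)"
    using u by (simp add: powr_diff powr_minus divide_simps)
  show ?thesis using B unfolding eq1 eq2 .
qed

text \<open>The \<open>N\<close>-th backward difference, with step 1, of the function that is \<open>t powr (s - 1)\<close> for positive
\<open>t\<close> and vanishes elsewhere. Its Laplace transform is the one of the power, which is a multiple of \<open>u powr (- s)\<close>,
times \<open>(1 - exp (- u)) ^ N\<close>. The second factor cancels the singularity of the first at \<open>u = 0\<close>, and correspondingly
the density becomes integrable at infinity once \<open>N\<close> exceeds \<open>s\<close>, which the power itself is not.\<close>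

primrec power_diff :: "nat \<Rightarrow> real \<Rightarrow> real \<Rightarrow> real" where
  "power_diff 0 s t = (if t > 0 then t powr (s - 1) else 0)"
| "power_diff (Suc N) s t = power_diff N s t - power_diff N s (t - 1)"

lemma power_diff_nonpos: "t \<le> 0 \<Longrightarrow> power_diff N s t = 0"
  by (induction N arbitrary: t) auto

lemma measurable_power_diff [measurable]: "power_diff N s \<in> borel_measurable borel"
proof (induction N)
  case 0
  have "power_diff 0 s = (\<lambda>t. if t > 0 then t powr (s - 1) else 0)" by auto
  thus ?case by simp
next
  case (Suc N)
  note [measurable] = this
  have "power_diff (Suc N) s = (\<lambda>t. power_diff N s t - power_diff N s (t - 1))" by auto
  thus ?case by simp
qed

lemma laplace_power_diff:
  assumes s: "s > 0" and u: "u > 0"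
  shows "has_bochner_integral lborel (\<lambda>t. power_diff N s t * exp (- t * u)) (Gamma s * u powr (- s) * (1 - exp (- u)) ^ N)"
proof (induction N)
  case 0
  show ?case using laplace_power[OF assms] by simp
next
  case (Suc N)
  let ?V = "Gamma s * u powr (- s) * (1 - exp (- u)) ^ N"
  have "has_bochner_integral lborel (\<lambda>t. power_diff N s (- 1 + 1 * t) * exp (- (- 1 + 1 * t) * u)) (?V /\<^sub>R \<bar>1\<bar>)"
    using lborel_has_bochner_integral_real_affine_iff[of 1 "\<lambda>t. power_diff N s t * exp (- t * u)" ?V "-1"] Suc by simp
  hence "has_bochner_integral lborel (\<lambda>t. exp (- u) * (power_diff N s (- 1 + 1 * t) * exp (- (- 1 + 1 * t) * u))) (exp (- u) * (?V /\<^sub>R \<bar>1\<bar>))"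
    by (rule has_bochner_integral_mult_right)
  hence B: "has_bochner_integral lborel (\<lambda>t. power_diff N s t * exp (- t * u) - exp (- u) * (power_diff N s (- 1 + 1 * t) * exp (- (- 1 + 1 * t) * u)))
     (?V - exp (- u) * (?V /\<^sub>R \<bar>1\<bar>))"
    by (intro has_bochner_integral_diff Suc)
  have eq1: "power_diff N s t * exp (- t * u) - exp (- u) * (power_diff N s (- 1 + 1 * t) * exp (- (- 1 + 1 * t) * u))
     = power_diff (Suc N) s t * exp (- t * u)" for t
  proof -
    have "exp (- u) * exp (- (- 1 + 1 * t) * u) = exp (- t * u)"
      unfolding exp_add[symmetric] by (simp add: algebra_simps)
    hence "exp (- u) * (power_diff N s (- 1 + 1 * t) * exp (- (- 1 + 1 * t) * u)) = power_diff N s (t - 1) * exp (- t * u)"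
      by (simp only: mult.left_commute[of "exp (- u)"]) simp
    thus ?thesis by (simp only: power_diff.simps left_diff_distrib)
  qed
  have eq2: "?V - exp (- u) * (?V /\<^sub>R \<bar>1\<bar>) = Gamma s * u powr (- s) * (1 - exp (- u)) ^ Suc N"
    by (simp add: algebra_simps)
  show ?case using B unfolding eq1 eq2 .
qed

lemma DERIV_power_diff:
  "t > real N \<Longrightarrow> (power_diff N s has_real_derivative (s - 1) * power_diff N (s - 1) t) (at t)"
proof (induction N arbitrary: t)
  case 0
  have "((\<lambda>t. t powr (s - 1)) has_real_derivative (s - 1) * power_diff 0 (s - 1) t) (at t)"
    using 0 by (auto intro!: derivative_eq_intros)
  thus ?case
    by (rule has_field_derivative_transform_within_open[where S="{0<..}"]) (use 0 in auto)
next
  case (Suc N)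
  have eq: "power_diff (Suc N) s = (\<lambda>t. power_diff N s t - power_diff N s (t - 1))" by auto
  have 1: "(power_diff N s has_real_derivative (s - 1) * power_diff N (s - 1) (t - 1)) (at (t - 1))"
    using Suc by auto
  have "((\<lambda>t. power_diff N s (t - 1)) has_real_derivative (s - 1) * power_diff N (s - 1) (t - 1) * 1) (at t)"
    by (rule DERIV_chain'[where f="\<lambda>t. t - 1" and g="power_diff N s", OF _ 1]) (auto intro!: derivative_eq_intros)
  moreover have "(power_diff N s has_real_derivative (s - 1) * power_diff N (s - 1) t) (at t)"
    using Suc by auto
  ultimately show ?case unfolding eq by (auto intro!: derivative_eq_intros simp: algebra_simps)
qed

text \<open>By the mean value theorem one difference costs one derivative, and the derivative of \<open>t powr (s - 1)\<close> is again
such a power with \<open>s\<close> lowered by 1; \<open>N\<close> differences thus gain \<open>N\<close> powers of decay. The hypothesis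
makes the exponents occurring in the induction nonpositive, so that the bounds may be moved to the left end of
the interval that contains the intermediate point.\<close>

lemma power_diff_tail:
  assumes "s \<le> real N + 1"
  shows "\<exists>C\<ge>0. \<forall>t > real N. \<bar>power_diff N s t\<bar> \<le> C * (t - N) powr (s - 1 - N)"
  using assms
proof (induction N arbitrary: s)
  case 0
  show ?case by (intro exI[of _ 1]) auto
next
  case (Suc N)
  then obtain C where C: "C \<ge> 0" "\<And>t. t > real N \<Longrightarrow> \<bar>power_diff N (s - 1) t\<bar> \<le> C * (t - N) powr (s - 1 - 1 - N)"
    using Suc.IH[of "s - 1"] by auto
  have "\<bar>power_diff (Suc N) s t\<bar> \<le> \<bar>s - 1\<bar> * C * (t - Suc N) powr (s - 1 - Suc N)" if t: "t > real (Suc N)" for t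
  proof -
    have "\<exists>z. t - 1 < z \<and> z < t \<and> power_diff N s t - power_diff N s (t - 1) = (t - (t - 1)) * ((s - 1) * power_diff N (s - 1) z)"
      by (rule MVT2) (use t in \<open>auto intro!: DERIV_power_diff\<close>)
    then obtain z where z: "t - 1 < z" "z < t" "power_diff (Suc N) s t = (s - 1) * power_diff N (s - 1) z"
      by auto
    have "\<bar>power_diff N (s - 1) z\<bar> \<le> C * (z - N) powr (s - 1 - 1 - N)"
      using z t by (intro C(2)) auto
    also have "\<dots> \<le> C * (t - Suc N) powr (s - 1 - 1 - N)"
      using z t C(1) Suc.prems by (intro mult_left_mono powr_mono2') auto
    finally have "\<bar>s - 1\<bar> * \<bar>power_diff N (s - 1) z\<bar> \<le> \<bar>s - 1\<bar> * (C * (t - Suc N) powr (s - 1 - 1 - N))"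
      by (rule mult_left_mono) auto
    thus ?thesis by (simp add: z(3) abs_mult mult_ac diff_diff_eq add_ac del: power_diff.simps)
  qed
  thus ?case using C(1) by (intro exI[of _ "\<bar>s - 1\<bar> * C"]) auto
qed

lemma integrable_powr_atLeast:
  fixes r a :: real
  assumes r: "r < - 1"
  shows "integrable lborel (\<lambda>t. indicator {a + 1..} t * (t - a) powr r)"
proof -
  have "(\<integral>\<^sup>+t. ennreal ((t - a) powr r) * indicator {a + 1..} t \<partial>lborel) = 0 - (((a + 1) - a) powr (r + 1) / (r + 1))"
  proof (rule nn_integral_FTC_atLeast)
    show "((\<lambda>t. (t - a) powr (r + 1) / (r + 1)) has_real_derivative (t - a) powr r) (at t)" if "a + 1 \<le> t" for t
    proof -
      have "((\<lambda>t. (t - a) powr (r + 1) / (r + 1)) has_real_derivative ((r + 1) * (t - a) powr (r + 1 - 1)) / (r + 1)) (at t)"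
        using that by (auto intro!: derivative_eq_intros)
      thus ?thesis using r by simp
    qed
    have "((\<lambda>t. (t - a) powr (r + 1)) \<longlongrightarrow> 0) at_top"
    proof (rule tendsto_neg_powr)
      show "filterlim (\<lambda>t. t - a) at_top at_top" by real_asymp
    qed (use r in simp)
    hence "((\<lambda>t. (t - a) powr (r + 1) / (r + 1)) \<longlongrightarrow> 0 / (r + 1)) at_top"
      using r by (intro tendsto_divide tendsto_const) auto
    thus "((\<lambda>t. (t - a) powr (r + 1) / (r + 1)) \<longlongrightarrow> 0) at_top" by simp
  qed auto
  hence "(\<integral>\<^sup>+t. ennreal ((t - a) powr r) * indicator {a + 1..} t \<partial>lborel) < \<infinity>" by simp
  thus ?thesis
    by (intro integrableI_bounded) (auto simp: abs_mult ennreal_mult' ennreal_indicator mult.commute)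
qed

text \<open>The singularity of \<open>power_diff N s\<close> at a positive integer \<open>k\<close> is the one of \<open>t powr (s - 1)\<close> at 0, and there
\<open>t powr (- c)\<close> is harmless; comparing \<open>t powr (- c)\<close> with its value at \<open>t - 1\<close> transports the
estimate at 0 to all of them.\<close>

lemma integrable_power_diff_local:
  assumes c: "0 \<le> c" "c < s"
  shows "integrable lborel (\<lambda>t. indicator {..T} t * (\<bar>power_diff N s t\<bar> * t powr (- c)))"
proof (induction N arbitrary: T)
  case 0
  have "integrable lborel (\<lambda>t. exp T * ((if t > 0 then t powr (s - c - 1) else 0) * exp (- t * 1)))"
    using laplace_power[of "s - c" 1] c by (intro integrable_mult_right) (auto simp: has_bochner_integral_iff)
  thus ?case
  proof (rule Bochner_Integration.integrable_bound)
    show "AE t in lborel. norm (indicator {..T} t * (\<bar>power_diff 0 s t\<bar> * t powr (- c))) \<le>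
       norm (exp T * ((if t > 0 then t powr (s - c - 1) else 0) * exp (- t * 1)))"
    proof (intro AE_I2)
      fix t
      show "norm (indicator {..T} t * (\<bar>power_diff 0 s t\<bar> * t powr (- c))) \<le>
       norm (exp T * ((if t > 0 then t powr (s - c - 1) else 0) * exp (- t * 1)))"
      proof (cases "0 < t \<and> t \<le> T")
        case True
        have "t powr (s - 1) * t powr (- c) = t powr (s - c - 1)"
          by (simp flip: powr_add add: algebra_simps)
        moreover have "t powr (s - c - 1) * 1 \<le> t powr (s - c - 1) * exp (T - t)"
          using True by (intro mult_left_mono) auto
        ultimately show ?thesis using True by (simp add: exp_diff exp_minus divide_inverse mult_ac)
      qed auto
    qed
  qed simp
next
  case (Suc N)
  let ?W = "\<lambda>T t. indicator {..T} t * (\<bar>power_diff N s t\<bar> * t powr (- c))"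
  have "integrable lborel (\<lambda>t. ?W (T - 1) (- 1 + 1 * t))"
    using lborel_integrable_real_affine_iff[of 1 "\<lambda>t. ?W (T - 1) t" "-1"] Suc[of "T - 1"]
    by simp
  hence "integrable lborel (\<lambda>t. ?W T t +
      ?W (T - 1) (- 1 + 1 * t))"
    by (intro Bochner_Integration.integrable_add Suc)
  thus ?case
  proof (rule Bochner_Integration.integrable_bound)
    show "AE t in lborel. norm (indicator {..T} t * (\<bar>power_diff (Suc N) s t\<bar> * t powr (- c))) \<le>
       norm (?W T t +
      ?W (T - 1) (- 1 + 1 * t))"
    proof (intro AE_I2)
      fix t
      have 2: "\<bar>power_diff N s (t - 1)\<bar> * t powr (- c) \<le> \<bar>power_diff N s (t - 1)\<bar> * (t - 1) powr (- c)"
      proof (cases "t - 1 > 0")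
        case True
        thus ?thesis using c by (intro mult_left_mono powr_mono2') auto
      qed (simp add: power_diff_nonpos)
      have "\<bar>power_diff (Suc N) s t\<bar> * t powr (- c) \<le> (\<bar>power_diff N s t\<bar> + \<bar>power_diff N s (t - 1)\<bar>) * t powr (- c)"
        by (intro mult_right_mono) auto
      also have "\<dots> \<le> \<bar>power_diff N s t\<bar> * t powr (- c) + \<bar>power_diff N s (t - 1)\<bar> * (t - 1) powr (- c)"
        using 2 by (simp add: algebra_simps)
      finally show "norm (indicator {..T} t * (\<bar>power_diff (Suc N) s t\<bar> * t powr (- c))) \<le>
       norm (?W T t +
      ?W (T - 1) (- 1 + 1 * t))"
        by (auto simp: indicator_def)
    qed
  qed simp
qed

lemma integrable_power_diff:
  assumes c: "0 \<le> c" "c < s" and N: "s < real N"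
  shows "integrable lborel (\<lambda>t. \<bar>power_diff N s t\<bar> * t powr (- c))"
proof -
  obtain C where C: "C \<ge> 0" "\<And>t. t > real N \<Longrightarrow> \<bar>power_diff N s t\<bar> \<le> C * (t - N) powr (s - 1 - N)"
    using power_diff_tail[of s N] N by auto
  let ?W = "\<lambda>t. \<bar>power_diff N s t\<bar> * t powr (- c)"
  let ?D = "\<lambda>t. indicator {..real N + 1} t * ?W t + C * (indicator {real N + 1..} t * (t - N) powr (s - 1 - N))"
  have "integrable lborel (\<lambda>t. ?D t)"
    using N by (intro Bochner_Integration.integrable_add integrable_power_diff_local c integrable_mult_right integrable_powr_atLeast) auto
  thus ?thesis
  proof (rule Bochner_Integration.integrable_bound)
    show "AE t in lborel. norm (?W t) \<le> norm (?D t)"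
    proof (intro AE_I2)
      fix t
      show "norm (?W t) \<le> norm (?D t)"
      proof (cases "t \<le> real N + 1")
        case True
        thus ?thesis using C(1) by (auto simp: indicator_def)
      next
        case False
        have "t powr (- c) \<le> 1 powr (- c)" using False c by (intro powr_mono2') auto
        hence "\<bar>power_diff N s t\<bar> * t powr (- c) \<le> (C * (t - N) powr (s - 1 - N)) * 1"
          using False C by (intro mult_mono) auto
        thus ?thesis using False C(1) by (auto simp: indicator_def)
      qed
    qed
  qed simp
qed

lemma integrable_powr_initial:
  assumes "r < 1"
  shows "integrable lborel (\<lambda>t. indicator {0<..<1} t * t powr (- r :: real))"
proof -
  have "integrable lborel (\<lambda>t. exp 1 * ((if t > 0 then t powr (1 - r - 1) else 0) * exp (- t * 1)))"
    using laplace_power[of "1 - r" 1] assms by (intro integrable_mult_right) (auto simp: has_bochner_integral_iff)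
  thus ?thesis
  proof (rule Bochner_Integration.integrable_bound)
    show "AE t in lborel. norm (indicator {0<..<1} t * t powr (- r)) \<le> norm (exp 1 * ((if t > 0 then t powr (1 - r - 1) else 0) * exp (- t * 1)))"
    proof (intro AE_I2)
      fix t :: real
      have "t powr (- r) * 1 \<le> t powr (- r) * exp (1 - t)" if "t < 1"
        using that by (intro mult_left_mono) auto
      thus "norm (indicator {0<..<1} t * t powr (- r)) \<le> norm (exp 1 * ((if t > 0 then t powr (1 - r - 1) else 0) * exp (- t * 1)))"
        by (auto simp: indicator_def exp_diff exp_minus divide_inverse mult_ac)
    qed
  qed simp
qed

text \<open>This represents \<open>u powr r\<close> through \<open>u\<close>, \<open>exp (- u)\<close> and Laplace transforms of integrable functions. It starts from
\<open>Gamma (1 - r) * u powr r = u * \<integral> t powr (- r) * exp (- t * u) dt\<close>, whose integrand decays too slowly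
in \<open>t\<close> to be the density of a bounded superposition of heat operators. On \<open>t \<ge> 1\<close> integration by parts trades the
factor \<open>u\<close> for the decay \<open>t powr (- r - 1)\<close> and the boundary term \<open>exp (- u)\<close>.\<close>

lemma fractional_power_laplace:
  fixes r u :: real
  assumes r: "0 \<le> r" "r < 1" and u: "u > 0"
  shows "Gamma (1 - r) * u powr r =
    u * (LINT t|lborel. indicator {0<..<1} t * t powr (- r) * exp (- t * u)) + exp (- u)
      - (LINT t|lborel. r * (indicator {1..} t * t powr (- r - 1)) * exp (- t * u))"
proof -
  let ?A = "\<lambda>t. indicator {0<..<1} t * t powr (- r) * exp (- t * u)"
  let ?B = "\<lambda>t. indicator {1..} t * t powr (- r) * exp (- t * u)"
  let ?D = "\<lambda>t. r * (indicator {1..} t * t powr (- r - 1)) * exp (- t * u)"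
  have L: "has_bochner_integral lborel (\<lambda>t. (if t > 0 then t powr (- r) else 0) * exp (- t * u)) (Gamma (1 - r) * u powr (r - 1))"
  proof -
    have "1 - r - 1 = - r" "- (1 - r) = r - 1" by auto
    with laplace_power[of "1 - r" u] r u show ?thesis by (simp only: diff_gt_0_iff_gt)
  qed
  have iL: "integrable lborel (\<lambda>t. (if t > 0 then t powr (- r) else 0) * exp (- t * u))"
    using L by (simp add: has_bochner_integral_iff)
  have iA: "integrable lborel ?A"
    by (rule Bochner_Integration.integrable_bound[OF iL]) (auto simp: indicator_def)
  have iB: "integrable lborel ?B"
    by (rule Bochner_Integration.integrable_bound[OF iL]) (auto simp: indicator_def)
  have "(LINT t|lborel. ?A t) + (LINT t|lborel. ?B t) = (LINT t|lborel. ?A t + ?B t)"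
    using iA iB by simp
  also have "\<dots> = (LINT t|lborel. (if t > 0 then t powr (- r) else 0) * exp (- t * u))"
    by (intro Bochner_Integration.integral_cong refl) (auto simp: indicator_def)
  also have "\<dots> = Gamma (1 - r) * u powr (r - 1)"
    using L by (simp add: has_bochner_integral_iff)
  finally have 1: "(LINT t|lborel. ?A t) + (LINT t|lborel. ?B t) = Gamma (1 - r) * u powr (r - 1)" .
  have FTC: "(\<integral>\<^sup>+t. ennreal ((u * t powr (- r) + r * t powr (- r - 1)) * exp (- t * u)) * indicator {1..} t \<partial>lborel)
      = 0 - (- (1 powr (- r) * exp (- 1 * u)))"
  proof (rule nn_integral_FTC_atLeast)
    show "((\<lambda>t. - (t powr (- r) * exp (- t * u))) has_real_derivative (u * t powr (- r) + r * t powr (- r - 1)) * exp (- t * u)) (at t)"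
      if "1 \<le> t" for t
      using that by (auto intro!: derivative_eq_intros simp: field_simps)
    show "((\<lambda>t. - (t powr (- r) * exp (- t * u))) \<longlongrightarrow> 0) at_top"
      using r u by real_asymp
  qed (use r u in auto)
  have "has_bochner_integral lborel (\<lambda>t. (u * t powr (- r) + r * t powr (- r - 1)) * exp (- t * u) * indicator {1..} t) (exp (- u))"
    by (rule has_bochner_integral_nn_integral)
       (use r u FTC in \<open>auto simp: ennreal_mult' ennreal_indicator mult_ac\<close>)
  hence 2: "has_bochner_integral lborel (\<lambda>t. u * ?B t + ?D t) (exp (- u))"
    by (simp add: algebra_simps)
  have iD: "integrable lborel ?D"
  proof -
    have "integrable lborel (\<lambda>t. (u * ?B t + ?D t) - u * ?B t)"
      using 2 iB by (intro Bochner_Integration.integrable_diff) (auto simp: has_bochner_integral_iff)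
    thus ?thesis by simp
  qed
  have "u * (LINT t|lborel. ?B t) + (LINT t|lborel. ?D t) = (LINT t|lborel. u * ?B t + ?D t)"
    using iB iD by simp
  also have "\<dots> = exp (- u)" using 2 by (simp add: has_bochner_integral_iff)
  finally have 3: "u * (LINT t|lborel. ?B t) + (LINT t|lborel. ?D t) = exp (- u)" .
  have "Gamma (1 - r) * u powr r = u * (Gamma (1 - r) * u powr (r - 1))"
    using u by (simp add: powr_diff)
  also have "\<dots> = u * (LINT t|lborel. ?A t) + u * (LINT t|lborel. ?B t)"
    unfolding 1[symmetric] by (simp add: distrib_left)
  finally show ?thesis using 3 by linarith
qed

section \<open>Gaussian averages of power weights\<close>

lemma sets_cball [measurable]: "cball (x::'a::euclidean_space) r \<in> sets borel"
  by simp

text \<open>The ball is cut into the dyadic shells where \<open>norm y\<close> lies between \<open>\<rho> / 2 ^ Suc k\<close> and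
\<open>\<rho> / 2 ^ k\<close>; their contributions form a geometric series, convergent because \<open>\<sigma> < DIM('a)\<close>.\<close>

lemma nn_integral_norm_powr_cball:
  fixes \<sigma> :: real
  assumes \<sigma>: "0 \<le> \<sigma>" "\<sigma> < DIM('a::euclidean_space)"
  obtains C where "C \<ge> 0" "\<And>\<rho>. \<rho> > 0 \<Longrightarrow>
    (\<integral>\<^sup>+y. ennreal (indicator (cball 0 \<rho>) y * norm (y::'a) powr (- \<sigma>)) \<partial>lborel) \<le> ennreal (C * \<rho> powr (DIM('a) - \<sigma>))"
proof -
  define x where "x = 1 / 2 powr (DIM('a) - \<sigma>)"
  have x: "0 < x" "x < 1" using \<sigma> by (auto simp: x_def)
  define V where "V = unit_ball_vol (real DIM('a))"
  have V: "V \<ge> 0" by (simp add: V_def)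
  define C where "C = 2 powr \<sigma> * V / (1 - x)"
  have "(\<integral>\<^sup>+y. ennreal (indicator (cball 0 \<rho>) y * norm (y::'a) powr (- \<sigma>)) \<partial>lborel) \<le> ennreal (C * \<rho> powr (DIM('a) - \<sigma>))"
    if \<rho>: "\<rho> > 0" for \<rho>
  proof -
    let ?c = "\<lambda>k. (\<rho> / 2 ^ Suc k) powr (- \<sigma>)"
    let ?B = "\<lambda>k. cball (0::'a) (\<rho> / 2 ^ k)"
    have pw: "ennreal (indicator (cball 0 \<rho>) y * norm y powr (- \<sigma>)) \<le> (\<Sum>k. ennreal (?c k) * indicator (?B k) y)" for y :: 'a
    proof (cases "y \<noteq> 0 \<and> norm y \<le> \<rho>")
      case True
      define K where "K = (LEAST k. \<rho> / 2 ^ k < norm y)"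
      have "\<exists>k. (1 / 2) ^ k < norm y / \<rho>"
        using True \<rho> by (intro real_arch_pow_inv) auto
      hence "\<exists>k. \<rho> / 2 ^ k < norm y" using \<rho> by (simp add: field_simps power_divide)
      hence K: "\<rho> / 2 ^ K < norm y" unfolding K_def by (rule LeastI_ex)
      with True obtain k where k: "K = Suc k" by (cases K) auto
      hence "\<not> \<rho> / 2 ^ k < norm y" unfolding K_def by (intro not_less_Least) simp
      hence y: "y \<in> ?B k" by simp
      have "norm y powr (- \<sigma>) \<le> ?c k" using K k \<rho> \<sigma> by (intro powr_mono2') auto
      hence "ennreal (indicator (cball 0 \<rho>) y * norm y powr (- \<sigma>)) \<le> ennreal (?c k) * indicator (?B k) y"
        using True y by (simp add: ennreal_leI)
      also have "\<dots> \<le> (\<Sum>k. ennreal (?c k) * indicator (?B k) y)"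
      proof -
        have "F k \<le> suminf F" for F :: "nat \<Rightarrow> ennreal"
          using sum_le_suminf[OF summableI, of "{k}" F] by simp
        thus ?thesis .
      qed
      finally show ?thesis .
    qed auto
    have shell: "?c k * (V * (\<rho> / 2 ^ k) ^ DIM('a)) = 2 powr \<sigma> * V * \<rho> powr (DIM('a) - \<sigma>) * x ^ k" for k
    proof -
      let ?r = "\<rho> / 2 ^ k"
      have r: "?r > 0" using \<rho> by simp
      have "?c k = (?r / 2) powr (- \<sigma>)" by (simp add: field_simps)
      also have "\<dots> = 2 powr \<sigma> * ?r powr (- \<sigma>)"
        unfolding powr_divide[of ?r 2] by (simp add: powr_minus_divide)
      finally have "?c k * ?r ^ DIM('a) = 2 powr \<sigma> * (?r powr (- \<sigma>) * ?r powr (real DIM('a)))"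
        using powr_realpow[OF r, of "DIM('a)"] by simp
      also have "?r powr (- \<sigma>) * ?r powr (real DIM('a)) = ?r powr (DIM('a) - \<sigma>)"
        unfolding powr_add[symmetric] by simp
      also have "\<dots> = \<rho> powr (DIM('a) - \<sigma>) * x ^ k"
        unfolding powr_divide x_def by (simp add: power_one_over powr_power powr_powr mult.commute flip: powr_realpow)
      finally show ?thesis by (simp only: mult_ac)
    qed
    have "(\<integral>\<^sup>+y. ennreal (indicator (cball 0 \<rho>) y * norm (y::'a) powr (- \<sigma>)) \<partial>lborel) \<le>
       (\<integral>\<^sup>+y. (\<Sum>k. ennreal (?c k) * indicator (?B k) y) \<partial>lborel)"
      by (intro nn_integral_mono pw)
    also have "\<dots> = (\<Sum>k. \<integral>\<^sup>+y. ennreal (?c k) * indicator (?B k) y \<partial>lborel)"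
      by (rule nn_integral_suminf) measurable
    also have "\<dots> = (\<Sum>k. ennreal (2 powr \<sigma> * V * \<rho> powr (DIM('a) - \<sigma>) * x ^ k))"
      unfolding shell[symmetric] using \<rho> V
      by (intro suminf_cong) (simp add: nn_integral_cmult_indicator emeasure_cball V_def ennreal_mult)
    also have "\<dots> = ennreal (\<Sum>k. 2 powr \<sigma> * V * \<rho> powr (DIM('a) - \<sigma>) * x ^ k)"
      using x V by (intro suminf_ennreal2 summable_mult summable_geometric) auto
    also have "(\<Sum>k. 2 powr \<sigma> * V * \<rho> powr (DIM('a) - \<sigma>) * x ^ k) = C * \<rho> powr (DIM('a) - \<sigma>)"
      using x by (subst suminf_mult) (auto simp: suminf_geometric C_def)
    finally show ?thesis .
  qed
  moreover have "C \<ge> 0" using x V by (simp add: C_def)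
  ultimately show ?thesis using that by blast
qed

text \<open>Inside the ball of radius \<open>\<rho>\<close> only the singularity matters and \<open>K\<close> is replaced by its maximum; outside,
the power is at most \<open>\<rho> powr (- \<sigma>)\<close> and only the mass of \<open>K\<close> matters.\<close>

lemma nn_integral_norm_powr_split:
  fixes K :: "'a::euclidean_space \<Rightarrow> real" and \<sigma> C :: real
  assumes C: "(\<integral>\<^sup>+y. ennreal (indicator (cball 0 \<rho>) y * norm (y::'a) powr (- \<sigma>)) \<partial>lborel) \<le> ennreal (C * \<rho> powr (DIM('a) - \<sigma>))"
    and \<rho>: "\<rho> > 0" and \<sigma>: "\<sigma> \<ge> 0" and C0: "C \<ge> 0"
    and [measurable]: "K \<in> borel_measurable borel" and K0: "\<And>y. K y \<ge> 0"
    and KA: "\<And>y. norm y \<le> \<rho> \<Longrightarrow> K y \<le> A" and K1: "(\<integral>\<^sup>+y. ennreal (K y) \<partial>lborel) \<le> 1"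
  shows "(\<integral>\<^sup>+y. ennreal (K y * norm y powr (- \<sigma>)) \<partial>lborel) \<le> ennreal (A * (C * \<rho> powr (DIM('a) - \<sigma>)) + \<rho> powr (- \<sigma>))"
proof -
  have A: "A \<ge> 0" using KA[of 0] K0[of 0] \<rho> by simp
  have "(\<integral>\<^sup>+y. ennreal (K y * norm y powr (- \<sigma>)) \<partial>lborel) \<le>
     (\<integral>\<^sup>+y. ennreal A * ennreal (indicator (cball 0 \<rho>) y * norm y powr (- \<sigma>)) + ennreal (\<rho> powr (- \<sigma>)) * ennreal (K y) \<partial>lborel)"
  proof (intro nn_integral_mono)
    fix y :: 'a
    show "ennreal (K y * norm y powr (- \<sigma>)) \<le> ennreal A * ennreal (indicator (cball 0 \<rho>) y * norm y powr (- \<sigma>)) + ennreal (\<rho> powr (- \<sigma>)) * ennreal (K y)"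
    proof (cases "norm y \<le> \<rho>")
      case True
      have "K y * norm y powr (- \<sigma>) \<le> A * norm y powr (- \<sigma>)"
        by (intro mult_right_mono KA True) auto
      hence "ennreal (K y * norm y powr (- \<sigma>)) \<le> ennreal A * ennreal (indicator (cball 0 \<rho>) y * norm y powr (- \<sigma>))"
        using A True by (simp add: ennreal_leI flip: ennreal_mult)
      thus ?thesis by (rule order.trans) simp
    next
      case False
      have "norm y powr (- \<sigma>) \<le> \<rho> powr (- \<sigma>)"
        using False \<rho> \<sigma> by (intro powr_mono2') auto
      hence "K y * norm y powr (- \<sigma>) \<le> \<rho> powr (- \<sigma>) * K y"
        using K0[of y] by (subst mult.commute, intro mult_right_mono) auto
      thus ?thesis using False K0[of y] by (simp add: ennreal_leI flip: ennreal_mult)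
    qed
  qed
  also have "\<dots> = ennreal A * (\<integral>\<^sup>+y. ennreal (indicator (cball 0 \<rho>) (y::'a) * norm y powr (- \<sigma>)) \<partial>lborel) +
     ennreal (\<rho> powr (- \<sigma>)) * (\<integral>\<^sup>+y. ennreal (K y) \<partial>lborel)"
    by (subst nn_integral_add) (auto simp: nn_integral_cmult)
  also have "\<dots> \<le> ennreal A * ennreal (C * \<rho> powr (DIM('a) - \<sigma>)) + ennreal (\<rho> powr (- \<sigma>)) * 1"
    by (intro add_mono mult_left_mono C K1) auto
  also have "\<dots> = ennreal (A * (C * \<rho> powr (DIM('a) - \<sigma>)) + \<rho> powr (- \<sigma>))"
    using A C0 by (simp flip: ennreal_mult ennreal_plus)
  finally show ?thesis .
qed

lemma heat_kernel_le: "t > 0 \<Longrightarrow> heat_kernel t (x::'a::euclidean_space) \<le> 1 / sqrt (4 * pi * t) ^ DIM('a)"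
  unfolding heat_kernel_def by (intro divide_right_mono) auto

text \<open>In terms of the scale invariant quantity \<open>q = norm x / sqrt (4 * pi * t)\<close> the left hand side is
\<open>q ^ DIM('a) * exp (- pi * q\<^sup>2)\<close>, which is bounded. That the bound does not involve \<open>t\<close> is what makes
\<open>heat_kernel_weight_preserved\<close> uniform in \<open>t\<close>.\<close>

lemma heat_kernel_le_norm_power:
  assumes t: "t > 0"
  shows "heat_kernel t (x::'a::euclidean_space) * norm x ^ DIM('a) \<le> fact DIM('a) * exp 1"
proof -
  define q where "q = norm x / sqrt (4 * pi * t)"
  have q: "q \<ge> 0" using t by (simp add: q_def)
  have "q\<^sup>2 = (norm x)\<^sup>2 / (4 * pi * t)" using t by (simp add: q_def power_divide)
  hence e: "(norm x)\<^sup>2 / (4 * t) = pi * q\<^sup>2" using t by (simp add: field_simps)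
  have "q ^ DIM('a) / fact DIM('a) \<le> exp q"
  proof -
    have "(\<Sum>k\<in>{DIM('a)}. q ^ k /\<^sub>R fact k) \<le> (\<Sum>k. q ^ k /\<^sub>R fact k)"
      by (rule sum_le_suminf) (use q summable_exp_generic[of q] in auto)
    thus ?thesis by (simp add: exp_def divide_inverse mult.commute)
  qed
  hence 1: "q ^ DIM('a) \<le> fact DIM('a) * exp q" by (simp add: field_simps)
  have "0 \<le> (q - 1)\<^sup>2" by simp
  hence "2 * q \<le> 1 + q\<^sup>2" unfolding power2_diff by simp
  hence "q \<le> 1 + q\<^sup>2" using q by linarith
  also have "\<dots> \<le> 1 + pi * q\<^sup>2"
    using pi_gt3 by (simp add: mult_le_cancel_right1)
  finally have "exp q \<le> exp (1 + pi * q\<^sup>2)" by simp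
  hence "q ^ DIM('a) * exp (- (pi * q\<^sup>2)) \<le> fact DIM('a) * exp (1 + pi * q\<^sup>2) * exp (- (pi * q\<^sup>2))"
    using 1 by (intro mult_right_mono) (auto intro: order.trans mult_left_mono)
  also have "\<dots> = fact DIM('a) * exp 1" by (simp add: exp_add exp_minus)
  finally have "q ^ DIM('a) * exp (- (pi * q\<^sup>2)) \<le> fact DIM('a) * exp 1" .
  moreover have "q ^ DIM('a) = norm x ^ DIM('a) / sqrt (4 * pi * t) ^ DIM('a)"
    by (simp add: q_def power_divide)
  moreover have "- (norm x)\<^sup>2 / (4 * t) = - (pi * q\<^sup>2)" using e by simp
  ultimately show ?thesis by (simp add: heat_kernel_def mult.commute)
qed

text \<open>Splitting at the natural radius \<open>sqrt t\<close> of the kernel, where the two contributions balance.\<close>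

lemma heat_kernel_singular_weight:
  fixes \<beta> :: real
  assumes \<beta>: "0 \<le> \<beta>" "\<beta> < DIM('a::euclidean_space)"
  obtains C where "C > 0" "\<And>t y. t > 0 \<Longrightarrow>
    (\<integral>\<^sup>+x. ennreal (heat_kernel t (x - y) * norm (x::'a) powr (- \<beta>)) \<partial>lborel) \<le> ennreal (C * t powr (- \<beta> / 2))"
proof -
  obtain C where C: "C \<ge> 0" "\<And>\<rho>. \<rho> > 0 \<Longrightarrow>
    (\<integral>\<^sup>+y. ennreal (indicator (cball 0 \<rho>) y * norm (y::'a) powr (- \<beta>)) \<partial>lborel) \<le> ennreal (C * \<rho> powr (DIM('a) - \<beta>))"
    using nn_integral_norm_powr_cball[OF \<beta>] by blast
  define c where "c = C / sqrt (4 * pi) ^ DIM('a) + 1"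
  have "(\<integral>\<^sup>+x. ennreal (heat_kernel t (x - y) * norm (x::'a) powr (- \<beta>)) \<partial>lborel) \<le> ennreal (c * t powr (- \<beta> / 2))"
    if t: "t > 0" for t y
  proof -
    have K1: "(\<integral>\<^sup>+x. ennreal (heat_kernel t (x - y)) \<partial>lborel) \<le> 1"
      using nn_integral_heat_kernel[OF t, where 'a='a]
      unfolding heat_kernel_swap[of t _ y] by (subst nn_integral_lborel_reflect) auto
    have "(\<integral>\<^sup>+x. ennreal (heat_kernel t (x - y) * norm (x::'a) powr (- \<beta>)) \<partial>lborel) \<le>
       ennreal (1 / sqrt (4 * pi * t) ^ DIM('a) * (C * sqrt t powr (DIM('a) - \<beta>)) + sqrt t powr (- \<beta>))"
      by (rule nn_integral_norm_powr_split[OF C(2)]) (use t \<beta> C(1) K1 in \<open>auto intro: heat_kernel_le\<close>)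
    also have "1 / sqrt (4 * pi * t) ^ DIM('a) * (C * sqrt t powr (DIM('a) - \<beta>)) + sqrt t powr (- \<beta>) = c * sqrt t powr (- \<beta>)"
      using t by (simp add: c_def real_sqrt_mult power_mult_distrib powr_diff powr_minus powr_realpow field_simps)
    also have "sqrt t powr (- \<beta>) = t powr (- \<beta> / 2)"
      using t by (simp add: powr_half_sqrt[symmetric] powr_powr)
    finally show ?thesis .
  qed
  moreover have "c > 0" using C(1) by (auto simp: c_def intro!: add_nonneg_pos divide_nonneg_pos)
  ultimately show ?thesis using that by blast
qed

text \<open>Splitting at \<open>norm x / 2\<close>. For \<open>y\<close> near the origin, \<open>x - y\<close> is comparable to \<open>x\<close>, and the kernel is at most a
multiple of \<open>1 / norm x ^ DIM('a)\<close> for every \<open>t\<close>; for the other \<open>y\<close> the weight is comparable to its value at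
\<open>x\<close>. This is the property that makes \<open>norm y powr (- \<sigma>)\<close> a Muckenhoupt weight of class \<open>A\<^sub>1\<close>.\<close>

lemma heat_kernel_weight_preserved:
  fixes \<sigma> :: real
  assumes \<sigma>: "0 \<le> \<sigma>" "\<sigma> < DIM('a::euclidean_space)"
  obtains C where "C > 0" "\<And>t x. t > 0 \<Longrightarrow> x \<noteq> 0 \<Longrightarrow>
    (\<integral>\<^sup>+y. ennreal (heat_kernel t (x - y) * norm (y::'a) powr (- \<sigma>)) \<partial>lborel) \<le> ennreal (C * norm x powr (- \<sigma>))"
proof -
  obtain C where C: "C \<ge> 0" "\<And>\<rho>. \<rho> > 0 \<Longrightarrow>
    (\<integral>\<^sup>+y. ennreal (indicator (cball 0 \<rho>) y * norm (y::'a) powr (- \<sigma>)) \<partial>lborel) \<le> ennreal (C * \<rho> powr (DIM('a) - \<sigma>))"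
    using nn_integral_norm_powr_cball[OF \<sigma>] by blast
  define B where "B = fact DIM('a) * exp (1::real)"
  define c where "c = (B * C + 1) * 2 powr \<sigma>"
  have "(\<integral>\<^sup>+y. ennreal (heat_kernel t (x - y) * norm (y::'a) powr (- \<sigma>)) \<partial>lborel) \<le> ennreal (c * norm x powr (- \<sigma>))"
    if t: "t > 0" and x: "x \<noteq> 0" for t x
  proof -
    let ?\<rho> = "norm x / 2"
    have \<rho>: "?\<rho> > 0" using x by simp
    have K1: "(\<integral>\<^sup>+y. ennreal (heat_kernel t (x - y)) \<partial>lborel) \<le> 1"
      using nn_integral_heat_kernel[OF t, where 'a='a] by (subst nn_integral_lborel_reflect) auto
    have bd: "heat_kernel t (x - y) \<le> B / ?\<rho> ^ DIM('a)" if "norm y \<le> ?\<rho>" for y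
    proof -
      have "?\<rho> \<le> norm (x - y)" using that norm_triangle_ineq2[of x y] by simp
      hence "heat_kernel t (x - y) * ?\<rho> ^ DIM('a) \<le> heat_kernel t (x - y) * norm (x - y) ^ DIM('a)"
        using t by (intro mult_left_mono power_mono) auto
      also have "\<dots> \<le> B" unfolding B_def by (rule heat_kernel_le_norm_power[OF t])
      finally show ?thesis using x by (subst pos_le_divide_eq) auto
    qed
    have "(\<integral>\<^sup>+y. ennreal (heat_kernel t (x - y) * norm (y::'a) powr (- \<sigma>)) \<partial>lborel) \<le>
       ennreal (B / ?\<rho> ^ DIM('a) * (C * ?\<rho> powr (DIM('a) - \<sigma>)) + ?\<rho> powr (- \<sigma>))"
      by (rule nn_integral_norm_powr_split[OF C(2)]) (use t \<sigma> C(1) K1 \<rho> bd in auto)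
    also have "B / ?\<rho> ^ DIM('a) * (C * ?\<rho> powr (DIM('a) - \<sigma>)) + ?\<rho> powr (- \<sigma>) = (B * C + 1) * ?\<rho> powr (- \<sigma>)"
    proof -
      have "?\<rho> powr (DIM('a) - \<sigma>) = ?\<rho> ^ DIM('a) * ?\<rho> powr (- \<sigma>)"
        using \<rho> powr_add[of ?\<rho> "real DIM('a)" "- \<sigma>"] by (simp add: powr_realpow)
      moreover have "?\<rho> ^ DIM('a) \<noteq> 0" using \<rho> by simp
      ultimately show ?thesis by (simp add: distrib_right del: power_divide)
    qed
    also have "\<dots> = c * norm x powr (- \<sigma>)"
    proof -
      have "?\<rho> powr (- \<sigma>) = norm x powr (- \<sigma>) * 2 powr \<sigma>"
        by (simp add: powr_divide powr_minus_divide)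
      thus ?thesis by (simp only: c_def mult_ac)
    qed
    finally show ?thesis .
  qed
  moreover have "c > 0" using C(1) by (auto simp: c_def B_def intro!: mult_pos_pos add_nonneg_pos)
  ultimately show ?thesis using that by blast
qed

section \<open>Superpositions of heat operators between weighted spaces\<close>

text \<open>Young's inequality, read as the statement that the convex function \<open>x powr p\<close> lies above its tangent at \<open>c\<close>.\<close>

lemma young_tangent:
  fixes p x c :: real
  assumes p: "1 < p" and x: "x \<ge> 0" and c: "c \<ge> 0"
  shows "p * c powr (p - 1) * x \<le> x powr p + (p - 1) * c powr p"
proof -
  define q where "q = p / (p - 1)"
  have q: "q > 1" "1 / p + 1 / q = 1" using p by (auto simp: q_def field_simps)
  have "x * c powr (p - 1) \<le> x powr p / p + (c powr (p - 1)) powr q / q"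
    by (rule Youngs_inequality) (use p q x in auto)
  also have "(c powr (p - 1)) powr q = c powr p" using p by (simp add: powr_powr q_def)
  also have "c powr p / q = (p - 1) * c powr p / p" using p by (simp add: q_def)
  finally have "p * (x * c powr (p - 1)) \<le> p * (x powr p / p + (p - 1) * c powr p / p)"
    using p by (intro mult_left_mono) auto
  also have "\<dots> = x powr p + (p - 1) * c powr p" using p by (simp add: field_simps)
  finally show ?thesis by (simp add: mult_ac)
qed

text \<open>Hoelder's inequality for \<open>f = (f * v powr (1 / p)) * v powr (- 1 / p)\<close> with respect to the density \<open>k\<close>. The upper
bound \<open>a\<close> of the dual integral and the lower bound \<open>r\<close> of the integral of \<open>f\<close> are real numbers, so only the
integral on the right may be infinite.\<close>

lemma weighted_holder:
  fixes k f v :: "'z \<Rightarrow> real" and p r a :: real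
  assumes p: "1 < p" and [measurable]: "k \<in> borel_measurable N" "f \<in> borel_measurable N" "v \<in> borel_measurable N"
    and nonneg: "\<And>z. k z \<ge> 0" "\<And>z. f z \<ge> 0" "\<And>z. v z \<ge> 0" and v0: "\<And>z. v z = 0 \<Longrightarrow> f z = 0"
    and r: "r \<ge> 0" "ennreal r \<le> (\<integral>\<^sup>+z. ennreal (k z * f z) \<partial>N)"
    and a: "a > 0" "(\<integral>\<^sup>+z. ennreal (k z * v z powr (- 1 / (p - 1))) \<partial>N) \<le> ennreal a"
  shows "ennreal (r powr p) \<le> ennreal (a powr (p - 1)) * (\<integral>\<^sup>+z. ennreal (k z * f z powr p * v z) \<partial>N)"
proof (cases "r = 0")
  case False
  \<comment> \<open>the tangent point \<open>l * v powr (- 1 / (p - 1))\<close> turns the integrated tangent inequality into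
      \<open>p * X \<le> I + (p - 1) * X\<close>, which is Hoelder's inequality\<close>
  define l where "l = r / a"
  define X where "X = r powr p / a powr (p - 1)"
  have l: "l > 0" using False r a by (simp add: l_def)
  have X0: "X \<ge> 0" by (simp add: X_def)
  have X1: "l powr (p - 1) * r = X"
    using r a False by (simp add: l_def X_def powr_divide powr_diff)
  have X2: "l powr p * a = X"
    using r a False by (simp add: l_def X_def powr_divide powr_diff)
  have pw: "(p * l powr (p - 1)) * (k z * f z) \<le> k z * f z powr p * v z + ((p - 1) * l powr p) * (k z * v z powr (- 1 / (p - 1)))" for z
  proof (cases "v z = 0")
    case True
    thus ?thesis using v0[OF True] p nonneg by auto
  next
    case False
    hence v: "v z > 0" using nonneg(3)[of z] by simp
    have e1: "(l * v z powr (- 1 / (p - 1))) powr (p - 1) = l powr (p - 1) / v z"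
    proof -
      have "(v z powr (- 1 / (p - 1))) powr (p - 1) = 1 / v z"
        by (subst powr_powr) (use p v in \<open>simp add: powr_minus_divide\<close>)
      thus ?thesis using v l by (simp add: powr_mult)
    qed
    have e2: "(l * v z powr (- 1 / (p - 1))) powr p * v z = l powr p * v z powr (- 1 / (p - 1))"
    proof -
      have "v z powr (- 1 / (p - 1) * p) * v z powr 1 = v z powr (- 1 / (p - 1))"
        using p by (subst powr_add[symmetric]) (simp add: field_simps)
      thus ?thesis using v l by (simp add: powr_mult powr_powr)
    qed
    have "p * (l * v z powr (- 1 / (p - 1))) powr (p - 1) * f z \<le> f z powr p + (p - 1) * (l * v z powr (- 1 / (p - 1))) powr p"
      using l by (intro young_tangent p nonneg) auto
    hence "(k z * v z) * (p * (l * v z powr (- 1 / (p - 1))) powr (p - 1) * f z) \<le> (k z * v z) * (f z powr p + (p - 1) * (l * v z powr (- 1 / (p - 1))) powr p)"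
      using nonneg by (intro mult_left_mono) auto
    also have "\<dots> = k z * f z powr p * v z + (p - 1) * k z * ((l * v z powr (- 1 / (p - 1))) powr p * v z)"
      by (simp add: algebra_simps)
    finally show ?thesis unfolding e1 e2 using v by (simp add: mult_ac)
  qed
  let ?I = "\<integral>\<^sup>+z. ennreal (k z * f z powr p * v z) \<partial>N"
  have "ennreal (p * X) = ennreal (p * l powr (p - 1)) * ennreal r"
    using p r by (simp add: X1[symmetric] mult_ac flip: ennreal_mult)
  also have "\<dots> \<le> ennreal (p * l powr (p - 1)) * (\<integral>\<^sup>+z. ennreal (k z * f z) \<partial>N)"
    by (intro mult_left_mono r) auto
  also have "\<dots> = (\<integral>\<^sup>+z. ennreal (p * l powr (p - 1)) * ennreal (k z * f z) \<partial>N)"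
    by (rule nn_integral_cmult[symmetric]) measurable
  also have "\<dots> \<le> (\<integral>\<^sup>+z. ennreal (k z * f z powr p * v z) + ennreal ((p - 1) * l powr p) * ennreal (k z * v z powr (- 1 / (p - 1))) \<partial>N)"
    using p nonneg pw by (intro nn_integral_mono) (auto simp: ennreal_leI simp flip: ennreal_mult ennreal_plus)
  also have "\<dots> = ?I + ennreal ((p - 1) * l powr p) * (\<integral>\<^sup>+z. ennreal (k z * v z powr (- 1 / (p - 1))) \<partial>N)"
    by (subst nn_integral_add) (auto simp: nn_integral_cmult)
  also have "\<dots> \<le> ?I + ennreal ((p - 1) * l powr p) * ennreal a"
    by (intro add_left_mono mult_left_mono a) auto
  also have "ennreal ((p - 1) * l powr p) * ennreal a = ennreal ((p - 1) * X)"
    using p a by (simp add: X2[symmetric] mult_ac flip: ennreal_mult)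
  finally have "ennreal (p * X) \<le> ?I + ennreal ((p - 1) * X)" .
  moreover have "ennreal (p * X) = ennreal X + ennreal ((p - 1) * X)"
  proof -
    have "p * X = X + (p - 1) * X" by (simp add: algebra_simps)
    thus ?thesis using p X0 by (simp only: ennreal_plus mult_nonneg_nonneg diff_ge_0_iff_ge less_imp_le)
  qed
  ultimately have "ennreal X \<le> ?I"
    by (simp add: add.commute[of _ "ennreal ((p - 1) * X)"] ennreal_add_left_cancel_le)
  hence "ennreal (a powr (p - 1)) * ennreal X \<le> ennreal (a powr (p - 1)) * ?I"
    by (intro mult_left_mono) auto
  thus ?thesis using a X0 by (simp add: X_def flip: ennreal_mult)
qed auto

text \<open>A superposition of heat operators at the times \<open>\<tau> s\<close> with density \<open>\<omega>\<close> gains the singular factor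
\<open>norm x powr (- b)\<close> on the weighted space as soon as \<open>\<omega> s * \<tau> s powr (- b / 2)\<close> is integrable.
Hoelder's inequality is used once, for the measure \<open>\<omega> s * \<tau> s powr (- b / 2) * heat_kernel (\<tau> s) (x - y)\<close> in both
variables; the compensating factor \<open>\<tau> s powr (b / 2)\<close> goes with \<open>f\<close>. The dual factor of Hoelder's inequality is bounded by
\<open>heat_kernel_weight_preserved\<close>. In the other one the integration over \<open>x\<close> comes first, and
\<open>heat_kernel_singular_weight\<close> cancels \<open>\<tau> s powr (b * p / 2)\<close> exactly. Without the compensation the density left
at this point would be \<open>\<omega> s * \<tau> s powr (- b * p / 2)\<close>, which need not be integrable near \<open>\<tau> s = 0\<close>.\<close>

theorem weighted_heat_superposition:
  fixes M :: "'s measure" and \<tau> \<omega> :: "'s \<Rightarrow> real" and p \<theta> b :: real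
  assumes sf: "sigma_finite_measure M"
    and [measurable]: "\<tau> \<in> borel_measurable M" "\<omega> \<in> borel_measurable M"
    and \<omega>: "\<And>s. \<omega> s \<ge> 0" "\<And>s. \<tau> s \<le> 0 \<Longrightarrow> \<omega> s = 0"
    and Q: "(\<integral>\<^sup>+s. ennreal (\<omega> s * \<tau> s powr (- b / 2)) \<partial>M) < \<infinity>"
    and p: "1 < p" and \<theta>: "0 \<le> \<theta>" "\<theta> < DIM('a) * (p - 1)" and b: "0 \<le> b" "b * p < DIM('a)"
  obtains C where "C > 0" "\<And>f F. f \<in> borel_measurable borel \<Longrightarrow> (\<And>y. f y \<ge> 0) \<Longrightarrow> (\<And>x. F x \<ge> 0) \<Longrightarrow>
    (\<And>x. ennreal (F x) \<le> (\<integral>\<^sup>+s. \<integral>\<^sup>+y. ennreal (\<omega> s * heat_kernel (\<tau> s) (x - y) * f y) \<partial>lborel \<partial>M)) \<Longrightarrow>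
    (\<integral>\<^sup>+x. ennreal (F x powr p * norm x powr (\<theta> - b * p)) \<partial>lborel) \<le>
      ennreal C * (\<integral>\<^sup>+y. ennreal (f y powr p * norm (y::'a::euclidean_space) powr \<theta>) \<partial>lborel)"
proof -
  interpret M: sigma_finite_measure M by (rule sf)
  interpret P: pair_sigma_finite M "lborel :: 'a measure" ..
  define \<sigma> where "\<sigma> = \<theta> / (p - 1)"
  have \<sigma>: "0 \<le> \<sigma>" "\<sigma> < DIM('a)" using \<theta> p by (auto simp: \<sigma>_def field_simps)
  have bp: "0 \<le> b * p" "b * p < DIM('a)" using b p by auto
  obtain c1 where c1: "c1 > 0" "\<And>t y. t > 0 \<Longrightarrow>
    (\<integral>\<^sup>+x. ennreal (heat_kernel t (x - y) * norm (x::'a) powr (- (b * p))) \<partial>lborel) \<le> ennreal (c1 * t powr (- (b * p) / 2))"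
    using heat_kernel_singular_weight[OF bp] by blast
  obtain c2 where c2: "c2 > 0" "\<And>t x. t > 0 \<Longrightarrow> x \<noteq> 0 \<Longrightarrow>
    (\<integral>\<^sup>+y. ennreal (heat_kernel t (x - y) * norm (y::'a) powr (- \<sigma>)) \<partial>lborel) \<le> ennreal (c2 * norm x powr (- \<sigma>))"
    using heat_kernel_weight_preserved[OF \<sigma>] by blast
  define Qi where "Qi = (\<integral>\<^sup>+s. ennreal (\<omega> s * \<tau> s powr (- b / 2)) \<partial>M)"
  \<comment> \<open>adding 1 ensures that \<open>q\<close> is positive, as \<open>weighted_holder\<close> requires\<close>
  define q where "q = enn2real Qi + 1"
  have q: "q > 0" "Qi \<le> ennreal q"
  proof -
    have "Qi < \<infinity>" using Q by (simp only: Qi_def)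
    hence e: "Qi = ennreal (enn2real Qi)" by simp
    show "q > 0" by (simp add: q_def add_nonneg_pos)
    show "Qi \<le> ennreal q" by (subst e) (simp add: q_def ennreal_leI)
  qed
  define C where "C = (q * c2) powr (p - 1) * (c1 * q)"
  show ?thesis
  proof (rule that[of C])
    show "C > 0" using q c1 c2 by (simp add: C_def)
    fix f F :: "'a \<Rightarrow> real"
    assume f[measurable]: "f \<in> borel_measurable borel" and f0: "\<And>y. f y \<ge> 0" and F0: "\<And>x. F x \<ge> 0"
      and F: "\<And>x. ennreal (F x) \<le> (\<integral>\<^sup>+s. \<integral>\<^sup>+y. ennreal (\<omega> s * heat_kernel (\<tau> s) (x - y) * f y) \<partial>lborel \<partial>M)"
    \<comment> \<open>the weight \<open>norm y powr \<theta>\<close> vanishes at the origin, also for \<open>\<theta> = 0\<close> because \<open>0 powr 0 = 0\<close>; so \<open>f\<close> is made to vanish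
        there too, as \<open>weighted_holder\<close> requires\<close>
    define g where "g y = (if y = 0 then 0 else f y)" for y
    have g[measurable]: "g \<in> borel_measurable borel" unfolding g_def by measurable
    have g0: "g y \<ge> 0" for y using f0 by (simp add: g_def)
    define k where "k (x :: 'a) z = \<omega> (fst z) * \<tau> (fst z) powr (- b / 2) * heat_kernel (\<tau> (fst z)) (x - snd z)" for x z
    have k[measurable]: "k x \<in> borel_measurable (M \<Otimes>\<^sub>M lborel)" for x unfolding k_def by measurable
    have k0: "k x z \<ge> 0" for x z
      using \<omega>[of "fst z"] by (cases "\<tau> (fst z) > 0") (auto simp: k_def)
    define J where "J = (\<lambda>z::'s \<times> 'a. g (snd z) powr p * norm (snd z) powr \<theta>)"
    have J[measurable]: "J \<in> borel_measurable (M \<Otimes>\<^sub>M lborel)" unfolding J_def by measurable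
    have J0: "J z \<ge> 0" for z by (simp add: J_def)
    let ?P = "M \<Otimes>\<^sub>M (lborel :: 'a measure)"
    let ?H = "\<lambda>x z. k x z * \<tau> (fst z) powr (b * p / 2) * J z"
    let ?q = "(q * c2) powr (p - 1)"
    have step: "ennreal (F x powr p * norm x powr (\<theta> - b * p)) \<le>
       ennreal (?q) * (\<integral>\<^sup>+z. ennreal (?H x z * norm x powr (- (b * p))) \<partial>?P)"
      if x: "x \<noteq> 0" for x
    proof -
      have "ennreal (F x) \<le> (\<integral>\<^sup>+s. \<integral>\<^sup>+y. ennreal (k x (s, y) * (\<tau> s powr (b / 2) * g y)) \<partial>lborel \<partial>M)"
      proof (rule order.trans[OF F], rule nn_integral_mono)
        fix s
        have "(\<integral>\<^sup>+y. ennreal (\<omega> s * heat_kernel (\<tau> s) (x - y) * f y) \<partial>lborel) =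
           (\<integral>\<^sup>+y. ennreal (k x (s, y) * (\<tau> s powr (b / 2) * g y)) \<partial>lborel)"
        proof (rule nn_integral_cong_AE)
          have t1: "\<tau> s powr (- b / 2) * \<tau> s powr (b / 2) = 1" if "\<tau> s > 0"
            using that by (simp flip: powr_add)
          show "AE y in lborel. ennreal (\<omega> s * heat_kernel (\<tau> s) (x - y) * f y) = ennreal (k x (s, y) * (\<tau> s powr (b / 2) * g y))"
            using AE_lborel_singleton[of 0]
          proof eventually_elim
            case (elim y)
            show ?case
            proof (cases "\<tau> s > 0")
              case True
              have "k x (s, y) * (\<tau> s powr (b / 2) * g y) = (\<tau> s powr (- b / 2) * \<tau> s powr (b / 2)) * (\<omega> s * heat_kernel (\<tau> s) (x - y) * g y)"
                by (simp add: k_def mult_ac)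
              moreover have "g y = f y" using elim by (simp add: g_def)
              ultimately show ?thesis by (simp only: t1[OF True] mult_1)
            qed (use \<omega>(2)[of s] in \<open>auto simp: k_def\<close>)
          qed
        qed
        thus "(\<integral>\<^sup>+y. ennreal (\<omega> s * heat_kernel (\<tau> s) (x - y) * f y) \<partial>lborel) \<le>
           (\<integral>\<^sup>+y. ennreal (k x (s, y) * (\<tau> s powr (b / 2) * g y)) \<partial>lborel)" by simp
      qed
      also have "\<dots> = (\<integral>\<^sup>+z. ennreal (k x z * (\<tau> (fst z) powr (b / 2) * g (snd z))) \<partial>?P)"
        by (subst lborel.nn_integral_fst[symmetric]) auto
      finally have R: "ennreal (F x) \<le> (\<integral>\<^sup>+z. ennreal (k x z * (\<tau> (fst z) powr (b / 2) * g (snd z))) \<partial>?P)" .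
      have "(\<integral>\<^sup>+z. ennreal (k x z * (norm (snd z) powr \<theta>) powr (- 1 / (p - 1))) \<partial>?P) =
         (\<integral>\<^sup>+s. \<integral>\<^sup>+y. ennreal (k x (s, y) * (norm y powr \<theta>) powr (- 1 / (p - 1))) \<partial>lborel \<partial>M)"
        by (subst lborel.nn_integral_fst[symmetric]) auto
      also have "\<dots> \<le> (\<integral>\<^sup>+s. ennreal (c2 * norm x powr (- \<sigma>)) * ennreal (\<omega> s * \<tau> s powr (- b / 2)) \<partial>M)"
      proof (intro nn_integral_mono)
        fix s
        show "(\<integral>\<^sup>+y. ennreal (k x (s, y) * (norm y powr \<theta>) powr (- 1 / (p - 1))) \<partial>lborel) \<le> ennreal (c2 * norm x powr (- \<sigma>)) * ennreal (\<omega> s * \<tau> s powr (- b / 2))"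
        proof (cases "\<tau> s > 0")
          case True
          have "(\<integral>\<^sup>+y. ennreal (k x (s, y) * (norm y powr \<theta>) powr (- 1 / (p - 1))) \<partial>lborel) =
            (\<integral>\<^sup>+y. ennreal (\<omega> s * \<tau> s powr (- b / 2)) * ennreal (heat_kernel (\<tau> s) (x - y) * norm y powr (- \<sigma>)) \<partial>lborel)"
            using True \<omega>(1)[of s] by (intro nn_integral_cong) (auto simp: k_def powr_powr \<sigma>_def mult_ac simp flip: ennreal_mult)
          also have "\<dots> = ennreal (\<omega> s * \<tau> s powr (- b / 2)) * (\<integral>\<^sup>+y. ennreal (heat_kernel (\<tau> s) (x - y) * norm y powr (- \<sigma>)) \<partial>lborel)"
            by (rule nn_integral_cmult) measurable
          also have "\<dots> \<le> ennreal (\<omega> s * \<tau> s powr (- b / 2)) * ennreal (c2 * norm x powr (- \<sigma>))"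
            by (intro mult_left_mono c2 True x) auto
          finally show ?thesis by (simp add: mult.commute)
        qed (use \<omega>(2)[of s] in \<open>auto simp: k_def\<close>)
      qed
      also have "\<dots> = ennreal (c2 * norm x powr (- \<sigma>)) * Qi"
        unfolding Qi_def by (rule nn_integral_cmult) measurable
      also have "\<dots> \<le> ennreal (c2 * norm x powr (- \<sigma>)) * ennreal q" by (intro mult_left_mono q) auto
      also have "\<dots> = ennreal ((q * c2) * norm x powr (- \<sigma>))" using c2 q by (simp add: mult_ac flip: ennreal_mult)
      finally have A: "(\<integral>\<^sup>+z. ennreal (k x z * (norm (snd z) powr \<theta>) powr (- 1 / (p - 1))) \<partial>?P) \<le> ennreal ((q * c2) * norm x powr (- \<sigma>))" .
      have "ennreal (F x powr p) \<le> ennreal (((q * c2) * norm x powr (- \<sigma>)) powr (p - 1)) *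
        (\<integral>\<^sup>+z. ennreal (k x z * (\<tau> (fst z) powr (b / 2) * g (snd z)) powr p * norm (snd z) powr \<theta>) \<partial>?P)"
        by (rule weighted_holder[OF p _ _ _ _ _ _ _ _ R _ A]) (use k0 g0 F0 q c2 x in \<open>auto simp: g_def\<close>)
      also have "(\<lambda>z. ennreal (k x z * (\<tau> (fst z) powr (b / 2) * g (snd z)) powr p * norm (snd z) powr \<theta>)) =
         (\<lambda>z. ennreal (?H x z))"
        using g0 by (intro ext) (simp add: J_def powr_mult powr_powr mult_ac)
      finally have H: "ennreal (F x powr p) \<le> ennreal (((q * c2) * norm x powr (- \<sigma>)) powr (p - 1)) *
        (\<integral>\<^sup>+z. ennreal (?H x z) \<partial>?P)" .
      have w: "((q * c2) * norm x powr (- \<sigma>)) powr (p - 1) * norm x powr (\<theta> - b * p) = ?q * norm x powr (- (b * p))"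
      proof -
        have "(norm x powr (- \<sigma>)) powr (p - 1) = norm x powr (- \<theta>)" using p by (simp add: powr_powr \<sigma>_def)
        moreover have "norm x powr (- \<theta>) * norm x powr (\<theta> - b * p) = norm x powr (- (b * p))"
          by (simp flip: powr_add)
        ultimately show ?thesis using q c2 by (simp add: powr_mult)
      qed
      have "ennreal (F x powr p * norm x powr (\<theta> - b * p)) = ennreal (norm x powr (\<theta> - b * p)) * ennreal (F x powr p)"
        by (simp add: mult.commute flip: ennreal_mult)
      also have "\<dots> \<le> ennreal (norm x powr (\<theta> - b * p)) * (ennreal (((q * c2) * norm x powr (- \<sigma>)) powr (p - 1)) *
        (\<integral>\<^sup>+z. ennreal (?H x z) \<partial>?P))"
        by (intro mult_left_mono H) auto
      also have "\<dots> = ennreal (?q * norm x powr (- (b * p))) * (\<integral>\<^sup>+z. ennreal (?H x z) \<partial>?P)"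
        unfolding w[symmetric] by (simp add: mult.assoc[symmetric] ennreal_mult[symmetric] mult.commute)
      also have "\<dots> = ennreal (?q) * (ennreal (norm x powr (- (b * p))) * (\<integral>\<^sup>+z. ennreal (?H x z) \<partial>?P))"
        by (simp add: ennreal_mult mult.assoc)
      also have "ennreal (norm x powr (- (b * p))) * (\<integral>\<^sup>+z. ennreal (?H x z) \<partial>?P) =
        (\<integral>\<^sup>+z. ennreal (norm x powr (- (b * p))) * ennreal (?H x z) \<partial>?P)"
        by (rule nn_integral_cmult[symmetric]) measurable
      also have "(\<lambda>z. ennreal (norm x powr (- (b * p))) * ennreal (?H x z)) =
         (\<lambda>z. ennreal (?H x z * norm x powr (- (b * p))))"
        using k0 J0 by (intro ext) (simp add: mult.commute flip: ennreal_mult)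
      finally show ?thesis .
    qed
    have km[measurable]: "(\<lambda>(x, z). k x z) \<in> borel_measurable (lborel \<Otimes>\<^sub>M ?P)"
      unfolding k_def by measurable
    interpret PP: sigma_finite_measure "?P" by (intro sigma_finite_pair_measure sf sigma_finite_lborel)
    interpret XP: pair_sigma_finite "lborel :: 'a measure" "?P" ..
    have "(\<integral>\<^sup>+x. ennreal (F x powr p * norm x powr (\<theta> - b * p)) \<partial>lborel) \<le>
      (\<integral>\<^sup>+x. ennreal (?q) * (\<integral>\<^sup>+z. ennreal (?H x z * norm x powr (- (b * p))) \<partial>?P) \<partial>lborel)"
      by (rule nn_integral_mono_AE) (use AE_lborel_singleton[of 0] in \<open>auto intro: step elim: eventually_mono\<close>)
    also have "\<dots> = ennreal (?q) * (\<integral>\<^sup>+x. \<integral>\<^sup>+z. ennreal (?H x z * norm x powr (- (b * p))) \<partial>?P \<partial>lborel)"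
      by (rule nn_integral_cmult) measurable
    also have "(\<integral>\<^sup>+x. \<integral>\<^sup>+z. ennreal (?H x z * norm x powr (- (b * p))) \<partial>?P \<partial>lborel) =
      (\<integral>\<^sup>+z. \<integral>\<^sup>+x. ennreal (?H x z * norm x powr (- (b * p))) \<partial>lborel \<partial>?P)"
      by (rule XP.Fubini'[symmetric]) measurable
    also have "\<dots> \<le> (\<integral>\<^sup>+z. ennreal c1 * (ennreal (\<omega> (fst z) * \<tau> (fst z) powr (- b / 2)) * ennreal (J z)) \<partial>?P)"
    proof (intro nn_integral_mono)
      fix z
      show "(\<integral>\<^sup>+x. ennreal (?H x z * norm x powr (- (b * p))) \<partial>lborel) \<le>
        ennreal c1 * (ennreal (\<omega> (fst z) * \<tau> (fst z) powr (- b / 2)) * ennreal (J z))"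
      proof (cases "\<tau> (fst z) > 0")
        case True
        let ?t = "\<tau> (fst z)" and ?w = "\<omega> (fst z)"
        let ?c = "?w * ?t powr (- b / 2) * ?t powr (b * p / 2) * J z"
        have c0: "?c \<ge> 0" using J0 \<omega>(1) by simp
        have "(\<integral>\<^sup>+x. ennreal (k x z * ?t powr (b * p / 2) * J z * norm x powr (- (b * p))) \<partial>lborel) =
          (\<integral>\<^sup>+x. ennreal ?c * ennreal (heat_kernel ?t (x - snd z) * norm x powr (- (b * p))) \<partial>lborel)"
          using True c0 by (intro nn_integral_cong) (auto simp: k_def mult_ac simp flip: ennreal_mult)
        also have "\<dots> = ennreal ?c * (\<integral>\<^sup>+x. ennreal (heat_kernel ?t (x - snd z) * norm x powr (- (b * p))) \<partial>lborel)"
          by (rule nn_integral_cmult) measurable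
        also have "\<dots> \<le> ennreal ?c * ennreal (c1 * ?t powr (- (b * p) / 2))"
          by (intro mult_left_mono c1 True) auto
        also have "\<dots> = ennreal (?c * (c1 * ?t powr (- (b * p) / 2)))"
          using c0 c1 by (simp flip: ennreal_mult)
        also have "?c * (c1 * ?t powr (- (b * p) / 2)) = c1 * (?w * ?t powr (- b / 2) * J z)"
        proof -
          have "?t powr (b * p / 2) * ?t powr (- (b * p) / 2) = 1" using True by (simp flip: powr_add)
          hence "c1 * (?w * ?t powr (- b / 2) * J z) * (?t powr (b * p / 2) * ?t powr (- (b * p) / 2)) = c1 * (?w * ?t powr (- b / 2) * J z)"
            by simp
          thus ?thesis by (simp only: mult_ac)
        qed
        also have "ennreal \<dots> = ennreal c1 * (ennreal (?w * ?t powr (- b / 2)) * ennreal (J z))"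
          using c1 J0 \<omega>(1) by (simp flip: ennreal_mult)
        finally show ?thesis .
      qed (use \<omega>(2)[of "fst z"] in \<open>auto simp: k_def\<close>)
    qed
    also have "\<dots> = ennreal c1 * (\<integral>\<^sup>+z. ennreal (\<omega> (fst z) * \<tau> (fst z) powr (- b / 2)) * ennreal (J z) \<partial>?P)"
      by (rule nn_integral_cmult) measurable
    also have "(\<integral>\<^sup>+z. ennreal (\<omega> (fst z) * \<tau> (fst z) powr (- b / 2)) * ennreal (J z) \<partial>?P) =
       (\<integral>\<^sup>+s. \<integral>\<^sup>+y. ennreal (\<omega> s * \<tau> s powr (- b / 2)) * ennreal (g y powr p * norm y powr \<theta>) \<partial>lborel \<partial>M)"
      by (subst lborel.nn_integral_fst[symmetric]) (auto simp: J_def)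
    also have "\<dots> = Qi * (\<integral>\<^sup>+y. ennreal (g y powr p * norm y powr \<theta>) \<partial>lborel)"
      unfolding Qi_def by (simp add: nn_integral_cmult nn_integral_multc)
    also have "\<dots> \<le> ennreal q * (\<integral>\<^sup>+y. ennreal (f y powr p * norm y powr \<theta>) \<partial>lborel)"
      by (intro mult_mono q nn_integral_mono) (auto simp: g_def)
    finally show "(\<integral>\<^sup>+x. ennreal (F x powr p * norm x powr (\<theta> - b * p)) \<partial>lborel) \<le>
      ennreal C * (\<integral>\<^sup>+y. ennreal (f y powr p * norm (y::'a) powr \<theta>) \<partial>lborel)"
      using q c1 c2 unfolding C_def by (simp add: ennreal_mult mult.assoc mult_left_mono)
  qed
qed

section \<open>Weighted norms of heat superpositions\<close>

abbreviation weighted_power :: "real \<Rightarrow> real \<Rightarrow> ('a::euclidean_space \<Rightarrow> complex) \<Rightarrow> ennreal" where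
  "weighted_power p q f \<equiv> Lp_norm_power p (\<lambda>x. norm x powr q) f"

lemma ennreal_norm_integral_le:
  fixes f :: "'a \<Rightarrow> 'b::{banach,second_countable_topology}"
  shows "ennreal (norm (integral\<^sup>L M f)) \<le> (\<integral>\<^sup>+x. ennreal (norm (f x)) \<partial>M)"
  by (cases "integrable M f") (auto intro: integral_norm_bound_ennreal simp: not_integrable_integral_eq)

lemma ennreal_norm_heat_le:
  assumes t: "t > 0"
  shows "ennreal (norm (heat t f x)) \<le> (\<integral>\<^sup>+y. ennreal (heat_kernel t (x - y) * norm (f y)) \<partial>lborel)"
proof -
  have "ennreal (norm (heat t f x)) \<le> (\<integral>\<^sup>+y. ennreal (norm (of_real (heat_kernel t (x - y)) * f y)) \<partial>lborel)"
    unfolding heat_def by (rule ennreal_norm_integral_le)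
  thus ?thesis using t by (simp add: norm_mult)
qed

lemma weighted_power_heat_superposition:
  fixes m :: "real \<Rightarrow> real" and p \<theta> b :: real
  assumes p: "1 < p" and \<theta>: "0 \<le> \<theta>" "\<theta> < DIM('a::euclidean_space) * (p - 1)" and b: "0 \<le> b" "b * p < DIM('a)"
    and m: "integrable lborel (\<lambda>t. \<bar>m t\<bar> * t powr (- b / 2))" and [measurable]: "m \<in> borel_measurable borel"
    and m0: "\<And>t. t \<le> 0 \<Longrightarrow> m t = 0"
  obtains C where "C > 0" "\<And>f :: 'a \<Rightarrow> complex. f \<in> borel_measurable borel \<Longrightarrow>
    weighted_power p (\<theta> - b * p) (\<lambda>x. LINT t|lborel. of_real (m t) * heat t f x) \<le> ennreal C * weighted_power p \<theta> f"
proof -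
  have Q: "(\<integral>\<^sup>+t. ennreal (\<bar>m t\<bar> * t powr (- b / 2)) \<partial>lborel) < \<infinity>"
    using m by (subst nn_integral_eq_integral) auto
  obtain C where C: "C > 0" "\<And>(f :: 'a \<Rightarrow> real) F. f \<in> borel_measurable borel \<Longrightarrow> (\<And>y. f y \<ge> 0) \<Longrightarrow> (\<And>x. F x \<ge> 0) \<Longrightarrow>
    (\<And>x. ennreal (F x) \<le> (\<integral>\<^sup>+s. \<integral>\<^sup>+y. ennreal (\<bar>m s\<bar> * heat_kernel s (x - y) * f y) \<partial>lborel \<partial>lborel)) \<Longrightarrow>
    (\<integral>\<^sup>+x. ennreal (F x powr p * norm x powr (\<theta> - b * p)) \<partial>lborel) \<le>
      ennreal C * (\<integral>\<^sup>+y. ennreal (f y powr p * norm y powr \<theta>) \<partial>lborel)"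
  proof -
    have "(\<lambda>t::real. t) \<in> borel_measurable lborel" "(\<lambda>t. \<bar>m t\<bar>) \<in> borel_measurable lborel"
      "\<And>t. \<bar>m t\<bar> \<ge> 0" "\<And>t. t \<le> 0 \<Longrightarrow> \<bar>m t\<bar> = 0"
      using m0 by auto
    from weighted_heat_superposition[OF sigma_finite_lborel this Q p \<theta> b] that show thesis by blast
  qed
  show ?thesis
  proof (rule that[OF C(1)])
    fix f :: "'a \<Rightarrow> complex" assume [measurable]: "f \<in> borel_measurable borel"
    have "ennreal (norm (LINT t|lborel. of_real (m t) * heat t f x)) \<le>
       (\<integral>\<^sup>+s. \<integral>\<^sup>+y. ennreal (\<bar>m s\<bar> * heat_kernel s (x - y) * norm (f y)) \<partial>lborel \<partial>lborel)" for x
    proof (rule order.trans[OF ennreal_norm_integral_le], rule nn_integral_mono)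
      fix s :: real
      show "ennreal (norm (of_real (m s) * heat s f x)) \<le> (\<integral>\<^sup>+y. ennreal (\<bar>m s\<bar> * heat_kernel s (x - y) * norm (f y)) \<partial>lborel)"
      proof (cases "s > 0")
        case True
        have "ennreal (norm (of_real (m s) * heat s f x)) = ennreal \<bar>m s\<bar> * ennreal (norm (heat s f x))"
          by (simp add: norm_mult ennreal_mult)
        also have "\<dots> \<le> ennreal \<bar>m s\<bar> * (\<integral>\<^sup>+y. ennreal (heat_kernel s (x - y) * norm (f y)) \<partial>lborel)"
          by (intro mult_left_mono ennreal_norm_heat_le True) auto
        also have "\<dots> = (\<integral>\<^sup>+y. ennreal \<bar>m s\<bar> * ennreal (heat_kernel s (x - y) * norm (f y)) \<partial>lborel)"
          by (rule nn_integral_cmult[symmetric]) measurable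
        finally show ?thesis using True by (simp add: mult.assoc ennreal_mult)
      qed (use m0 in auto)
    qed
    thus "weighted_power p (\<theta> - b * p) (\<lambda>x. LINT t|lborel. of_real (m t) * heat t f x) \<le> ennreal C * weighted_power p \<theta> f"
      unfolding Lp_norm_power_def by (intro C(2)) auto
  qed
qed

lemma weighted_power_heat:
  fixes p \<theta> b t :: real
  assumes p: "1 < p" and \<theta>: "0 \<le> \<theta>" "\<theta> < DIM('a::euclidean_space) * (p - 1)" and b: "0 \<le> b" "b * p < DIM('a)"
    and t: "t > 0"
  obtains C where "C > 0" "\<And>f :: 'a \<Rightarrow> complex. f \<in> borel_measurable borel \<Longrightarrow>
    weighted_power p (\<theta> - b * p) (heat t f) \<le> ennreal C * weighted_power p \<theta> f"
proof -
  \<comment> \<open>a single heat operator is the superposition over a one-point space\<close>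
  have sf: "sigma_finite_measure (count_space (UNIV :: unit set))"
    by (rule sigma_finite_measure_count_space_finite) simp
  have Q: "(\<integral>\<^sup>+s. ennreal (1 * t powr (- b / 2)) \<partial>count_space (UNIV :: unit set)) < \<infinity>"
    by (simp add: nn_integral_count_space_finite)
  obtain C where C: "C > 0" "\<And>(f :: 'a \<Rightarrow> real) F. f \<in> borel_measurable borel \<Longrightarrow> (\<And>y. f y \<ge> 0) \<Longrightarrow> (\<And>x. F x \<ge> 0) \<Longrightarrow>
    (\<And>x. ennreal (F x) \<le> (\<integral>\<^sup>+s. \<integral>\<^sup>+y. ennreal (1 * heat_kernel t (x - y) * f y) \<partial>lborel \<partial>count_space (UNIV :: unit set))) \<Longrightarrow>
    (\<integral>\<^sup>+x. ennreal (F x powr p * norm x powr (\<theta> - b * p)) \<partial>lborel) \<le>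
      ennreal C * (\<integral>\<^sup>+y. ennreal (f y powr p * norm y powr \<theta>) \<partial>lborel)"
  proof -
    have "(\<lambda>_::unit. t) \<in> borel_measurable (count_space UNIV)" "(\<lambda>_::unit. 1::real) \<in> borel_measurable (count_space UNIV)"
      "\<And>_::unit. (1::real) \<ge> 0" "\<And>_::unit. t \<le> 0 \<Longrightarrow> (1::real) = 0"
      using t by auto
    from weighted_heat_superposition[OF sf this Q p \<theta> b] that show thesis by blast
  qed
  show ?thesis
  proof (rule that[OF C(1)])
    fix f :: "'a \<Rightarrow> complex" assume [measurable]: "f \<in> borel_measurable borel"
    have "ennreal (norm (heat t f x)) \<le>
      (\<integral>\<^sup>+s. \<integral>\<^sup>+y. ennreal (1 * heat_kernel t (x - y) * norm (f y)) \<partial>lborel \<partial>count_space (UNIV :: unit set))" for x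
      using ennreal_norm_heat_le[OF t] by (simp add: nn_integral_count_space_finite)
    thus "weighted_power p (\<theta> - b * p) (heat t f) \<le> ennreal C * weighted_power p \<theta> f"
      unfolding Lp_norm_power_def by (intro C(2)) auto
  qed
qed

text \<open>Each summand is at most the largest one. The constant \<open>card A powr p\<close> is not optimal, but the constants are
of no concern here.\<close>

lemma sum_powr_le:
  fixes f :: "'i \<Rightarrow> real"
  assumes A: "finite A" and f: "\<And>i. i \<in> A \<Longrightarrow> f i \<ge> 0" and p: "p > 0"
  shows "(\<Sum>i\<in>A. f i) powr p \<le> real (card A) powr p * (\<Sum>i\<in>A. f i powr p)"
proof (cases "A = {}")
  case False
  define M where "M = Max (f ` A)"
  have M: "f i \<le> M" if "i \<in> A" for i using that A by (auto simp: M_def)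
  have "M \<in> f ` A" unfolding M_def using A False by (intro Max_in) auto
  then obtain j where j: "j \<in> A" "M = f j" by auto
  have "(\<Sum>i\<in>A. f i) \<le> real (card A) * M" using M by (intro sum_bounded_above) auto
  hence "(\<Sum>i\<in>A. f i) powr p \<le> (real (card A) * M) powr p"
    using p f by (intro powr_mono2 sum_nonneg) auto
  also have "\<dots> = real (card A) powr p * f j powr p"
    using f[OF j(1)] by (simp add: powr_mult j(2))
  also have "\<dots> \<le> real (card A) powr p * (\<Sum>i\<in>A. f i powr p)"
    using j(1) A by (intro mult_left_mono member_le_sum) auto
  finally show ?thesis .
qed auto

lemma weighted_power_sum_le:
  fixes f :: "'a::euclidean_space \<Rightarrow> complex" and F :: "'i \<Rightarrow> 'a \<Rightarrow> complex"
  assumes A: "finite A" and p: "p > 0" and [measurable]: "\<And>i. i \<in> A \<Longrightarrow> F i \<in> borel_measurable borel"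
    and c: "\<And>i. i \<in> A \<Longrightarrow> c i \<ge> 0" and le: "\<And>x. norm (f x) \<le> (\<Sum>i\<in>A. c i * norm (F i x))"
  shows "weighted_power p q f \<le> (\<Sum>i\<in>A. ennreal ((real (card A) * c i) powr p) * weighted_power p q (F i))"
proof -
  have pw: "norm (f x) powr p * norm x powr q \<le> (\<Sum>i\<in>A. (real (card A) * c i) powr p * (norm (F i x) powr p * norm x powr q))" for x
  proof -
    have "norm (f x) powr p \<le> (\<Sum>i\<in>A. c i * norm (F i x)) powr p"
      using p le by (intro powr_mono2) auto
    also have "\<dots> \<le> real (card A) powr p * (\<Sum>i\<in>A. (c i * norm (F i x)) powr p)"
      using A p c by (intro sum_powr_le) auto
    also have "\<dots> = (\<Sum>i\<in>A. (real (card A) * c i) powr p * norm (F i x) powr p)"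
      using c by (auto simp: sum_distrib_left powr_mult mult.assoc intro!: sum.cong)
    finally have "norm (f x) powr p * norm x powr q \<le> (\<Sum>i\<in>A. (real (card A) * c i) powr p * norm (F i x) powr p) * norm x powr q"
      by (intro mult_right_mono) auto
    thus ?thesis by (simp add: sum_distrib_right mult.assoc)
  qed
  have "weighted_power p q f \<le> (\<integral>\<^sup>+x. ennreal (\<Sum>i\<in>A. (real (card A) * c i) powr p * (norm (F i x) powr p * norm x powr q)) \<partial>lborel)"
    unfolding Lp_norm_power_def by (intro nn_integral_mono ennreal_leI pw)
  also have "\<dots> = (\<integral>\<^sup>+x. (\<Sum>i\<in>A. ennreal ((real (card A) * c i) powr p) * ennreal (norm (F i x) powr p * norm x powr q)) \<partial>lborel)"
    by (intro nn_integral_cong) (simp add: sum_ennreal[symmetric] ennreal_mult)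
  also have "\<dots> = (\<Sum>i\<in>A. \<integral>\<^sup>+x. ennreal ((real (card A) * c i) powr p) * ennreal (norm (F i x) powr p * norm x powr q) \<partial>lborel)"
    by (rule nn_integral_sum) measurable
  also have "\<dots> = (\<Sum>i\<in>A. ennreal ((real (card A) * c i) powr p) * weighted_power p q (F i))"
    unfolding Lp_norm_power_def by (intro sum.cong refl nn_integral_cmult) measurable
  finally show ?thesis .
qed

section \<open>The weighted Hardy inequality\<close>

lemma frac_laplacian_eq:
  "frac_laplacian s f = inverse_fourier (\<lambda>\<xi>. of_real (norm \<xi> powr (2 * s)) * fourier f \<xi>)"
  by (simp add: frac_laplacian_def fourier_multiplier_def)

lemma measurable_frac_laplacian:
  assumes f: "f \<in> test_functions"
  shows "frac_laplacian s f \<in> borel_measurable borel"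
proof -
  note [measurable] = test_functions_measurable[OF f]
  show ?thesis unfolding frac_laplacian_eq by measurable
qed

lemma measurable_heat:
  assumes [measurable]: "f \<in> borel_measurable borel"
  shows "heat t f \<in> borel_measurable borel"
  unfolding heat_def by measurable

lemma measurable_heat_superposition:
  assumes [measurable]: "f \<in> borel_measurable borel" "m \<in> borel_measurable borel"
  shows "(\<lambda>x. LINT t|lborel. of_real (m t) * heat t f x) \<in> borel_measurable borel"
  unfolding heat_def by measurable

lemma integrable_laplace_mult:
  fixes h :: "'a::euclidean_space \<Rightarrow> complex"
  assumes m: "integrable lborel m" and m0: "\<And>t. t \<le> 0 \<Longrightarrow> m t = 0" and h: "integrable lborel h"
  shows "integrable lborel (\<lambda>\<xi>. of_real (LINT t|lborel. m t * exp (- t * (norm \<xi>)\<^sup>2)) * h \<xi>)"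
proof -
  note [measurable] = borel_measurable_integrable[OF m] borel_measurable_integrable[OF h]
  show ?thesis
  proof (rule Bochner_Integration.integrable_bound)
    show "integrable lborel (\<lambda>\<xi>. of_real (LINT t|lborel. \<bar>m t\<bar>) * h \<xi>)" using h by (rule integrable_mult_right)
    have "\<bar>LINT t|lborel. m t * exp (- t * (norm \<xi>)\<^sup>2)\<bar> \<le> (LINT t|lborel. \<bar>m t\<bar>)" for \<xi> :: 'a
    proof -
      have le: "\<bar>m t * exp (- t * (norm \<xi>)\<^sup>2)\<bar> \<le> \<bar>m t\<bar>" for t
        using m0[of t] by (cases "t > 0") (auto simp: abs_mult mult_left_le)
      have "\<bar>LINT t|lborel. m t * exp (- t * (norm \<xi>)\<^sup>2)\<bar> \<le> (LINT t|lborel. \<bar>m t * exp (- t * (norm \<xi>)\<^sup>2)\<bar>)"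
        by (rule integral_abs_bound)
      also have "\<dots> \<le> (LINT t|lborel. \<bar>m t\<bar>)"
      proof (rule integral_mono)
        show "integrable lborel (\<lambda>t. \<bar>m t * exp (- t * (norm \<xi>)\<^sup>2)\<bar>)"
          by (rule Bochner_Integration.integrable_bound[OF m]) (use le in auto)
      qed (use m le in auto)
      finally show ?thesis .
    qed
    thus "AE \<xi> in lborel. norm (of_real (LINT t|lborel. m t * exp (- t * (norm \<xi>)\<^sup>2)) * h \<xi>) \<le> norm (of_real (LINT t|lborel. \<bar>m t\<bar>) * h \<xi>)"
      by (intro AE_I2) (auto simp: norm_mult intro!: mult_right_mono intro: order.trans)
  qed measurable
qed

text \<open>In terms of symbols: the Laplace transform of \<open>power_diff N s\<close> at \<open>u = (norm \<xi>)\<^sup>2\<close>, times the symbol \<open>u powr s\<close>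
of the fractional Laplacian, is \<open>Gamma s * (1 - exp (- u)) ^ N\<close>, and the binomial theorem expands this into
symbols of heat operators.\<close>

lemma heat_resolution:
  fixes f :: "'a::euclidean_space \<Rightarrow> complex"
  assumes f: "f \<in> test_functions" and s: "0 < s" "s < real N"
  shows "(LINT t|lborel. of_real (power_diff N s t) * heat t (frac_laplacian s f) x) =
    of_real (Gamma s) * (f x + (\<Sum>k=1..N. of_real ((-1) ^ k * real (N choose k)) * heat (real k) f x))"
proof -
  note [measurable] = test_functions_measurable[OF f]
  let ?h = "\<lambda>\<xi>. of_real (norm \<xi> powr (2 * s)) * fourier f \<xi>"
  have h: "integrable lborel ?h" using s by (intro integrable_powr_fourier f) auto
  have m: "integrable lborel (power_diff N s)"
  proof -
    have "integrable lborel (\<lambda>t. \<bar>power_diff N s t\<bar> * t powr (- 0))" using s by (intro integrable_power_diff) auto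
    moreover have "\<bar>power_diff N s t\<bar> * t powr (- 0) = \<bar>power_diff N s t\<bar>" for t
      using power_diff_nonpos[of t N s] by (cases "t = 0") auto
    ultimately have "integrable lborel (\<lambda>t. \<bar>power_diff N s t\<bar>)" by (simp only:)
    thus ?thesis by (subst (asm) integrable_abs_iff) auto
  qed
  define E where "E k \<xi> = of_real (exp (- real k * (norm \<xi>)\<^sup>2)) * fourier f \<xi>" for k and \<xi> :: 'a
  have [measurable]: "E k \<in> borel_measurable borel" for k unfolding E_def by measurable
  have E: "integrable lborel (E k)" for k
  proof (rule Bochner_Integration.integrable_bound[OF integrable_fourier[OF f]])
    show "AE \<xi> in lborel. norm (E k \<xi>) \<le> norm (fourier f \<xi>)"
      by (intro AE_I2) (auto simp: E_def norm_mult intro!: mult_left_le_one_le)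
  qed measurable
  have IE0: "inverse_fourier (E 0) x = f x" unfolding E_def using fourier_inversion[OF f] by simp
  have IE: "inverse_fourier (E k) x = heat (real k) f x" if "k \<in> {1..N}" for k
    unfolding E_def using that by (subst heat_eq_inverse_fourier) (auto intro: test_functions_integrable f)
  have "(LINT t|lborel. of_real (power_diff N s t) * heat t (frac_laplacian s f) x) =
    inverse_fourier (\<lambda>\<xi>. of_real (LINT t|lborel. power_diff N s t * exp (- t * (norm \<xi>)\<^sup>2)) * ?h \<xi>) x"
    unfolding frac_laplacian_eq by (rule integral_heat_inverse_fourier[OF m power_diff_nonpos h])
  also have "\<dots> = inverse_fourier (\<lambda>\<xi>. of_real (Gamma s) * (\<Sum>k\<le>N. of_real ((-1) ^ k * real (N choose k)) * E k \<xi>)) x"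
  proof (rule inverse_fourier_cong_AE)
    show "AE \<xi> in lborel. of_real (LINT t|lborel. power_diff N s t * exp (- t * (norm \<xi>)\<^sup>2)) * ?h \<xi> =
      of_real (Gamma s) * (\<Sum>k\<le>N. of_real ((-1) ^ k * real (N choose k)) * E k \<xi>)"
      using AE_lborel_singleton[of 0]
    proof eventually_elim
      case (elim \<xi>)
      let ?u = "(norm \<xi>)\<^sup>2"
      have u: "?u > 0" using elim by simp
      have L: "(LINT t|lborel. power_diff N s t * exp (- t * ?u)) = Gamma s * ?u powr (- s) * (1 - exp (- ?u)) ^ N"
        using laplace_power_diff[OF s(1) u, of N] by (simp add: has_bochner_integral_iff)
      have e: "?u powr (- s) * norm \<xi> powr (2 * s) = 1"
      proof -
        have "?u powr (- s) = norm \<xi> powr (- (2 * s))"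
          using elim by (simp add: powr_powr flip: powr_numeral)
        thus ?thesis using elim by (simp flip: powr_add)
      qed
      have "Gamma s * ?u powr (- s) * (1 - exp (- ?u)) ^ N * norm \<xi> powr (2 * s) =
         Gamma s * (1 - exp (- ?u)) ^ N * (?u powr (- s) * norm \<xi> powr (2 * s))"
        by (simp only: mult_ac)
      hence 1: "Gamma s * ?u powr (- s) * (1 - exp (- ?u)) ^ N * norm \<xi> powr (2 * s) = Gamma s * (1 - exp (- ?u)) ^ N"
        unfolding e mult_1_right .
      have "(1 - exp (- ?u)) ^ N = (- exp (- ?u) + 1) ^ N" by simp
      also have "\<dots> = (\<Sum>k\<le>N. real (N choose k) * (- exp (- ?u)) ^ k * 1 ^ (N - k))"
        by (rule binomial_ring)
      also have "\<dots> = (\<Sum>k\<le>N. (-1) ^ k * real (N choose k) * exp (- real k * ?u))"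
        by (intro sum.cong refl) (simp add: power_minus[of "exp _"] exp_of_nat_mult[symmetric] mult_ac)
      finally have 2: "(1 - exp (- ?u)) ^ N = (\<Sum>k\<le>N. (-1) ^ k * real (N choose k) * exp (- real k * ?u))" .
      have "of_real (LINT t|lborel. power_diff N s t * exp (- t * ?u)) * ?h \<xi> =
         of_real (Gamma s * ?u powr (- s) * (1 - exp (- ?u)) ^ N * norm \<xi> powr (2 * s)) * fourier f \<xi>"
        unfolding L by (simp only: of_real_mult mult.assoc)
      also have "\<dots> = of_real (Gamma s * (1 - exp (- ?u)) ^ N) * fourier f \<xi>"
        unfolding 1 ..
      also have "\<dots> = of_real (Gamma s) * (of_real (\<Sum>k\<le>N. (-1) ^ k * real (N choose k) * exp (- real k * ?u)) * fourier f \<xi>)"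
        unfolding 2 by (simp only: of_real_mult mult.assoc)
      also have "of_real (\<Sum>k\<le>N. (-1) ^ k * real (N choose k) * exp (- real k * ?u)) * fourier f \<xi> =
         (\<Sum>k\<le>N. of_real ((-1) ^ k * real (N choose k)) * E k \<xi>)"
        unfolding of_real_sum sum_distrib_right E_def by (simp only: of_real_mult mult.assoc)
      finally show ?case .
    qed
  qed (unfold E_def, measurable)
  also have "\<dots> = of_real (Gamma s) * (\<Sum>k\<le>N. of_real ((-1) ^ k * real (N choose k)) * inverse_fourier (E k) x)"
    unfolding inverse_fourier_cmult
    by (subst inverse_fourier_sum) (auto simp only: inverse_fourier_cmult intro!: integrable_mult_right E)
  also have "(\<Sum>k\<le>N. of_real ((-1) ^ k * real (N choose k)) * inverse_fourier (E k) x) =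
     f x + (\<Sum>k=1..N. of_real ((-1) ^ k * real (N choose k)) * heat (real k) f x)"
  proof -
    have "{..N} = insert 0 {1..N}" by auto
    hence "(\<Sum>k\<le>N. of_real ((-1) ^ k * real (N choose k)) * inverse_fourier (E k) x) =
       inverse_fourier (E 0) x + (\<Sum>k=1..N. of_real ((-1) ^ k * real (N choose k)) * inverse_fourier (E k) x)"
      by simp
    also have "(\<Sum>k=1..N. of_real ((-1) ^ k * real (N choose k)) * inverse_fourier (E k) x) =
       (\<Sum>k=1..N. of_real ((-1) ^ k * real (N choose k)) * heat (real k) f x)"
      by (intro sum.cong refl) (simp only: IE)
    finally show ?thesis by (simp only: IE0)
  qed
  finally show ?thesis .
qed

text \<open>\<open>heat_resolution\<close> expresses \<open>f\<close> by heat operators applied to \<open>f\<close> and to its fractional Laplacian.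
The bound for the superposition with density \<open>power_diff N s\<close> uses \<open>b < 2 * s\<close> near \<open>t = 0\<close> and \<open>s < N\<close> near infinity.\<close>

theorem weighted_hardy:
  fixes p \<theta> b s :: real
  assumes p: "1 < p" and \<theta>: "0 \<le> \<theta>" "\<theta> < DIM('a::euclidean_space) * (p - 1)" and b: "0 \<le> b" "b * p < DIM('a)"
    and s: "0 < s" "b < 2 * s"
  obtains C where "C > 0" "\<And>f :: 'a \<Rightarrow> complex. f \<in> test_functions \<Longrightarrow>
    weighted_power p (\<theta> - b * p) f \<le> ennreal C * (weighted_power p \<theta> (frac_laplacian s f) + weighted_power p \<theta> f)"
proof -
  define N where "N = nat \<lceil>s\<rceil> + 1"
  have N: "s < real N" unfolding N_def using real_nat_ceiling_ge[of s] by simp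
  have m: "integrable lborel (\<lambda>t. \<bar>power_diff N s t\<bar> * t powr (- b / 2))"
    using integrable_power_diff[of "b / 2" s N] b s N by simp
  obtain C0 where C0: "C0 > 0" "\<And>f :: 'a \<Rightarrow> complex. f \<in> borel_measurable borel \<Longrightarrow>
    weighted_power p (\<theta> - b * p) (\<lambda>x. LINT t|lborel. of_real (power_diff N s t) * heat t f x) \<le> ennreal C0 * weighted_power p \<theta> f"
    using weighted_power_heat_superposition[OF p \<theta> b m measurable_power_diff power_diff_nonpos] by blast
  have "\<exists>C>0. \<forall>f :: 'a \<Rightarrow> complex. f \<in> borel_measurable borel \<longrightarrow>
     weighted_power p (\<theta> - b * p) (heat (real k) f) \<le> ennreal C * weighted_power p \<theta> f" if "k \<in> {1..N}" for k
    using weighted_power_heat[OF p \<theta> b, of "real k"] that by (metis atLeastAtMost_iff of_nat_0_less_iff not_one_le_zero gr0I)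
  then obtain Ck where Ck: "\<And>k. k \<in> {1..N} \<Longrightarrow> Ck k > 0" "\<And>k (f :: 'a \<Rightarrow> complex). k \<in> {1..N} \<Longrightarrow> f \<in> borel_measurable borel \<Longrightarrow>
     weighted_power p (\<theta> - b * p) (heat (real k) f) \<le> ennreal (Ck k) * weighted_power p \<theta> f"
    by metis
  have G: "Gamma s > 0" using s by (intro Gamma_real_pos)
  define c where "c k = (if k = 0 then 1 / Gamma s else real (N choose k))" for k
  have c0: "c k \<ge> 0" for k using G by (simp add: c_def)
  define D where "D k = (real (card {0..N}) * c k) powr p * (if k = 0 then C0 else Ck k)" for k
  have D0: "D k \<ge> 0" if "k \<in> {0..N}" for k
    using C0(1) Ck(1)[of k] that
    unfolding D_def by (intro mult_nonneg_nonneg) (auto intro: less_imp_le)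
  define C where "C = (\<Sum>k=0..N. D k) + 1"
  have C: "C > 0" unfolding C_def using D0 by (intro add_nonneg_pos sum_nonneg) auto
  show ?thesis
  proof (rule that[OF C])
    fix f :: "'a \<Rightarrow> complex" assume f: "f \<in> test_functions"
    note [measurable] = test_functions_measurable[OF f] measurable_frac_laplacian[OF f]
    define g where "g = frac_laplacian s f"
    have [measurable]: "g \<in> borel_measurable borel" unfolding g_def by measurable
    define A where "A x = (LINT t|lborel. of_real (power_diff N s t) * heat t g x)" for x
    define F where "F k = (if k = 0 then A else heat (real k) f)" for k
    have F: "F k \<in> borel_measurable borel" for k
      unfolding F_def A_def by (auto intro: measurable_heat measurable_heat_superposition)
    have le: "norm (f x) \<le> (\<Sum>k=0..N. c k * norm (F k x))" for x
    proof -
      let ?S = "\<Sum>k=1..N. of_real ((-1) ^ k * real (N choose k)) * heat (real k) f x"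
      have "A x = of_real (Gamma s) * (f x + ?S)"
        unfolding A_def g_def by (rule heat_resolution[OF f s(1) N])
      hence "f x = of_real (1 / Gamma s) * A x - ?S" using G by simp
      hence "norm (f x) \<le> norm (of_real (1 / Gamma s) * A x) + norm ?S"
        using norm_triangle_ineq4 by simp
      also have "norm ?S \<le> (\<Sum>k=1..N. norm (of_real ((-1) ^ k * real (N choose k)) * heat (real k) f x))"
        by (rule norm_sum)
      also have "\<dots> = (\<Sum>k=1..N. c k * norm (F k x))"
        by (intro sum.cong refl) (auto simp: norm_mult norm_power c_def F_def)
      also have "norm (of_real (1 / Gamma s) * A x) = c 0 * norm (F 0 x)"
        using G by (simp add: norm_mult c_def F_def norm_divide)
      also have "c 0 * norm (F 0 x) + (\<Sum>k=1..N. c k * norm (F k x)) = (\<Sum>k=0..N. c k * norm (F k x))"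
        by (simp add: sum.atLeast_Suc_atMost)
      finally show ?thesis by simp
    qed
    let ?W = "weighted_power p \<theta> g + weighted_power p \<theta> f"
    have Fb: "ennreal ((real (card {0..N}) * c k) powr p) * weighted_power p (\<theta> - b * p) (F k) \<le> ennreal (D k) * ?W" if k: "k \<in> {0..N}" for k
    proof -
      have "weighted_power p (\<theta> - b * p) (F k) \<le> ennreal (if k = 0 then C0 else Ck k) * ?W"
      proof (cases "k = 0")
        case True
        have "weighted_power p (\<theta> - b * p) A \<le> ennreal C0 * weighted_power p \<theta> g"
          unfolding A_def by (rule C0(2)) measurable
        also have "\<dots> \<le> ennreal C0 * ?W" by (intro mult_left_mono) auto
        finally show ?thesis using True by (simp add: F_def)
      next
        case False
        have "weighted_power p (\<theta> - b * p) (heat (real k) f) \<le> ennreal (Ck k) * weighted_power p \<theta> f"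
          using False k by (intro Ck(2)) auto
        also have "\<dots> \<le> ennreal (Ck k) * ?W" by (intro mult_left_mono) auto
        finally show ?thesis using False by (simp add: F_def)
      qed
      hence "ennreal ((real (card {0..N}) * c k) powr p) * weighted_power p (\<theta> - b * p) (F k) \<le>
         ennreal ((real (card {0..N}) * c k) powr p) * (ennreal (if k = 0 then C0 else Ck k) * ?W)"
        by (intro mult_left_mono) auto
      also have "\<dots> = ennreal (D k) * ?W"
        unfolding D_def by (simp add: ennreal_mult' mult.assoc del: card_atLeastAtMost)
      finally show ?thesis .
    qed
    have "weighted_power p (\<theta> - b * p) f \<le> (\<Sum>k=0..N. ennreal ((real (card {0..N}) * c k) powr p) * weighted_power p (\<theta> - b * p) (F k))"
      using p c0 F le by (intro weighted_power_sum_le) auto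
    also have "\<dots> \<le> (\<Sum>k=0..N. ennreal (D k) * ?W)" by (intro sum_mono Fb)
    also have "\<dots> = ennreal (\<Sum>k=0..N. D k) * ?W"
      using D0 by (subst sum_ennreal[symmetric]) (auto simp: sum_distrib_right)
    also have "\<dots> \<le> ennreal C * ?W" unfolding C_def by (intro mult_right_mono ennreal_leI) auto
    finally show "weighted_power p (\<theta> - b * p) f \<le> ennreal C * (weighted_power p \<theta> (frac_laplacian s f) + weighted_power p \<theta> f)"
      unfolding g_def .
  qed
qed

section \<open>Dilations and the form bound\<close>

lemma weighted_power_scale:
  fixes f :: "'a::euclidean_space \<Rightarrow> complex" and c p q s :: real
  assumes c: "c > 0" and [measurable]: "f \<in> borel_measurable borel"
  shows "weighted_power p q (\<lambda>x. f (c *\<^sub>R x)) = ennreal (c powr (- (DIM('a) + q))) * weighted_power p q f"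
proof -
  have "weighted_power p q f = ennreal (\<bar>c\<bar> ^ DIM('a)) * (\<integral>\<^sup>+x. ennreal (norm (f (0 + c *\<^sub>R x)) powr p * norm (0 + c *\<^sub>R x) powr q) \<partial>lborel)"
    unfolding Lp_norm_power_def using c by (intro nn_integral_lborel_affine) auto
  also have "(\<integral>\<^sup>+x. ennreal (norm (f (0 + c *\<^sub>R x)) powr p * norm (0 + c *\<^sub>R x) powr q) \<partial>lborel) =
     (\<integral>\<^sup>+x. ennreal (c powr q) * ennreal (norm (f (c *\<^sub>R x)) powr p * norm x powr q) \<partial>lborel)"
    using c by (intro nn_integral_cong) (auto simp: powr_mult mult_ac simp flip: ennreal_mult)
  also have "\<dots> = ennreal (c powr q) * weighted_power p q (\<lambda>x. f (c *\<^sub>R x))"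
    unfolding Lp_norm_power_def by (rule nn_integral_cmult) measurable
  finally have "weighted_power p q f = ennreal (c powr (DIM('a) + q)) * weighted_power p q (\<lambda>x. f (c *\<^sub>R x))"
    using c by (simp add: mult.assoc[symmetric] powr_add powr_realpow flip: ennreal_mult)
  hence "ennreal (c powr (- (DIM('a) + q))) * weighted_power p q f =
     ennreal (c powr (- (DIM('a) + q)) * c powr (DIM('a) + q)) * weighted_power p q (\<lambda>x. f (c *\<^sub>R x))"
    by (simp only: ennreal_mult powr_ge_zero mult.assoc)
  also have "c powr (- (DIM('a) + q)) * c powr (DIM('a) + q) = 1"
    using c by (simp flip: powr_add)
  finally show ?thesis by simp
qed

lemma fourier_scale:
  fixes f :: "'a::euclidean_space \<Rightarrow> complex" and c :: real
  assumes c: "c > 0" and [measurable]: "f \<in> borel_measurable borel"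
  shows "fourier f (\<xi> /\<^sub>R c) = of_real (c ^ DIM('a)) * fourier (\<lambda>x. f (c *\<^sub>R x)) \<xi>"
proof -
  have "fourier f (\<xi> /\<^sub>R c) = (\<bar>c\<bar> ^ DIM('a)) *\<^sub>R (LINT x|lborel. cis (- ((c *\<^sub>R x) \<bullet> (\<xi> /\<^sub>R c))) * f (c *\<^sub>R x))"
    unfolding fourier_def using c by (intro integral_lborel_scale) auto
  moreover have "(c *\<^sub>R x) \<bullet> (\<xi> /\<^sub>R c) = x \<bullet> \<xi>" for x
    using c by simp
  ultimately show ?thesis using c by (simp only: fourier_def scaleR_conv_of_real abs_of_pos)
qed

lemma frac_laplacian_scale:
  fixes f :: "'a::euclidean_space \<Rightarrow> complex" and c p q s :: real
  assumes c: "c > 0" and [measurable]: "f \<in> borel_measurable borel"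
  shows "frac_laplacian s (\<lambda>x. f (c *\<^sub>R x)) = (\<lambda>x. of_real (c powr (2 * s)) * frac_laplacian s f (c *\<^sub>R x))"
proof
  fix x
  let ?K = "complex_of_real (1 / (2 * pi) ^ DIM('a))"
  have m: "(\<lambda>x. f (c *\<^sub>R x)) \<in> borel_measurable borel" by measurable
  have "(LINT \<xi>|lborel. cis (x \<bullet> \<xi>) * (of_real (norm \<xi> powr (2 * s)) * fourier (\<lambda>x. f (c *\<^sub>R x)) \<xi>)) =
    (\<bar>c\<bar> ^ DIM('a)) *\<^sub>R (LINT \<xi>|lborel. cis (x \<bullet> (c *\<^sub>R \<xi>)) * (of_real (norm (c *\<^sub>R \<xi>) powr (2 * s)) * fourier (\<lambda>x. f (c *\<^sub>R x)) (c *\<^sub>R \<xi>)))"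
    using c m by (intro integral_lborel_scale) auto
  also have "\<dots> = (LINT \<xi>|lborel. (\<bar>c\<bar> ^ DIM('a)) *\<^sub>R (cis (x \<bullet> (c *\<^sub>R \<xi>)) * (of_real (norm (c *\<^sub>R \<xi>) powr (2 * s)) * fourier (\<lambda>x. f (c *\<^sub>R x)) (c *\<^sub>R \<xi>))))"
    by (rule integral_scaleR_right[symmetric])
  also have "\<dots> = (LINT \<xi>|lborel. of_real (c powr (2 * s)) * (cis ((c *\<^sub>R x) \<bullet> \<xi>) * (of_real (norm \<xi> powr (2 * s)) * fourier f \<xi>)))"
  proof (intro Bochner_Integration.integral_cong refl)
    fix \<xi>
    have "fourier f \<xi> = of_real (c ^ DIM('a)) * fourier (\<lambda>x. f (c *\<^sub>R x)) (c *\<^sub>R \<xi>)"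
      using fourier_scale[OF c assms(2), of "c *\<^sub>R \<xi>"] c by simp
    thus "(\<bar>c\<bar> ^ DIM('a)) *\<^sub>R (cis (x \<bullet> (c *\<^sub>R \<xi>)) * (of_real (norm (c *\<^sub>R \<xi>) powr (2 * s)) * fourier (\<lambda>x. f (c *\<^sub>R x)) (c *\<^sub>R \<xi>))) =
      of_real (c powr (2 * s)) * (cis ((c *\<^sub>R x) \<bullet> \<xi>) * (of_real (norm \<xi> powr (2 * s)) * fourier f \<xi>))"
      using c by (simp add: scaleR_conv_of_real powr_mult mult_ac)
  qed
  also have "\<dots> = of_real (c powr (2 * s)) * (LINT \<xi>|lborel. cis ((c *\<^sub>R x) \<bullet> \<xi>) * (of_real (norm \<xi> powr (2 * s)) * fourier f \<xi>))"
    by (rule integral_mult_right_zero)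
  finally show "frac_laplacian s (\<lambda>x. f (c *\<^sub>R x)) x = of_real (c powr (2 * s)) * frac_laplacian s f (c *\<^sub>R x)"
    unfolding frac_laplacian_eq inverse_fourier_def by (simp only: mult.left_commute)
qed

lemma weighted_power_cmult:
  fixes k p q :: real
  assumes "k \<ge> 0" and [measurable]: "f \<in> borel_measurable borel"
  shows "weighted_power p q (\<lambda>x. of_real k * f x) = ennreal (k powr p) * weighted_power p q f"
  unfolding Lp_norm_power_def
  by (subst nn_integral_cmult[symmetric])
     (use assms(1) in \<open>auto intro!: nn_integral_cong simp: norm_mult powr_mult mult_ac simp flip: ennreal_mult\<close>)

lemma weighted_power_frac_laplacian_scale:
  fixes f :: "'a::euclidean_space \<Rightarrow> complex" and c p q s :: real
  assumes c: "c > 0" and f: "f \<in> test_functions"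
  shows "weighted_power p q (frac_laplacian s (\<lambda>x. f (c *\<^sub>R x))) =
    ennreal (c powr (2 * s * p - (DIM('a) + q))) * weighted_power p q (frac_laplacian s f)"
proof -
  note [measurable] = test_functions_measurable[OF f] measurable_frac_laplacian[OF f]
  have "weighted_power p q (frac_laplacian s (\<lambda>x. f (c *\<^sub>R x))) =
     ennreal ((c powr (2 * s)) powr p) * (ennreal (c powr (- (DIM('a) + q))) * weighted_power p q (frac_laplacian s f))"
    unfolding frac_laplacian_scale[OF c test_functions_measurable[OF f]]
    using c by (subst weighted_power_cmult, simp, measurable, subst weighted_power_scale) auto
  also have "\<dots> = ennreal ((c powr (2 * s)) powr p * c powr (- (DIM('a) + q))) * weighted_power p q (frac_laplacian s f)"
    by (simp only: ennreal_mult powr_ge_zero mult.assoc)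
  also have "(c powr (2 * s)) powr p * c powr (- (DIM('a) + q)) = c powr (2 * s * p - (DIM('a) + q))"
    unfolding powr_powr powr_add[symmetric] by (simp add: algebra_simps)
  finally show ?thesis .
qed

lemma weighted_power_multiplier:
  "Lp_norm_power p (\<lambda>x. norm x powr \<theta>) (\<lambda>x. of_real (norm x powr a) * f x) = weighted_power p (\<theta> + a * p) f"
  unfolding Lp_norm_power_def
  by (intro nn_integral_cong) (auto simp: norm_mult powr_mult powr_powr powr_add mult_ac)

text \<open>All three norms are homogeneous under dilations, so a form bound for the dilate of \<open>f\<close> is one for \<open>f\<close> itself with
other constants.\<close>

lemma form_bound_dilate:
  fixes f :: "'a::euclidean_space \<Rightarrow> complex" and p \<theta> a s c E C :: real
  assumes f: "f \<in> test_functions" and c: "c > 0" and E: "E \<ge> 0" and C: "C \<ge> 0"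
    and bd: "weighted_power p (\<theta> + a * p) (\<lambda>x. f (c *\<^sub>R x)) \<le>
      ennreal E * weighted_power p \<theta> (frac_laplacian s (\<lambda>x. f (c *\<^sub>R x))) + ennreal C * weighted_power p \<theta> (\<lambda>x. f (c *\<^sub>R x))"
  shows "weighted_power p (\<theta> + a * p) f \<le>
    ennreal (E * c powr ((a + 2 * s) * p)) * weighted_power p \<theta> (frac_laplacian s f) + ennreal (C * c powr (a * p)) * weighted_power p \<theta> f"
proof -
  let ?n = "real DIM('a)" and ?q = "\<theta> + a * p"
  let ?A = "weighted_power p \<theta> (frac_laplacian s f)" and ?B = "weighted_power p \<theta> f" and ?L = "weighted_power p ?q f"
  have le: "ennreal (c powr (- (?n + ?q))) * ?L \<le>
     ennreal E * (ennreal (c powr (2 * s * p - (?n + \<theta>))) * ?A) + ennreal C * (ennreal (c powr (- (?n + \<theta>))) * ?B)"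
    using bd unfolding weighted_power_frac_laplacian_scale[OF c f]
      weighted_power_scale[OF c test_functions_measurable[OF f]] .
  let ?k = "c powr (?n + ?q)"
  have "?L = ennreal (?k * c powr (- (?n + ?q))) * ?L"
    using c by (simp flip: powr_add)
  also have "\<dots> = ennreal ?k * (ennreal (c powr (- (?n + ?q))) * ?L)"
    by (simp only: ennreal_mult powr_ge_zero mult.assoc)
  also have "\<dots> \<le> ennreal ?k * (ennreal E * (ennreal (c powr (2 * s * p - (?n + \<theta>))) * ?A) + ennreal C * (ennreal (c powr (- (?n + \<theta>))) * ?B))"
    by (intro mult_left_mono le) auto
  also have "\<dots> = ennreal (E * (?k * c powr (2 * s * p - (?n + \<theta>)))) * ?A + ennreal (C * (?k * c powr (- (?n + \<theta>)))) * ?B"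
    using E C by (simp add: ennreal_mult distrib_left mult_ac)
  also have "?k * c powr (2 * s * p - (?n + \<theta>)) = c powr ((a + 2 * s) * p)"
    unfolding powr_add[symmetric] by (simp add: algebra_simps)
  also have "?k * c powr (- (?n + \<theta>)) = c powr (a * p)"
    unfolding powr_add[symmetric] by (simp add: algebra_simps)
  finally show ?thesis .
qed

text \<open>Inserting \<open>f (c x)\<close> into \<open>weighted_hardy\<close> multiplies the term with the
fractional Laplacian by \<open>c powr ((2 * s - b) * p)\<close> relative to the left hand side; this is small for small \<open>c\<close>.\<close>

theorem form_bound_sufficient:
  fixes p \<theta> b s \<epsilon> :: real
  assumes p: "1 < p" and \<theta>: "0 \<le> \<theta>" "\<theta> < DIM('a::euclidean_space) * (p - 1)" and b: "0 \<le> b" "b * p < DIM('a)"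
    and s: "0 < s" "b < 2 * s" and \<epsilon>: "\<epsilon> > 0"
  obtains C where "C > 0" "\<And>f :: 'a \<Rightarrow> complex. f \<in> test_functions \<Longrightarrow>
    weighted_power p (\<theta> - b * p) f \<le> ennreal \<epsilon> * weighted_power p \<theta> (frac_laplacian s f) + ennreal C * weighted_power p \<theta> f"
proof -
  obtain C where C: "C > 0" "\<And>f :: 'a \<Rightarrow> complex. f \<in> test_functions \<Longrightarrow>
    weighted_power p (\<theta> - b * p) f \<le> ennreal C * (weighted_power p \<theta> (frac_laplacian s f) + weighted_power p \<theta> f)"
    using weighted_hardy[OF p \<theta> b s] by blast
  define d where "d = (2 * s - b) * p"
  have d: "d > 0" using s p by (simp add: d_def)
  \<comment> \<open>the dilation for which the factor of the fractional Laplacian becomes \<open>\<epsilon>\<close>\<close>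
  define c where "c = (\<epsilon> / C) powr (1 / d)"
  have c: "c > 0" using C(1) \<epsilon> by (simp add: c_def)
  have cd: "C * c powr d = \<epsilon>" using C(1) \<epsilon> d by (simp add: c_def powr_powr)
  show ?thesis
  proof (rule that[of "C * c powr (- b * p)"])
    show "C * c powr (- b * p) > 0" using C(1) c by simp
    fix f :: "'a \<Rightarrow> complex" assume f: "f \<in> test_functions"
    let ?A = "weighted_power p \<theta> (frac_laplacian s f)" and ?B = "weighted_power p \<theta> f"
    have fc: "(\<lambda>x. f (c *\<^sub>R x)) \<in> test_functions"
      using test_functions_affine[OF f, of c 0] c by simp
    have "weighted_power p (\<theta> + (- b) * p) f \<le>
       ennreal (C * c powr ((- b + 2 * s) * p)) * ?A + ennreal (C * c powr (- b * p)) * ?B"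
      by (rule form_bound_dilate[OF f c]) (use C(1) C(2)[OF fc] in \<open>simp_all add: distrib_left\<close>)
    also have "C * c powr ((- b + 2 * s) * p) = \<epsilon>"
      using cd by (simp add: d_def)
    finally show "weighted_power p (\<theta> - b * p) f \<le> ennreal \<epsilon> * ?A + ennreal (C * c powr (- b * p)) * ?B"
      by simp
  qed
qed

section \<open>The fractional Laplacian of a test function has finite weighted norm\<close>

lemma weighted_power_test_finite:
  fixes f :: "'a::euclidean_space \<Rightarrow> complex"
  assumes f: "f \<in> test_functions" and p: "p > 0" and q: "q \<ge> 0"
  shows "weighted_power p q f < \<infinity>"
proof -
  obtain B R where BR: "B \<ge> 0" "R > 0" "\<And>x. norm (f x) \<le> B" "\<And>x. norm x > R \<Longrightarrow> f x = 0"
    using test_functions_bounded_support[OF f] by metis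
  have "norm (f x) powr p * norm x powr q \<le> B powr p * R powr q * indicator (cball 0 R) x" for x
  proof (cases "norm x \<le> R")
    case True
    have "norm (f x) powr p * norm x powr q \<le> B powr p * R powr q"
      using p q BR(3) True by (intro mult_mono powr_mono2) auto
    thus ?thesis using True by simp
  qed (use BR in auto)
  hence "weighted_power p q f \<le> (\<integral>\<^sup>+x. ennreal (B powr p * R powr q) * indicator (cball 0 R) (x::'a) \<partial>lborel)"
    unfolding Lp_norm_power_def
    by (intro nn_integral_mono) (metis ennreal_indicator ennreal_leI ennreal_mult' mult_nonneg_nonneg powr_ge_zero)
  also have "\<dots> < \<infinity>"
    using emeasure_lborel_cball_finite[of "0::'a" R] by (simp add: nn_integral_cmult_indicator ennreal_mult_less_top)
  finally show ?thesis .
qed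

text \<open>The continuous function \<open>f\<close> would otherwise vanish almost everywhere although it is nonzero on a nonempty open set.\<close>

lemma weighted_power_test_pos:
  fixes f :: "'a::euclidean_space \<Rightarrow> complex"
  assumes f: "f \<in> test_functions" and f0: "f 0 \<noteq> 0"
  shows "weighted_power p q f > 0"
proof (rule ccontr)
  note [measurable] = test_functions_measurable[OF f]
  assume "\<not> ?thesis"
  hence "weighted_power p q f = 0" by simp
  hence "AE x in lborel. ennreal (norm (f x) powr p * norm x powr q) = 0"
    unfolding Lp_norm_power_def by (subst (asm) nn_integral_0_iff_AE) auto
  hence "AE x in lborel. f x = 0"
    using AE_lborel_singleton[of 0]
  proof eventually_elim
    case (elim x)
    have "norm (f x) powr p * norm x powr q = 0"
      using elim(1) by (metis ennreal_eq_0_iff mult_nonneg_nonneg powr_ge_zero antisym)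
    thus ?case using elim(2) by simp
  qed
  hence "{x. f x \<noteq> 0} \<in> null_sets lborel"
    by (subst (asm) AE_iff_null) auto
  hence "negligible {x. f x \<noteq> 0}"
    by (simp add: negligible_iff_null_sets null_sets_completionI)
  moreover have "open {x. f x \<noteq> 0}"
    by (intro open_Collect_neq test_functions_continuous f continuous_on_const)
  ultimately show False using f0 open_not_negligible by blast
qed

lemma test_functions_neg_laplacian_power:
  assumes "f \<in> test_functions"
  shows "(neg_laplacian ^^ J) f \<in> test_functions"
  by (induction J) (auto intro: test_functions_neg_laplacian assms)

lemma fourier_neg_laplacian_power:
  assumes "f \<in> test_functions"
  shows "fourier ((neg_laplacian ^^ J) f) \<xi> = of_real (norm \<xi> ^ (2 * J)) * fourier f \<xi>"
  by (induction J)
     (auto simp: fourier_neg_laplacian test_functions_neg_laplacian_power assms power2_eq_square)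

text \<open>Whole powers of the negative Laplacian preserve test functions, so that only exponents in \<open>[0, 1)\<close> remain
to be treated.\<close>

lemma frac_laplacian_reduce:
  fixes f :: "'a::euclidean_space \<Rightarrow> complex"
  assumes f: "f \<in> test_functions"
  shows "frac_laplacian (real J + r) f = frac_laplacian r ((neg_laplacian ^^ J) f)"
proof
  fix x
  note [measurable] = test_functions_measurable[OF f] test_functions_measurable[OF test_functions_neg_laplacian_power[OF f, of J]]
  show "frac_laplacian (real J + r) f x = frac_laplacian r ((neg_laplacian ^^ J) f) x"
    unfolding frac_laplacian_eq
  proof (rule inverse_fourier_cong_AE)
    show "AE \<xi> in lborel. of_real (norm \<xi> powr (2 * (real J + r))) * fourier f \<xi> =
       of_real (norm \<xi> powr (2 * r)) * fourier ((neg_laplacian ^^ J) f) \<xi>"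
      using AE_lborel_singleton[of 0]
    proof eventually_elim
      case (elim \<xi>)
      have "norm \<xi> powr (2 * (real J + r)) = norm \<xi> powr (2 * r) * norm \<xi> powr (real (2 * J))"
        unfolding powr_add[symmetric] by (simp add: algebra_simps)
      also have "norm \<xi> powr (real (2 * J)) = norm \<xi> ^ (2 * J)"
        using elim by (intro powr_realpow) simp
      finally show ?case unfolding fourier_neg_laplacian_power[OF f] by simp
    qed
  qed measurable
qed

text \<open>The operator form of \<open>fractional_power_laplace\<close>: the factor \<open>u\<close> in front of the first Laplace transform becomes
a Laplacian applied to the test function.\<close>

lemma frac_laplacian_heat_representation:
  fixes f :: "'a::euclidean_space \<Rightarrow> complex" and r :: real
  assumes f: "f \<in> test_functions" and r: "0 \<le> r" "r < 1"
  defines "m1 \<equiv> (\<lambda>t. indicator {0<..<1} t * t powr (- r))"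
    and "m2 \<equiv> (\<lambda>t. r * (indicator {1..} t * t powr (- r - 1)))"
  shows "integrable lborel m1" "integrable lborel m2"
    "of_real (Gamma (1 - r)) * frac_laplacian r f x =
      (LINT t|lborel. of_real (m1 t) * heat t (neg_laplacian f) x) + heat 1 f x
        - (LINT t|lborel. of_real (m2 t) * heat t f x)"
proof -
  note [measurable] = test_functions_measurable[OF f] test_functions_measurable[OF test_functions_neg_laplacian[OF f]]
  show m1: "integrable lborel m1" unfolding m1_def using r by (intro integrable_powr_initial) auto
  show m2: "integrable lborel m2"
  proof (cases "r = 0")
    case False
    thus ?thesis unfolding m2_def using integrable_powr_atLeast[of "- r - 1" 0] r
      by (intro integrable_mult_right) auto
  qed (auto simp: m2_def)
  have m10: "m1 t = 0" and m20: "m2 t = 0" if "t \<le> 0" for t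
    using that by (auto simp: m1_def m2_def)
  let ?h = "fourier f" and ?k = "fourier (neg_laplacian f)"
  have h: "integrable lborel ?h" and k: "integrable lborel ?k"
    by (intro integrable_fourier f test_functions_neg_laplacian)+
  let ?L1 = "\<lambda>\<xi>. of_real (LINT t|lborel. m1 t * exp (- t * (norm \<xi>)\<^sup>2)) * ?k \<xi>"
  let ?L2 = "\<lambda>\<xi>. of_real (LINT t|lborel. m2 t * exp (- t * (norm \<xi>)\<^sup>2)) * ?h \<xi>"
  let ?E = "\<lambda>\<xi>. of_real (exp (- 1 * (norm \<xi>)\<^sup>2)) * ?h \<xi>"
  have 1: "(LINT t|lborel. of_real (m1 t) * heat t (neg_laplacian f) x) = inverse_fourier ?L1 x"
    using integral_heat_inverse_fourier[OF m1 m10 k, of x] unfolding fourier_inversion[OF test_functions_neg_laplacian[OF f]] by simp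
  have 2: "(LINT t|lborel. of_real (m2 t) * heat t f x) = inverse_fourier ?L2 x"
    using integral_heat_inverse_fourier[OF m2 m20 h, of x] unfolding fourier_inversion[OF f] by simp
  have 3: "heat 1 f x = inverse_fourier ?E x"
    by (intro heat_eq_inverse_fourier test_functions_integrable f) simp
  have i1: "integrable lborel ?L1" by (rule integrable_laplace_mult[OF m1 m10 k])
  have i2: "integrable lborel ?L2" by (rule integrable_laplace_mult[OF m2 m20 h])
  have i3: "integrable lborel ?E"
    by (rule Bochner_Integration.integrable_bound[OF h]) (auto simp: norm_mult intro!: mult_left_le_one_le)
  define F where "F i = (if i = (0::nat) then ?L1 else if i = 1 then ?E else (\<lambda>\<xi>. (-1) * ?L2 \<xi>))" for i
  have "inverse_fourier (\<lambda>\<xi>. \<Sum>i<3. F i \<xi>) x = (\<Sum>i<3. inverse_fourier (F i) x)"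
    by (rule inverse_fourier_sum) (use i1 i2 i3 in \<open>auto simp: F_def\<close>)
  also have "\<dots> = inverse_fourier ?L1 x + inverse_fourier ?E x - inverse_fourier ?L2 x"
    unfolding F_def by (simp add: numeral_3_eq_3 inverse_fourier_cmult[of "-1", simplified])
  finally have S: "inverse_fourier (\<lambda>\<xi>. \<Sum>i<3. F i \<xi>) x = inverse_fourier ?L1 x + inverse_fourier ?E x - inverse_fourier ?L2 x" .
  have "of_real (Gamma (1 - r)) * frac_laplacian r f x = inverse_fourier (\<lambda>\<xi>. of_real (Gamma (1 - r)) * (of_real (norm \<xi> powr (2 * r)) * ?h \<xi>)) x"
    by (simp only: inverse_fourier_cmult frac_laplacian_eq)
  also have "\<dots> = inverse_fourier (\<lambda>\<xi>. \<Sum>i<3. F i \<xi>) x"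
  proof (rule inverse_fourier_cong_AE)
    show "AE \<xi> in lborel. of_real (Gamma (1 - r)) * (of_real (norm \<xi> powr (2 * r)) * ?h \<xi>) = (\<Sum>i<3. F i \<xi>)"
      using AE_lborel_singleton[of 0]
    proof eventually_elim
      case (elim \<xi>)
      let ?u = "(norm \<xi>)\<^sup>2"
      have u: "?u > 0" using elim by simp
      have "Gamma (1 - r) * ?u powr r =
         ?u * (LINT t|lborel. m1 t * exp (- t * ?u)) + exp (- ?u) - (LINT t|lborel. m2 t * exp (- t * ?u))"
        unfolding m1_def m2_def by (rule fractional_power_laplace[OF r u])
      moreover have "?u powr r = norm \<xi> powr (2 * r)"
        using elim by (simp add: powr_powr flip: powr_numeral)
      ultimately have "of_real (Gamma (1 - r) * norm \<xi> powr (2 * r)) * ?h \<xi> =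
         of_real (?u * (LINT t|lborel. m1 t * exp (- t * ?u)) + exp (- ?u) - (LINT t|lborel. m2 t * exp (- t * ?u))) * ?h \<xi>"
        by simp
      also have "\<dots> = ?L1 \<xi> + ?E \<xi> - ?L2 \<xi>"
        unfolding fourier_neg_laplacian[OF f] by (simp add: algebra_simps)
      also have "\<dots> = (\<Sum>i<3. F i \<xi>)" by (simp add: F_def numeral_3_eq_3)
      finally show ?case by (simp add: mult.assoc)
    qed
    have "F i \<in> borel_measurable borel" for i
      using borel_measurable_integrable[OF i1] borel_measurable_integrable[OF i2] borel_measurable_integrable[OF i3]
      by (auto simp: F_def)
    thus "(\<lambda>\<xi>. \<Sum>i<3. F i \<xi>) \<in> borel_measurable borel" by measurable
  qed measurable
  finally show "of_real (Gamma (1 - r)) * frac_laplacian r f x =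
      (LINT t|lborel. of_real (m1 t) * heat t (neg_laplacian f) x) + heat 1 f x
        - (LINT t|lborel. of_real (m2 t) * heat t f x)"
    unfolding 1 2 3 S .
qed

text \<open>The fractional Laplacian is a combination of heat superpositions with integrable densities, applied to test functions.
These superpositions are bounded on the weighted space by \<open>weighted_heat_superposition\<close> with \<open>b = 0\<close>, so no pointwise
decay of \<open>frac_laplacian s f\<close> is needed.\<close>

theorem weighted_power_frac_laplacian_finite:
  fixes f :: "'a::euclidean_space \<Rightarrow> complex" and p \<theta> s :: real
  assumes f: "f \<in> test_functions" and p: "1 < p" and \<theta>: "0 \<le> \<theta>" "\<theta> < DIM('a) * (p - 1)" and s: "s > 0"
  shows "weighted_power p \<theta> (frac_laplacian s f) < \<infinity>"
proof -
  define J where "J = nat \<lfloor>s\<rfloor>"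
  define r where "r = s - real J"
  have "real J = of_int \<lfloor>s\<rfloor>" using s by (simp add: J_def)
  hence r: "0 \<le> r" "r < 1" unfolding r_def by linarith+
  define g where "g = (neg_laplacian ^^ J) f"
  have g: "g \<in> test_functions" unfolding g_def by (rule test_functions_neg_laplacian_power[OF f])
  have eq: "frac_laplacian s f = frac_laplacian r g"
    using frac_laplacian_reduce[OF f, of J r] by (simp add: r_def g_def)
  note [measurable] = test_functions_measurable[OF g] test_functions_measurable[OF test_functions_neg_laplacian[OF g]]
  define m1 where "m1 = (\<lambda>t. indicator {0<..<1} t * t powr (- r))"
  define m2 where "m2 = (\<lambda>t. r * (indicator {1..} t * t powr (- r - 1)))"
  have [measurable]: "m1 \<in> borel_measurable borel" "m2 \<in> borel_measurable borel"
    unfolding m1_def m2_def by measurable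
  have m0: "m1 t = 0" "m2 t = 0" if "t \<le> 0" for t using that by (auto simp: m1_def m2_def)
  have mi: "integrable lborel m1" "integrable lborel m2"
    unfolding m1_def m2_def by (rule frac_laplacian_heat_representation[OF g r])+
  have rep: "of_real (Gamma (1 - r)) * frac_laplacian r g x =
      (LINT t|lborel. of_real (m1 t) * heat t (neg_laplacian g) x) + heat 1 g x
        - (LINT t|lborel. of_real (m2 t) * heat t g x)" for x
    unfolding m1_def m2_def by (rule frac_laplacian_heat_representation[OF g r])
  have G: "Gamma (1 - r) > 0" using r by (intro Gamma_real_pos) auto
  have b: "0 \<le> (0::real)" "0 * p < real DIM('a)" by auto
  have mi0: "integrable lborel (\<lambda>t. \<bar>m t\<bar> * t powr (- 0 / 2))"
    if "integrable lborel m" "\<And>t. t \<le> 0 \<Longrightarrow> m t = 0" for m :: "real \<Rightarrow> real"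
  proof -
    have "\<bar>m t\<bar> * t powr (- 0 / 2) = \<bar>m t\<bar>" for t using that(2)[of t] by (cases "t = 0") auto
    thus ?thesis using that(1) by (simp only: integrable_abs)
  qed
  have finI: "weighted_power p \<theta> (\<lambda>x. LINT t|lborel. of_real (m t) * heat t k x) < \<infinity>"
    if m: "integrable lborel m" "\<And>t. t \<le> 0 \<Longrightarrow> m t = 0" "m \<in> borel_measurable borel" and k: "k \<in> test_functions" for m :: "real \<Rightarrow> real" and k :: "'a \<Rightarrow> complex"
  proof -
    obtain C where C: "\<And>f :: 'a \<Rightarrow> complex. f \<in> borel_measurable borel \<Longrightarrow>
      weighted_power p (\<theta> - 0 * p) (\<lambda>x. LINT t|lborel. of_real (m t) * heat t f x) \<le> ennreal C * weighted_power p \<theta> f"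
      using weighted_power_heat_superposition[OF p \<theta> b mi0[OF m(1,2)] m(3,2)] by blast
    have "weighted_power p \<theta> (\<lambda>x. LINT t|lborel. of_real (m t) * heat t k x) \<le> ennreal C * weighted_power p \<theta> k"
      using C[OF test_functions_measurable[OF k]] by simp
    also have "\<dots> < \<infinity>"
      using weighted_power_test_finite[OF k, of p \<theta>] p \<theta> by (simp add: ennreal_mult_less_top)
    finally show ?thesis .
  qed
  have fin1: "weighted_power p \<theta> (heat 1 g) < \<infinity>"
  proof -
    obtain C where C: "\<And>f :: 'a \<Rightarrow> complex. f \<in> borel_measurable borel \<Longrightarrow>
      weighted_power p (\<theta> - 0 * p) (heat 1 f) \<le> ennreal C * weighted_power p \<theta> f"
      using weighted_power_heat[OF p \<theta> b, of 1] by (metis zero_less_one)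
    have "weighted_power p \<theta> (heat 1 g) \<le> ennreal C * weighted_power p \<theta> g"
      using C[OF test_functions_measurable[OF g]] by simp
    also have "\<dots> < \<infinity>"
      using weighted_power_test_finite[OF g, of p \<theta>] p \<theta> by (simp add: ennreal_mult_less_top)
    finally show ?thesis .
  qed
  define F where "F i = (if i = (0::nat) then (\<lambda>x. LINT t|lborel. of_real (m1 t) * heat t (neg_laplacian g) x)
     else if i = 1 then heat 1 g else (\<lambda>x. LINT t|lborel. of_real (m2 t) * heat t g x))" for i
  have F: "F i \<in> borel_measurable borel" for i
    by (auto simp: F_def intro!: measurable_heat measurable_heat_superposition)
  have Ffin: "weighted_power p \<theta> (F i) < \<infinity>" for i
    using fin1 finI[OF mi(1) m0(1) _ test_functions_neg_laplacian[OF g]] finI[OF mi(2) m0(2) _ g]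
    by (auto simp: F_def)
  have le: "norm (frac_laplacian r g x) \<le> (\<Sum>i<3. (1 / Gamma (1 - r)) * norm (F i x))" for x
  proof -
    have "of_real (Gamma (1 - r)) * frac_laplacian r g x = F 0 x + F 1 x - F 2 x"
      using rep[of x] by (simp add: F_def)
    hence "norm (of_real (Gamma (1 - r)) * frac_laplacian r g x) \<le> norm (F 0 x) + norm (F 1 x) + norm (F 2 x)"
      by (metis add_right_mono norm_triangle_ineq norm_triangle_ineq4 order.trans)
    hence "Gamma (1 - r) * norm (frac_laplacian r g x) \<le> norm (F 0 x) + norm (F 1 x) + norm (F 2 x)"
      using G by (simp add: norm_mult)
    hence "norm (frac_laplacian r g x) \<le> (norm (F 0 x) + norm (F 1 x) + norm (F 2 x)) / Gamma (1 - r)"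
      using G by (simp add: field_simps)
    thus ?thesis by (simp add: numeral_3_eq_3 numeral_2_eq_2 add_divide_distrib)
  qed
  have "weighted_power p \<theta> (frac_laplacian r g) \<le>
     (\<Sum>i<3. ennreal ((real (card {..<3::nat}) * (1 / Gamma (1 - r))) powr p) * weighted_power p \<theta> (F i))"
    by (rule weighted_power_sum_le) (use p F G le in auto)
  also have "\<dots> < \<infinity>"
    using Ffin by (simp add: ennreal_mult_less_top)
  finally show ?thesis unfolding eq .
qed

section \<open>Necessity of the conditions on the exponent\<close>

lemma frac_laplacian_translate:
  fixes f :: "'a::euclidean_space \<Rightarrow> complex"
  assumes [measurable]: "f \<in> borel_measurable borel"
  shows "frac_laplacian s (\<lambda>x. f (v + x)) = (\<lambda>x. frac_laplacian s f (v + x))"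
proof
  fix x
  have "cis (x \<bullet> \<xi>) * (of_real (norm \<xi> powr (2 * s)) * fourier (\<lambda>x. f (v + x)) \<xi>) =
     cis ((v + x) \<bullet> \<xi>) * (of_real (norm \<xi> powr (2 * s)) * fourier f \<xi>)" for \<xi>
    by (simp add: fourier_shift inner_add_left cis_mult[symmetric] mult_ac)
  thus "frac_laplacian s (\<lambda>x. f (v + x)) x = frac_laplacian s f (v + x)"
    by (simp only: frac_laplacian_eq inverse_fourier_def)
qed

lemma weighted_power_translate:
  fixes f :: "'a::euclidean_space \<Rightarrow> complex"
  assumes [measurable]: "f \<in> borel_measurable borel"
  shows "weighted_power p q (\<lambda>x. f (- v + x)) = (\<integral>\<^sup>+x. ennreal (norm (f x) powr p * norm (v + x) powr q) \<partial>lborel)"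
  unfolding Lp_norm_power_def
  by (subst nn_integral_lborel_affine[of 1 _ v]) auto

lemma weighted_power_translate_le:
  fixes f :: "'a::euclidean_space \<Rightarrow> complex"
  assumes [measurable]: "f \<in> borel_measurable borel" and q: "q \<ge> 0" and v: "norm v \<ge> 1"
  shows "weighted_power p q (\<lambda>x. f (- v + x)) \<le> ennreal (norm v powr q) * (ennreal (2 powr q) * (weighted_power p q f + weighted_power p 0 f))"
proof -
  have "weighted_power p q (\<lambda>x. f (- v + x)) = (\<integral>\<^sup>+x. ennreal (norm (f x) powr p * norm (v + x) powr q) \<partial>lborel)"
    by (rule weighted_power_translate) measurable
  also have "\<dots> \<le> (\<integral>\<^sup>+x. ennreal (norm v powr q * 2 powr q) * (ennreal (norm (f x) powr p * norm x powr q) + ennreal (norm (f x) powr p * norm x powr 0)) \<partial>lborel)"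
  proof (rule nn_integral_mono_AE)
    show "AE x in lborel. ennreal (norm (f x) powr p * norm (v + x) powr q) \<le>
      ennreal (norm v powr q * 2 powr q) * (ennreal (norm (f x) powr p * norm x powr q) + ennreal (norm (f x) powr p * norm x powr 0))"
      using AE_lborel_singleton[of 0]
    proof eventually_elim
      case (elim x)
      have "norm (v + x) powr q \<le> norm v powr q * 2 powr q * (norm x powr q + 1)"
      proof (cases "norm x \<le> norm v")
        case True
        have "norm (v + x) powr q \<le> (norm v * 2) powr q"
          using q True norm_triangle_ineq[of v x] by (intro powr_mono2) auto
        also have "\<dots> = norm v powr q * 2 powr q * 1" by (simp add: powr_mult)
        also have "\<dots> \<le> norm v powr q * 2 powr q * (norm x powr q + 1)" by (intro mult_left_mono) auto
        finally show ?thesis .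
      next
        case False
        have "norm (v + x) powr q \<le> (2 * norm x) powr q"
          using q False norm_triangle_ineq[of v x] by (intro powr_mono2) auto
        also have "\<dots> = 1 * 2 powr q * norm x powr q" by (simp add: powr_mult)
        also have "\<dots> \<le> norm v powr q * 2 powr q * (norm x powr q + 1)"
          using v q by (intro mult_mono) (auto intro!: ge_one_powr_ge_zero)
        finally show ?thesis .
      qed
      hence "norm (f x) powr p * norm (v + x) powr q \<le> norm (f x) powr p * (norm v powr q * 2 powr q * (norm x powr q + 1))"
        by (intro mult_left_mono) auto
      also have "\<dots> = norm v powr q * 2 powr q * (norm (f x) powr p * norm x powr q + norm (f x) powr p * norm x powr 0)"
        using elim by (simp add: algebra_simps)
      finally show ?case by (simp add: ennreal_leI flip: ennreal_mult ennreal_plus)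
    qed
  qed
  also have "\<dots> = ennreal (norm v powr q * 2 powr q) * (weighted_power p q f + weighted_power p 0 f)"
    unfolding Lp_norm_power_def by (subst nn_integral_cmult, measurable, subst nn_integral_add) auto
  finally show ?thesis by (simp add: ennreal_mult mult.assoc)
qed

lemma weighted_power_translate_ge:
  fixes f :: "'a::euclidean_space \<Rightarrow> complex"
  assumes [measurable]: "f \<in> borel_measurable borel" and q: "q \<ge> 0"
    and R: "\<And>x. norm x > R \<Longrightarrow> f x = 0" and v: "norm v \<ge> 2 * R"
  shows "ennreal ((norm v / 2) powr q) * weighted_power p 0 f \<le> weighted_power p q (\<lambda>x. f (- v + x))"
proof -
  have "ennreal ((norm v / 2) powr q) * weighted_power p 0 f = (\<integral>\<^sup>+x. ennreal ((norm v / 2) powr q) * ennreal (norm (f x) powr p * norm x powr 0) \<partial>lborel)"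
    unfolding Lp_norm_power_def by (rule nn_integral_cmult[symmetric]) measurable
  also have "\<dots> \<le> (\<integral>\<^sup>+x. ennreal (norm (f x) powr p * norm (v + x) powr q) \<partial>lborel)"
  proof (intro nn_integral_mono)
    fix x
    show "ennreal ((norm v / 2) powr q) * ennreal (norm (f x) powr p * norm x powr 0) \<le> ennreal (norm (f x) powr p * norm (v + x) powr q)"
    proof (cases "norm x \<le> R")
      case True
      have "norm v / 2 \<le> norm (v + x)"
        using True v norm_diff_ineq[of v x] by linarith
      hence "(norm v / 2) powr q \<le> norm (v + x) powr q" using q by (intro powr_mono2) auto
      hence "(norm v / 2) powr q * (norm (f x) powr p * norm x powr 0) \<le> norm (v + x) powr q * (norm (f x) powr p * 1)"
        by (intro mult_mono) auto
      thus ?thesis by (simp add: ennreal_leI mult.commute flip: ennreal_mult)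
    qed (use R in auto)
  qed
  also have "\<dots> = weighted_power p q (\<lambda>x. f (- v + x))"
    by (rule weighted_power_translate[symmetric]) measurable
  finally show ?thesis .
qed

text \<open>For a translate by a vector of length \<open>\<rho>\<close> the weights are of the order of \<open>\<rho> powr (\<theta> + a * p)\<close> on the left, where the
support is bounded, and at most of the order of \<open>\<rho> powr \<theta>\<close> on the right; the tail of the fractional Laplacian is
controlled by its norms for the weights \<open>norm x powr \<theta>\<close> and 1. Letting \<open>\<rho>\<close> tend to infinity excludes \<open>a > 0\<close>. The bound
for one fixed \<open>\<epsilon>\<close> suffices.\<close>

theorem form_bound_imp_nonpos:
  fixes p \<theta> a s C :: real
  assumes p: "1 < p" and \<theta>: "0 \<le> \<theta>" "\<theta> < DIM('a::euclidean_space) * (p - 1)" and s: "s > 0"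
    and bd: "\<And>f :: 'a \<Rightarrow> complex. f \<in> test_functions \<Longrightarrow> weighted_power p (\<theta> + a * p) f \<le>
     ennreal 1 * weighted_power p \<theta> (frac_laplacian s f) + ennreal C * weighted_power p \<theta> f"
  shows "a \<le> 0"
proof (rule ccontr)
  assume "\<not> a \<le> 0"
  hence a: "a > 0" by simp
  obtain f :: "'a \<Rightarrow> complex" where f: "f \<in> test_functions" "f 0 \<noteq> 0" using bump_test_function by blast
  note [measurable] = test_functions_measurable[OF f(1)] measurable_frac_laplacian[OF f(1)]
  obtain B R where BR: "B \<ge> 0" "R > 0" "\<And>x. norm (f x) \<le> B" "\<And>x. norm x > R \<Longrightarrow> f x = 0"
    using test_functions_bounded_support[OF f(1)] by metis
  define q where "q = \<theta> + a * p"
  have q: "q \<ge> 0" using a p \<theta> by (simp add: q_def)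
  have \<theta>0: "0 \<le> (0::real)" "0 < DIM('a) * (p - 1)" using p by auto
  define K where "K = ennreal (2 powr \<theta>) * (weighted_power p \<theta> (frac_laplacian s f) + weighted_power p 0 (frac_laplacian s f))
     + ennreal C * (ennreal (2 powr \<theta>) * (weighted_power p \<theta> f + weighted_power p 0 f))"
  have "K < \<infinity>"
    using weighted_power_frac_laplacian_finite[OF f(1) p \<theta> s] weighted_power_frac_laplacian_finite[OF f(1) p \<theta>0 s]
      weighted_power_test_finite[OF f(1), of p \<theta>] weighted_power_test_finite[OF f(1), of p 0] p \<theta>
    by (simp add: K_def ennreal_mult_less_top)
  then obtain k where k: "K = ennreal k" "k \<ge> 0" by (cases K) auto
  have "weighted_power p 0 f < \<infinity>" using weighted_power_test_finite[OF f(1), of p 0] p by simp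
  then obtain w where w: "weighted_power p 0 f = ennreal w" "w \<ge> 0" by (cases "weighted_power p 0 f") auto
  have w0: "w > 0" using weighted_power_test_pos[OF f, of p 0] w by simp
  have main: "\<rho> powr (a * p) * w \<le> 2 powr q * k" if \<rho>: "\<rho> \<ge> 1" "\<rho> \<ge> 2 * R" for \<rho>
  proof -
    obtain e :: 'a where e: "e \<in> Basis" using nonempty_Basis by blast
    define v where "v = \<rho> *\<^sub>R e"
    have v: "norm v = \<rho>" using e \<rho> by (simp add: v_def)
    have fv: "(\<lambda>x. f (- v + x)) \<in> test_functions" using test_functions_affine[OF f(1), of 1 "- v"] by simp
    have "ennreal ((norm v / 2) powr q) * weighted_power p 0 f \<le> weighted_power p q (\<lambda>x. f (- v + x))"
      by (rule weighted_power_translate_ge[OF _ q BR(4)]) (use \<rho> v in auto)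
    also have "\<dots> \<le> ennreal 1 * weighted_power p \<theta> (frac_laplacian s (\<lambda>x. f (- v + x))) + ennreal C * weighted_power p \<theta> (\<lambda>x. f (- v + x))"
      unfolding q_def by (rule bd[OF fv])
    also have "frac_laplacian s (\<lambda>x. f (- v + x)) = (\<lambda>x. frac_laplacian s f (- v + x))"
      by (rule frac_laplacian_translate) measurable
    also have "ennreal 1 * weighted_power p \<theta> (\<lambda>x. frac_laplacian s f (- v + x)) + ennreal C * weighted_power p \<theta> (\<lambda>x. f (- v + x)) \<le>
       ennreal 1 * (ennreal (norm v powr \<theta>) * (ennreal (2 powr \<theta>) * (weighted_power p \<theta> (frac_laplacian s f) + weighted_power p 0 (frac_laplacian s f))))
       + ennreal C * (ennreal (norm v powr \<theta>) * (ennreal (2 powr \<theta>) * (weighted_power p \<theta> f + weighted_power p 0 f)))"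
      using \<theta> v \<rho> by (intro add_mono mult_left_mono weighted_power_translate_le) auto
    also have "\<dots> = ennreal (norm v powr \<theta>) * K"
      unfolding K_def by (simp add: distrib_left mult_ac)
    finally have "ennreal ((\<rho> / 2) powr q * w) \<le> ennreal (\<rho> powr \<theta> * k)"
      using w k v by (simp add: ennreal_mult)
    hence "(\<rho> / 2) powr q * w \<le> \<rho> powr \<theta> * k" using k by (simp add: ennreal_le_iff)
    moreover have "(\<rho> / 2) powr q = \<rho> powr \<theta> * (\<rho> powr (a * p) / 2 powr q)"
      unfolding powr_divide by (simp add: q_def powr_add)
    ultimately have "\<rho> powr \<theta> * (\<rho> powr (a * p) / 2 powr q * w) \<le> \<rho> powr \<theta> * k" by (simp add: mult.assoc)
    hence "\<rho> powr (a * p) / 2 powr q * w \<le> k" using \<rho> by (subst (asm) mult_le_cancel_left_pos) auto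
    thus ?thesis by (simp add: field_simps)
  qed
  \<comment> \<open>a translation so long that \<open>\<rho> powr (a * p)\<close> exceeds the bound \<open>D\<close> obtained from \<open>main\<close>\<close>
  define D where "D = 2 powr q * k / w"
  define \<rho> where "\<rho> = max (max 1 (2 * R)) ((D + 1) powr (1 / (a * p)))"
  have D: "D \<ge> 0" using k w0 by (simp add: D_def)
  have ap: "a * p > 0" using a p by simp
  have "\<rho> powr (a * p) * w \<le> 2 powr q * k" by (rule main) (auto simp: \<rho>_def)
  hence "\<rho> powr (a * p) \<le> D" using w0 by (simp add: D_def field_simps)
  moreover have "D + 1 \<le> \<rho> powr (a * p)"
  proof -
    have "1 / (a * p) * (a * p) = 1" using a p by simp
    hence "D + 1 = ((D + 1) powr (1 / (a * p))) powr (a * p)" using D by (simp only: powr_powr) simp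
    also have "\<dots> \<le> \<rho> powr (a * p)" using ap by (intro powr_mono2) (auto simp: \<rho>_def)
    finally show ?thesis .
  qed
  ultimately show False by simp
qed

text \<open>For \<open>f (c x)\<close> with \<open>c \<ge> 1\<close> the factor of the fractional Laplacian, relative to the left hand side, is
\<open>c powr ((a + 2 * s) * p)\<close>. If \<open>a \<le> - 2 * s\<close> it stays at most 1, while the factor \<open>c powr (a * p)\<close>
of the lower order term tends to 0 as \<open>c\<close> grows. Hence the left hand side is bounded by \<open>\<epsilon>\<close> times a constant for every
\<open>\<epsilon> > 0\<close>, which is absurd.\<close>

theorem form_bound_imp_order:
  fixes p \<theta> a s :: real
  assumes p: "1 < p" and \<theta>: "0 \<le> \<theta>" "\<theta> < DIM('a::euclidean_space) * (p - 1)" and s: "s > 0"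
    and bd: "\<And>\<epsilon>. \<epsilon> > 0 \<Longrightarrow> \<exists>C. \<forall>f \<in> (test_functions :: ('a \<Rightarrow> complex) set). weighted_power p (\<theta> + a * p) f \<le>
     ennreal \<epsilon> * weighted_power p \<theta> (frac_laplacian s f) + ennreal C * weighted_power p \<theta> f"
  shows "- (2 * s) < a"
proof (rule ccontr)
  let ?bd = "\<lambda>\<epsilon> C (f :: 'a \<Rightarrow> complex). weighted_power p (\<theta> + a * p) f \<le>
     ennreal \<epsilon> * weighted_power p \<theta> (frac_laplacian s f) + ennreal C * weighted_power p \<theta> f"
  assume "\<not> - (2 * s) < a"
  hence a: "a + 2 * s \<le> 0" "a < 0" using s by auto
  obtain f :: "'a \<Rightarrow> complex" where f: "f \<in> test_functions" "f 0 \<noteq> 0" using bump_test_function by blast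
  note [measurable] = test_functions_measurable[OF f(1)] measurable_frac_laplacian[OF f(1)]
  define q where "q = \<theta> + a * p"
  let ?L = "weighted_power p q f"
  obtain A where A: "weighted_power p \<theta> (frac_laplacian s f) = ennreal A" "A \<ge> 0"
    using weighted_power_frac_laplacian_finite[OF f(1) p \<theta> s] by (cases "weighted_power p \<theta> (frac_laplacian s f)") auto
  obtain B where B: "weighted_power p \<theta> f = ennreal B" "B \<ge> 0"
    using weighted_power_test_finite[OF f(1), of p \<theta>] p \<theta> by (cases "weighted_power p \<theta> f") auto
  have scaled: "?L \<le> ennreal (\<epsilon> * A + C * (c powr (a * p) * B))"
    if \<epsilon>: "\<epsilon> > 0" and c: "c \<ge> 1" and C: "C \<ge> 0" "\<forall>f \<in> test_functions. ?bd \<epsilon> C f" for \<epsilon> c C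
  proof -
    have c0: "c > 0" using c by simp
    have fc: "(\<lambda>x. f (c *\<^sub>R x)) \<in> test_functions"
      using test_functions_affine[OF f(1), of c 0] c0 by simp
    have "?L \<le> ennreal (\<epsilon> * c powr ((a + 2 * s) * p)) * ennreal A + ennreal (C * c powr (a * p)) * ennreal B"
      unfolding q_def A(1)[symmetric] B(1)[symmetric]
      by (rule form_bound_dilate[OF f(1) c0]) (use \<epsilon> C(1) bspec[OF C(2) fc] in auto)
    also have "\<dots> \<le> ennreal (\<epsilon> * A + C * (c powr (a * p) * B))"
    proof -
      have "(a + 2 * s) * p \<le> 0" using a p by (intro mult_nonpos_nonneg) auto
      hence "c powr ((a + 2 * s) * p) \<le> c powr 0" using c by (intro powr_mono) auto
      hence "\<epsilon> * c powr ((a + 2 * s) * p) * A \<le> \<epsilon> * A"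
        using A(2) c0 \<epsilon> by (intro mult_right_mono) auto
      hence "\<epsilon> * c powr ((a + 2 * s) * p) * A + C * c powr (a * p) * B \<le> \<epsilon> * A + C * (c powr (a * p) * B)"
        by simp
      thus ?thesis using \<epsilon> A(2) B(2) C(1) by (simp add: ennreal_leI flip: ennreal_mult ennreal_plus)
    qed
    finally show ?thesis .
  qed
  have bd': "\<exists>C\<ge>0. \<forall>f \<in> test_functions. ?bd \<epsilon> C f" if e: "\<epsilon> > 0" for \<epsilon>
  proof -
    obtain C where C: "\<forall>f \<in> test_functions. ?bd \<epsilon> C f" using bd[OF e] by blast
    show ?thesis
    proof (intro exI[of _ "max C 0"] conjI ballI)
      fix f :: "'a \<Rightarrow> complex" assume "f \<in> test_functions"
      hence "weighted_power p (\<theta> + a * p) f \<le> ennreal \<epsilon> * weighted_power p \<theta> (frac_laplacian s f) + ennreal C * weighted_power p \<theta> f"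
        using C by blast
      also have "\<dots> \<le> ennreal \<epsilon> * weighted_power p \<theta> (frac_laplacian s f) + ennreal (max C 0) * weighted_power p \<theta> f"
        by (intro add_left_mono mult_right_mono ennreal_leI) auto
      finally show "weighted_power p (\<theta> + a * p) f \<le> ennreal \<epsilon> * weighted_power p \<theta> (frac_laplacian s f) + ennreal (max C 0) * weighted_power p \<theta> f" .
    qed simp
  qed
  have "?L < \<infinity>"
  proof -
    obtain C where C: "C \<ge> 0" "\<forall>f \<in> test_functions. ?bd 1 C f" using bd'[of 1] by auto
    have "?L \<le> ennreal (1 * A + C * (1 powr (a * p) * B))" by (rule scaled[OF _ _ C]) auto
    thus ?thesis by (rule le_less_trans) simp
  qed
  then obtain l where l: "?L = ennreal l" "l \<ge> 0" by (cases ?L) auto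
  have l0: "l > 0" using weighted_power_test_pos[OF f, of p q] l by simp
  \<comment> \<open>\<open>\<epsilon>\<close> and the dilation \<open>c\<close> make each of the two terms on the right at most a quarter of the left hand side \<open>l\<close>\<close>
  define \<epsilon> where "\<epsilon> = l / (4 * (A + 1))"
  have \<epsilon>: "\<epsilon> > 0" using l0 A by (simp add: \<epsilon>_def)
  have \<epsilon>A: "\<epsilon> * A \<le> l / 4" using l0 A by (simp add: \<epsilon>_def field_simps)
  obtain C where C: "C \<ge> 0" "\<forall>f \<in> test_functions. ?bd \<epsilon> C f" using bd'[OF \<epsilon>] by auto
  define y where "y = 4 * (C * B) / l + 1"
  have y: "y \<ge> 1" using C B l0 by (simp add: y_def)
  define c where "c = y powr (- 1 / (a * p))"
  have ap: "a * p < 0" using a p by (simp add: mult_neg_pos)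
  have c: "c \<ge> 1" unfolding c_def using y ap by (intro ge_one_powr_ge_zero) (auto simp: divide_nonpos_neg)
  have cy: "c powr (a * p) = 1 / y" 
  proof -
    have "- 1 / (a * p) * (a * p) = - 1" using a p by simp
    hence "c powr (a * p) = y powr (- 1)" unfolding c_def powr_powr by (simp only:)
    thus ?thesis using y by (simp add: powr_minus_divide)
  qed
  have "C * (c powr (a * p) * B) \<le> l / 4"
    unfolding cy using y l0 by (simp add: y_def field_simps)
  hence "\<epsilon> * A + C * (c powr (a * p) * B) < l" using \<epsilon>A l0 by linarith
  moreover have "ennreal l \<le> ennreal (\<epsilon> * A + C * (c powr (a * p) * B))"
    using scaled[OF \<epsilon> c C] l by simp
  hence "l \<le> \<epsilon> * A + C * (c powr (a * p) * B)"
    using \<epsilon> A B C by (subst (asm) ennreal_le_iff) auto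
  ultimately show False by simp
qed

text \<open>The multiplication by \<open>V\<close> shifts the exponent of the weight to \<open>\<theta> + a * p\<close>. The lower bound on \<open>a\<close> enters through its
consequence \<open>- a * p < n\<close>, the local integrability that \<open>form_bound_sufficient\<close> asks for.\<close>

theorem corollary1p3:
  fixes p p' \<alpha> \<theta> a :: real
    and w V :: "real ^ 'n \<Rightarrow> real"
  assumes "1 < p" and "p' = p / (p - 1)"
    and "0 < \<alpha>" and "\<alpha> < real CARD('n)"
    and "0 \<le> \<theta>" and "\<theta> < (real CARD('n) - 1) * (p - 1)"
    and "w = (\<lambda>x. norm x powr \<theta>)"
    and "a > - real CARD('n) / p + (p' - 1) * \<theta> / p"
    and "V = (\<lambda>x. norm x powr a)"
  shows "(\<forall>\<epsilon>::real. \<epsilon> > 0 \<longrightarrow> (\<exists>C::real. C > 0 \<and> (\<forall>\<phi> \<in> test_functions.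
            Lp_norm_power p w (\<lambda>x. of_real (V x) * \<phi> x)
              \<le> ennreal \<epsilon> * Lp_norm_power p w (frac_laplacian (\<alpha> / 2) \<phi>)
                 + ennreal C * Lp_norm_power p w \<phi>)))
         \<longleftrightarrow> - \<alpha> < a \<and> a \<le> 0"
proof -
  let ?P = "\<lambda>\<epsilon> C. \<forall>\<phi> \<in> (test_functions :: (real ^ 'n \<Rightarrow> complex) set). weighted_power p (\<theta> + a * p) \<phi> \<le>
     ennreal \<epsilon> * weighted_power p \<theta> (frac_laplacian (\<alpha> / 2) \<phi>) + ennreal C * weighted_power p \<theta> \<phi>"
  have s: "\<alpha> / 2 > 0" using assms by simp
  have "\<theta> < (real CARD('n) - 1) * (p - 1)" by fact
  also have "\<dots> \<le> real CARD('n) * (p - 1)" using assms(1) by (intro mult_right_mono) auto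
  finally have \<theta>: "0 \<le> \<theta>" "\<theta> < real DIM(real ^ 'n) * (p - 1)" using assms(5) by auto
  have "(\<forall>\<epsilon>::real. \<epsilon> > 0 \<longrightarrow> (\<exists>C::real. C > 0 \<and> ?P \<epsilon> C)) \<longleftrightarrow> - \<alpha> < a \<and> a \<le> 0"
  proof
    assume H: "\<forall>\<epsilon>::real. \<epsilon> > 0 \<longrightarrow> (\<exists>C::real. C > 0 \<and> ?P \<epsilon> C)"
    obtain C where C: "?P 1 C" using H zero_less_one by blast
    have "a \<le> 0" by (rule form_bound_imp_nonpos[OF assms(1) \<theta> s]) (use C in blast)
    moreover have "- (2 * (\<alpha> / 2)) < a" by (rule form_bound_imp_order[OF assms(1) \<theta> s]) (use H in blast)
    ultimately show "- \<alpha> < a \<and> a \<le> 0" by simp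
  next
    assume a: "- \<alpha> < a \<and> a \<le> 0"
    have b: "0 \<le> - a" using a by simp
    have "p' - 1 = 1 / (p - 1)" using assms(1,2) by (simp add: field_simps)
    hence "0 \<le> (p' - 1) * \<theta> / p" using assms(1,5) by simp
    hence "- real CARD('n) / p < a" using assms(8) by linarith
    hence bp: "(- a) * p < real DIM(real ^ 'n)" using assms(1) by (simp add: field_simps)
    show "\<forall>\<epsilon>::real. \<epsilon> > 0 \<longrightarrow> (\<exists>C::real. C > 0 \<and> ?P \<epsilon> C)"
    proof (intro allI impI)
      fix \<epsilon> :: real assume \<epsilon>: "\<epsilon> > 0"
      have "- a < 2 * (\<alpha> / 2)" using a by simp
      from form_bound_sufficient[OF assms(1) \<theta> b bp s this \<epsilon>] obtain C where
        "C > 0" "\<And>f :: real ^ 'n \<Rightarrow> complex. f \<in> test_functions \<Longrightarrow>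
        weighted_power p (\<theta> - (- a) * p) f \<le> ennreal \<epsilon> * weighted_power p \<theta> (frac_laplacian (\<alpha> / 2) f) + ennreal C * weighted_power p \<theta> f"
        by blast
      thus "\<exists>C::real. C > 0 \<and> ?P \<epsilon> C" by (intro exI[of _ C]) simp
    qed
  qed
  thus ?thesis unfolding assms(7,9) weighted_power_multiplier .
qed

end
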